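(* Let $\mathcal A$ and $\mathcal B$ be unital C$^*$-algebras generated by finite families of self-adjoint elements $x_1,\ldots,x_n$ and $y_1,\ldots,y_m$ respectively, and let $\mathcal D=\mathcal A\oplus\mathcal B$ be their orthogonal (direct) sum, generated by a finite family of self-adjoint elements $z_1,\ldots,z_p$. Then $$\mathfrak K_{top}^{(2)}(z_1,\ldots,z_p)\le\mathfrak K_{top}^{(2)}(x_1,\ldots,x_n)+\mathfrak K_{top}^{(2)}(y_1,\ldots,y_m).$$
   Context: Microstates. Let $\mathcal A$ be a unital C$^*$-algebra and $x_1,\dots,x_n$ self-adjoint elements of $\mathcal A$. Let $\{P_r\}_{r\ge1}$ enumerate all noncommutative polynomials in the indeterminates $X_1,\dots,X_n$ whose coefficients have rational real and imaginary parts (constants allowed). $\mathcal M_k^{s.a.}(\mathbb C)$ is the set of self-adjoint $k\times k$ complex matrices and $\tau_k=\frac1k\mathrm{Tr}$. For $R,\epsilon>0$ and $r,k\in\mathbb N$, $\Gamma_R^{(top)}(x_1,\dots,x_n;k,\epsilon,P_1,\dots,P_r)$ is the set of $(A_1,\dots,A_n)\in\mathcal M_k^{s.a.}(\mathbb C)^n$ with $\max_i\|A_i\|\le R$ and $\big|\|P_j(A_1,\dots,A_n)\|-\|P_j(x_1,\dots,x_n)\|\big|\le\epsilon$ for $1\le j\le r$. Covering numbers. On $\mathcal M_k(\mathbb C)^n$ put $\|(A_i)\|_2=(\sum_i\tau_k(A_i^*A_i))^{1/2}$. The $\omega$-orbit ball centred at $(B_i)$ is the set of $(A_i)$ such that some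 unitary $W\in\mathcal M_k(\mathbb C)$ satisfies $\|(A_i)-(WB_iW^* )\|_2<\omega$; for $\Sigma\subseteq\mathcal M_k(\mathbb C)^n$, $o_2(\Sigma,\omega)$ is the minimal number of $\omega$-orbit balls centred at points of $\Sigma$ covering $\Sigma$. Convention $\log 0=-\infty$ (and $-\infty+a=-\infty$). Topological orbit dimension: $\mathfrak K^{(2)}_{top}(x_1,\dots,x_n;\omega)=\sup_{R>0}\inf_{\epsilon>0,r\in\mathbb N}\limsup_{k\to\infty}\frac{\log o_2(\Gamma_R^{(top)}(x_1,\dots,x_n;k,\epsilon,P_1,\dots,P_r),\omega)}{k^2}$ and $\mathfrak K_{top}^{(2)}(x_1,\dots,x_n)=\limsup_{\omega\to0^+}\mathfrak K_{top}^{(2)}(x_1,\dots,x_n;\omega)$. *)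

theory Defs
  imports "HOL-Analysis.Analysis" "HOL-Library.List_Lexorder" "Jordan_Normal_Form.Matrix"
begin

record 'a calg =
  cadd   :: "'a \<Rightarrow> 'a \<Rightarrow> 'a"
  cmul   :: "'a \<Rightarrow> 'a \<Rightarrow> 'a"
  cscale :: "complex \<Rightarrow> 'a \<Rightarrow> 'a"
  cstar  :: "'a \<Rightarrow> 'a"
  cnorm  :: "'a \<Rightarrow> real"
  czero  :: "'a"
  cone   :: "'a"

definition csub :: "'a calg \<Rightarrow> 'a \<Rightarrow> 'a \<Rightarrow> 'a" where
  "csub A a b = cadd A a (cscale A (-1) b)"

definition unital_cstar_algebra :: "'a calg \<Rightarrow> bool" where
  "unital_cstar_algebra A \<longleftrightarrow>
     \<comment> \<open>complex vector space\<close>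
     (\<forall>a b c. cadd A (cadd A a b) c = cadd A a (cadd A b c)) \<and>
     (\<forall>a b. cadd A a b = cadd A b a) \<and>
     (\<forall>a. cadd A (czero A) a = a) \<and>
     (\<forall>a. cadd A a (cscale A (-1) a) = czero A) \<and>
     (\<forall>s t a. cscale A s (cscale A t a) = cscale A (s * t) a) \<and>
     (\<forall>a. cscale A 1 a = a) \<and>
     (\<forall>s a b. cscale A s (cadd A a b) = cadd A (cscale A s a) (cscale A s b)) \<and>
     (\<forall>s t a. cscale A (s + t) a = cadd A (cscale A s a) (cscale A t a)) \<and>
     \<comment> \<open>associative unital algebra\<close>
     (\<forall>a b c. cmul A (cmul A a b) c = cmul A a (cmul A b c)) \<and>
     (\<forall>a b c. cmul A a (cadd A b c) = cadd A (cmul A a b) (cmul A a c)) \<and>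
     (\<forall>a b c. cmul A (cadd A a b) c = cadd A (cmul A a c) (cmul A b c)) \<and>
     (\<forall>s a b. cmul A (cscale A s a) b = cscale A s (cmul A a b)) \<and>
     (\<forall>s a b. cmul A a (cscale A s b) = cscale A s (cmul A a b)) \<and>
     (\<forall>a. cmul A (cone A) a = a) \<and> (\<forall>a. cmul A a (cone A) = a) \<and>
     cone A \<noteq> czero A \<and>
     \<comment> \<open>involution\<close>
     (\<forall>a b. cstar A (cadd A a b) = cadd A (cstar A a) (cstar A b)) \<and>
     (\<forall>s a. cstar A (cscale A s a) = cscale A (cnj s) (cstar A a)) \<and>
     (\<forall>a b. cstar A (cmul A a b) = cmul A (cstar A b) (cstar A a)) \<and>
     (\<forall>a. cstar A (cstar A a) = a) \<and>
     \<comment> \<open>submultiplicative norm\<close>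
     (\<forall>a. cnorm A a = 0 \<longleftrightarrow> a = czero A) \<and>
     (\<forall>a. 0 \<le> cnorm A a) \<and>
     (\<forall>a b. cnorm A (cadd A a b) \<le> cnorm A a + cnorm A b) \<and>
     (\<forall>s a. cnorm A (cscale A s a) = cmod s * cnorm A a) \<and>
     (\<forall>a b. cnorm A (cmul A a b) \<le> cnorm A a * cnorm A b) \<and>
     \<comment> \<open>completeness\<close>
     (\<forall>f :: nat \<Rightarrow> 'a.
        (\<forall>e>0. \<exists>N. \<forall>m\<ge>N. \<forall>n\<ge>N. cnorm A (csub A (f m) (f n)) < e) \<longrightarrow>
        (\<exists>l. \<forall>e>0. \<exists>N. \<forall>n\<ge>N. cnorm A (csub A (f n) l) < e)) \<and>
     \<comment> \<open>C*-identity\<close>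
     (\<forall>a. cnorm A (cmul A (cstar A a) a) = (cnorm A a)\<^sup>2)"

definition self_adjoint :: "'a calg \<Rightarrow> 'a \<Rightarrow> bool" where
  "self_adjoint A a \<longleftrightarrow> cstar A a = a"

definition cdirect_sum :: "'a calg \<Rightarrow> 'b calg \<Rightarrow> ('a \<times> 'b) calg" where
  "cdirect_sum A B =
     \<lparr> cadd = (\<lambda>u v. (cadd A (fst u) (fst v), cadd B (snd u) (snd v))),
       cmul = (\<lambda>u v. (cmul A (fst u) (fst v), cmul B (snd u) (snd v))),
       cscale = (\<lambda>s u. (cscale A s (fst u), cscale B s (snd u))),
       cstar = (\<lambda>u. (cstar A (fst u), cstar B (snd u))),
       cnorm = (\<lambda>u. max (cnorm A (fst u)) (cnorm B (snd u))),
       czero = (czero A, czero B),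
       cone = (cone A, cone B) \<rparr>"

text \<open>A noncommutative polynomial in X_0,...,X_(n-1): a finitely supported
  coefficient function on words (lists of variable indices).\<close>

definition ncpolys :: "nat \<Rightarrow> (nat list \<Rightarrow> complex) set" where
  "ncpolys n = {P. finite {w. P w \<noteq> 0} \<and> (\<forall>w. P w \<noteq> 0 \<longrightarrow> set w \<subseteq> {..<n})}"

definition rat_ncpolys :: "nat \<Rightarrow> (nat list \<Rightarrow> complex) set" where
  "rat_ncpolys n = {P \<in> ncpolys n. \<forall>w. Re (P w) \<in> \<rat> \<and> Im (P w) \<in> \<rat>}"

definition ncmon :: "'a calg \<Rightarrow> 'a list \<Rightarrow> nat list \<Rightarrow> 'a" where
  "ncmon A x w = foldr (\<lambda>i acc. cmul A (x ! i) acc) w (cone A)"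

definition ncpoly_eval :: "'a calg \<Rightarrow> 'a list \<Rightarrow> (nat list \<Rightarrow> complex) \<Rightarrow> 'a" where
  "ncpoly_eval A x P =
     foldr (\<lambda>w acc. cadd A (cscale A (P w) (ncmon A x w)) acc)
           (sorted_list_of_set {w. P w \<noteq> 0}) (czero A)"

text \<open>x generates A as a unital C*-algebra: the *-polynomials in x are norm dense
  (x self-adjoint, so ordinary noncommutative polynomials suffice).\<close>
definition generates :: "'a calg \<Rightarrow> 'a list \<Rightarrow> bool" where
  "generates A x \<longleftrightarrow>
     (\<forall>a. \<forall>e>0. \<exists>P\<in>ncpolys (length x). cnorm A (csub A a (ncpoly_eval A x P)) < e)"

text \<open>M_k(C) as a (non-normed) calg structure on complex mat; used only to evaluate
  polynomials on k x k matrices.\<close>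
definition matalg :: "nat \<Rightarrow> complex mat calg" where
  "matalg k = \<lparr> cadd = (+), cmul = (*), cscale = (\<cdot>\<^sub>m),
       cstar = (\<lambda>A. mat (dim_col A) (dim_row A) (\<lambda>(i,j). cnj (A $$ (j,i)))),
       cnorm = (\<lambda>_. 0), czero = 0\<^sub>m k k, cone = 1\<^sub>m k \<rparr>"

definition madj :: "complex mat \<Rightarrow> complex mat" where
  "madj A = mat (dim_col A) (dim_row A) (\<lambda>(i,j). cnj (A $$ (j,i)))"

definition mtrace :: "complex mat \<Rightarrow> complex" where
  "mtrace A = (\<Sum>i<dim_row A. A $$ (i,i))"

definition vnorm :: "complex vec \<Rightarrow> real" where
  "vnorm v = sqrt (\<Sum>i<dim_vec v. (cmod (v $ i))\<^sup>2)"

definition opnorm :: "complex mat \<Rightarrow> real" where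
  "opnorm A = Sup {vnorm (A *\<^sub>v v) | v. dim_vec v = dim_col A \<and> vnorm v \<le> 1}"

definition unitary_mat :: "nat \<Rightarrow> complex mat \<Rightarrow> bool" where
  "unitary_mat k W \<longleftrightarrow> W \<in> carrier_mat k k \<and> madj W * W = 1\<^sub>m k \<and> W * madj W = 1\<^sub>m k"

definition hs2 :: "nat \<Rightarrow> complex mat list \<Rightarrow> real" where
  "hs2 k A = sqrt (Re (\<Sum>i<length A. mtrace (madj (A ! i) * (A ! i)) / of_nat k))"

definition tuples :: "nat \<Rightarrow> nat \<Rightarrow> complex mat list set" where
  "tuples n k = {A. length A = n \<and> (\<forall>i<n. A ! i \<in> carrier_mat k k)}"

definition Gamma_top ::
  "'a calg \<Rightarrow> 'a list \<Rightarrow> real \<Rightarrow> nat \<Rightarrow> real \<Rightarrow> (nat \<Rightarrow> nat list \<Rightarrow> complex) \<Rightarrow> nat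
     \<Rightarrow> complex mat list set" where
  "Gamma_top Alg x R k \<epsilon> P r =
     {A \<in> tuples (length x) k.
        (\<forall>i<length x. madj (A ! i) = A ! i) \<and>
        (\<forall>i<length x. opnorm (A ! i) \<le> R) \<and>
        (\<forall>j\<in>{1..r}. \<bar>opnorm (ncpoly_eval (matalg k) A (P j))
                        - cnorm Alg (ncpoly_eval Alg x (P j))\<bar> \<le> \<epsilon>)}"

definition orbit_ball :: "nat \<Rightarrow> real \<Rightarrow> complex mat list \<Rightarrow> complex mat list set" where
  "orbit_ball k \<omega> B =
     {A \<in> tuples (length B) k. \<exists>W. unitary_mat k W \<and>
        hs2 k (map2 (-) A (map (\<lambda>Bi. W * Bi * madj W) B)) < \<omega>}"

definition o2 :: "nat \<Rightarrow> complex mat list set \<Rightarrow> real \<Rightarrow> nat" where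
  "o2 k \<Sigma> \<omega> = (LEAST N. \<exists>C. finite C \<and> card C = N \<and> C \<subseteq> \<Sigma> \<and> \<Sigma> \<subseteq> (\<Union>B\<in>C. orbit_ball k \<omega> B))"

definition log_ratio :: "nat \<Rightarrow> nat \<Rightarrow> ereal" where
  "log_ratio N k = (if N = 0 then -\<infinity> else ereal (ln (real N) / (real k)\<^sup>2))"

definition Ktop_omega ::
  "'a calg \<Rightarrow> 'a list \<Rightarrow> (nat \<Rightarrow> nat list \<Rightarrow> complex) \<Rightarrow> real \<Rightarrow> ereal" where
  "Ktop_omega Alg x P \<omega> =
     (SUP R\<in>{0<..}. INF p\<in>{0<..} \<times> {1..}.
        limsup (\<lambda>k. log_ratio (o2 k (Gamma_top Alg x R k (fst p) P (snd p)) \<omega>) k))"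

definition Ktop :: "'a calg \<Rightarrow> 'a list \<Rightarrow> (nat \<Rightarrow> nat list \<Rightarrow> complex) \<Rightarrow> ereal" where
  "Ktop Alg x P = Limsup (at_right 0) (\<lambda>\<omega>. Ktop_omega Alg x P \<omega>)"

definition eplus :: "ereal \<Rightarrow> ereal \<Rightarrow> ereal" where
  "eplus a b = (if a = -\<infinity> \<or> b = -\<infinity> then -\<infinity> else a + b)"

definition enumerates :: "nat \<Rightarrow> (nat \<Rightarrow> nat list \<Rightarrow> complex) \<Rightarrow> bool" where
  "enumerates n P \<longleftrightarrow> bij_betw P {1..} (rat_ncpolys n)"

end

theory Submission
  imports Defs
begin

text \<open>A polynomial in \<open>z\<close> approximating the central projection \<open>(1, 0)\<close> becomes an almost projection
  when it is evaluated at a microstate \<open>C\<close> of \<open>z\<close>.  An exact projection near it splits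
  \<open>k\<close>-dimensional space into orthogonal summands of dimensions \<open>k1 + k2 = k\<close>.  Compressing to them
  polynomials in \<open>C\<close> that approximate \<open>(x_i, 0)\<close> and \<open>(0, y_j)\<close> yields microstates of \<open>x\<close> and \<open>y\<close>,
  from which \<open>C\<close> is recovered up to a small error and a unitary conjugation.  So the covering number
  of the microstates of \<open>z\<close> of size \<open>k\<close> is at most the sum of the products of those of \<open>x\<close> and \<open>y\<close> of
  sizes \<open>k1, k2 \<le> k\<close>.  To avoid explicit tolerances, the splitting is derived by contradiction from a
  sequence of microstates of \<open>z\<close> with tolerances tending to 0: modulo null sequences, sequences of
  matrices represent the direct sum exactly.\<close>

subsection \<open>Operator and Frobenius norms\<close>

text \<open>Counting orbits instead of points is what makes the estimate work: the position of the
  two summands inside the \<open>k\<close>-dimensional space costs nothing, because any two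
  splittings with equal dimensions are unitarily conjugate. Only the pair of sizes and the pair of
  covering centres have to be counted. There are at most k^2 pairs of sizes, which contribute 2 ln
  k, negligible against k^2. One obstacle is that the bounds for \<open>x\<close> and
  \<open>y\<close> hold for large sizes only, whereas k1 or k2 may stay small while k grows. A
  finite value is repaired by a constant factor, together with k1^2, k2^2 \<le> k^2; this requires
  nonnegative bounds, and a negative dimension means empty microstate spaces because the logarithm
  of a positive integer is nonnegative. The suprema over the norm cut-off do not interact: for
  \<open>x\<close> and \<open>y\<close> one cut-off strictly above the norms of the generators is
  enough, whatever cut-off is imposed on \<open>z\<close>.\<close>

lemma assoc_mult_mat_dim:
  fixes A :: "'a::semiring_0 mat"
  assumes "dim_col A = dim_row B" "dim_col B = dim_row C"
  shows "(A * B) * C = A * (B * C)"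
  using assms by (intro assoc_mult_mat) auto

lemma add_mult_distrib_mat_dim:
  fixes A :: "'a::semiring_0 mat"
  assumes "dim_row A = dim_row B" "dim_col A = dim_col B" "dim_col B = dim_row C"
  shows "(A + B) * C = A * C + B * C"
  by (rule add_mult_distrib_mat) (use assms in auto)

lemma mult_add_distrib_mat_dim:
  fixes A :: "'a::semiring_0 mat"
  assumes "dim_row B = dim_row C" "dim_col B = dim_col C" "dim_col A = dim_row C"
  shows "A * (B + C) = A * B + A * C"
  by (rule mult_add_distrib_mat) (use assms in auto)

lemma minus_mult_distrib_mat_dim:
  fixes A :: "'a::ring mat"
  assumes "dim_row A = dim_row B" "dim_col A = dim_col B" "dim_col B = dim_row C"
  shows "(A - B) * C = A * C - B * C"
  by (rule minus_mult_distrib_mat) (use assms in auto)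

lemma mult_minus_distrib_mat_dim:
  fixes A :: "'a::ring mat"
  assumes "dim_row B = dim_row C" "dim_col B = dim_col C" "dim_col A = dim_row C"
  shows "A * (B - C) = A * B - A * C"
  by (rule mult_minus_distrib_mat) (use assms in auto)

lemma smult_mult_mat_dim:
  fixes A :: "'a::comm_semiring_0 mat"
  assumes "dim_col A = dim_row B"
  shows "(c \<cdot>\<^sub>m A) * B = c \<cdot>\<^sub>m (A * B)"
  by (rule mult_smult_assoc_mat) (use assms in auto)

lemma mult_smult_mat_dim:
  fixes A :: "'a::comm_semiring_0 mat"
  assumes "dim_col A = dim_row B"
  shows "A * (c \<cdot>\<^sub>m B) = c \<cdot>\<^sub>m (A * B)"
  by (rule mult_smult_distrib) (use assms in auto)

text \<open>The side conditions are equations between dimensions, since carrier premises would leave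
  dimension variables that the simplifier cannot instantiate. Together the rules turn an expression
  into a sum of right-nested products.\<close>

lemmas mat_dim_simps = assoc_mult_mat_dim add_mult_distrib_mat_dim mult_add_distrib_mat_dim
  minus_mult_distrib_mat_dim mult_minus_distrib_mat_dim smult_mult_mat_dim mult_smult_mat_dim

section \<open>Adjoint matrices\<close>

lemma dim_madj [simp]: "dim_row (madj A) = dim_col A" "dim_col (madj A) = dim_row A"
  by (simp_all add: madj_def)

lemma madj_carrier [simp]: "madj A \<in> carrier_mat n m \<longleftrightarrow> A \<in> carrier_mat m n"
  using carrier_matI carrier_matD dim_madj by metis

lemma index_madj [simp]: "i < dim_col A \<Longrightarrow> j < dim_row A \<Longrightarrow> madj A $$ (i, j) = cnj (A $$ (j, i))"
  by (simp add: madj_def)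

lemma madj_madj [simp]: "madj (madj A) = A"
  by (rule eq_matI) auto

lemma index_mult_mat_sum:
  "i < dim_row A \<Longrightarrow> j < dim_col B \<Longrightarrow> dim_col A = dim_row B \<Longrightarrow>
    (A * B) $$ (i, j) = (\<Sum>l<dim_row B. A $$ (i, l) * B $$ (l, j))"
  by (simp add: scalar_prod_def atLeast0LessThan)

lemma madj_mult: "dim_col A = dim_row B \<Longrightarrow> madj (A * B) = madj B * madj A"
  by (rule eq_matI) (simp_all add: index_mult_mat_sum mult.commute del: index_mult_mat(1))

lemma madj_add: "dim_row A = dim_row B \<Longrightarrow> dim_col A = dim_col B \<Longrightarrow> madj (A + B) = madj A + madj B"
  by (rule eq_matI) auto

lemma madj_minus: "dim_row A = dim_row B \<Longrightarrow> dim_col A = dim_col B \<Longrightarrow> madj (A - B) = madj A - madj B"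
  by (rule eq_matI) auto

lemma madj_smult: "madj (c \<cdot>\<^sub>m A) = cnj c \<cdot>\<^sub>m madj A"
  by (rule eq_matI) auto

lemma madj_one [simp]: "madj (1\<^sub>m k) = 1\<^sub>m k"
  by (rule eq_matI) auto

lemma madj_zero [simp]: "madj (0\<^sub>m k l) = 0\<^sub>m l k"
  by (rule eq_matI) auto

section \<open>Inner product and Euclidean norm of vectors\<close>

definition cinner :: "complex vec \<Rightarrow> complex vec \<Rightarrow> complex" where
  "cinner u v = (\<Sum>i<dim_vec v. cnj (u $ i) * v $ i)"

lemma vnorm_L2: "vnorm v = L2_set (\<lambda>i. cmod (v $ i)) {..<dim_vec v}"
  by (simp add: vnorm_def L2_set_def)

lemma vnorm_nonneg [simp]: "0 \<le> vnorm v"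
  by (simp add: vnorm_L2)

lemma cinner_self: "cinner v v = complex_of_real ((vnorm v)\<^sup>2)"
  by (simp add: cinner_def vnorm_def sum_nonneg complex_norm_square mult.commute of_real_sum del: of_real_power)

lemma norm_cinner_le: "dim_vec u = dim_vec v \<Longrightarrow> cmod (cinner u v) \<le> vnorm u * vnorm v"
proof -
  assume d: "dim_vec u = dim_vec v"
  have "cmod (cinner u v) \<le> (\<Sum>i<dim_vec v. \<bar>cmod (u $ i)\<bar> * \<bar>cmod (v $ i)\<bar>)"
    unfolding cinner_def by (rule order.trans[OF norm_sum]) (simp add: norm_mult)
  also have "\<dots> \<le> vnorm u * vnorm v"
    unfolding vnorm_L2 d by (rule L2_set_mult_ineq)
  finally show ?thesis .
qed

lemma index_mult_mat_vec_sum: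
  "i < dim_row A \<Longrightarrow> dim_vec v = dim_col A \<Longrightarrow> (A *\<^sub>v v) $ i = (\<Sum>j<dim_col A. A $$ (i, j) * v $ j)"
  by (simp add: scalar_prod_def atLeast0LessThan)

lemma cinner_madj:
  assumes "dim_vec u = dim_row A" "dim_vec v = dim_col A"
  shows "cinner (madj A *\<^sub>v u) v = cinner u (A *\<^sub>v v)"
proof -
  have "cinner (madj A *\<^sub>v u) v = (\<Sum>j<dim_col A. \<Sum>i<dim_row A. A $$ (i, j) * cnj (u $ i) * v $ j)"
    using assms by (simp add: cinner_def index_mult_mat_vec_sum sum_distrib_right del: index_mult_mat_vec)
  also have "\<dots> = (\<Sum>i<dim_row A. \<Sum>j<dim_col A. A $$ (i, j) * cnj (u $ i) * v $ j)"
    by (rule sum.swap)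
  also have "\<dots> = cinner u (A *\<^sub>v v)"
    using assms by (simp add: cinner_def index_mult_mat_vec_sum sum_distrib_left mult_ac del: index_mult_mat_vec)
  finally show ?thesis .
qed

lemma vnorm_add: "dim_vec u = dim_vec v \<Longrightarrow> vnorm (u + v) \<le> vnorm u + vnorm v"
proof -
  assume d: "dim_vec u = dim_vec v"
  have "vnorm (u + v) \<le> L2_set (\<lambda>i. cmod (u $ i) + cmod (v $ i)) {..<dim_vec v}"
    unfolding vnorm_L2 by (simp, rule L2_set_mono) (auto intro: norm_triangle_ineq)
  also have "\<dots> \<le> vnorm u + vnorm v"
    unfolding vnorm_L2 d by (rule L2_set_triangle_ineq)
  finally show ?thesis .
qed

lemma vnorm_smult: "vnorm (c \<cdot>\<^sub>v v) = cmod c * vnorm v"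
proof -
  have "vnorm (c \<cdot>\<^sub>v v) = L2_set (\<lambda>i. cmod c * cmod (v $ i)) {..<dim_vec v}"
    unfolding vnorm_L2 by (intro L2_set_cong) (auto simp: norm_mult)
  then show ?thesis by (simp add: vnorm_L2 L2_set_right_distrib)
qed

lemma vnorm_eq_0D: "vnorm v = 0 \<Longrightarrow> i < dim_vec v \<Longrightarrow> v $ i = 0"
  by (auto simp: vnorm_L2 L2_set_eq_0_iff)

text \<open>Grouping the entries by columns lets \<open>frob_mult_right\<close> treat a product one
  column at a time; \<open>frob_square\<close> recovers the sum over all entries.\<close>

definition frob :: "complex mat \<Rightarrow> real" where
  "frob A = L2_set (\<lambda>j. vnorm (col A j)) {..<dim_col A}"

lemma frob_nonneg [simp]: "0 \<le> frob A"
  by (simp add: frob_def)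

lemma frob_square: "(frob A)\<^sup>2 = (\<Sum>j<dim_col A. \<Sum>i<dim_row A. (cmod (A $$ (i, j)))\<^sup>2)"
  by (simp add: frob_def L2_set_def sum_nonneg vnorm_def)

lemma frob_madj: "frob (madj A) = frob A"
proof -
  have "(frob (madj A))\<^sup>2 = (frob A)\<^sup>2"
    unfolding frob_square by (simp, rule sum.swap)
  then show ?thesis by simp
qed

text \<open>Cauchy-Schwarz in every row. The bound shows that the set in the definition of
  \<open>opnorm\<close> is bounded above, so that its \<open>Sup\<close> is an upper bound.\<close>

lemma vnorm_mult_frob: 
  assumes "dim_vec v = dim_col A" 
  shows "vnorm (A *\<^sub>v v) \<le> frob A * vnorm v"
proof -
  have "(vnorm (A *\<^sub>v v))\<^sup>2 = (\<Sum>i<dim_row A. (cmod ((A *\<^sub>v v) $ i))\<^sup>2)"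
    by (simp add: vnorm_def sum_nonneg)
  also have "\<dots> \<le> (\<Sum>i<dim_row A. (vnorm (row A i))\<^sup>2 * (vnorm v)\<^sup>2)"
  proof (rule sum_mono)
    fix i assume i: "i \<in> {..<dim_row A}"
    have "cmod ((A *\<^sub>v v) $ i) \<le> (\<Sum>j<dim_col A. \<bar>cmod (row A i $ j)\<bar> * \<bar>cmod (v $ j)\<bar>)"
      using i assms by (simp add: index_mult_mat_vec_sum del: index_mult_mat_vec)
        (rule order.trans[OF norm_sum], simp add: norm_mult)
    also have "\<dots> \<le> vnorm (row A i) * vnorm v"
      using L2_set_mult_ineq[of "\<lambda>j. cmod (row A i $ j)" "\<lambda>j. cmod (v $ j)" "{..<dim_col A}"] assms
      by (simp add: vnorm_L2)
    finally show "(cmod ((A *\<^sub>v v) $ i))\<^sup>2 \<le> (vnorm (row A i))\<^sup>2 * (vnorm v)\<^sup>2"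
      by (simp add: power_mono flip: power_mult_distrib)
  qed
  also have "\<dots> = (frob A * vnorm v)\<^sup>2"
    unfolding power_mult_distrib frob_square sum_distrib_right[symmetric]
    by (subst sum.swap) (simp add: vnorm_def sum_nonneg)
  finally show ?thesis
    by (rule power2_le_imp_le) simp
qed

section \<open>The operator norm and its interplay with the Frobenius norm\<close>

lemma vnorm_mult_mat_le:
  assumes "dim_vec v = dim_col A"
  shows "vnorm (A *\<^sub>v v) \<le> opnorm A * vnorm v"
proof (cases "vnorm v = 0")
  case True
  then show ?thesis using vnorm_mult_frob[OF assms] vnorm_nonneg[of "A *\<^sub>v v"] by simp
next
  case False
  then have pos: "vnorm v > 0" using vnorm_nonneg[of v] by linarith
  let ?w = "complex_of_real (1 / vnorm v) \<cdot>\<^sub>v v"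
  have "bdd_above {vnorm (A *\<^sub>v v) | v. dim_vec v = dim_col A \<and> vnorm v \<le> 1}"
    by (rule bdd_aboveI[of _ "frob A"])
      (auto intro!: order.trans[OF vnorm_mult_frob] mult_left_le)
  moreover have "vnorm ?w = 1" using pos unfolding vnorm_smult by (simp del: of_real_divide)
  ultimately have "vnorm (A *\<^sub>v ?w) \<le> opnorm A"
    unfolding opnorm_def by (intro cSup_upper) (use assms in auto)
  moreover have "A *\<^sub>v ?w = complex_of_real (1 / vnorm v) \<cdot>\<^sub>v (A *\<^sub>v v)"
    by (rule mult_mat_vec[OF _ carrier_vecI]) (use assms in auto)
  ultimately show ?thesis
    using pos by (simp add: vnorm_smult field_simps del: of_real_divide)
qed

lemma opnorm_leI:
  assumes "\<And>v. dim_vec v = dim_col A \<Longrightarrow> vnorm (A *\<^sub>v v) \<le> c * vnorm v" and "0 \<le> c"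
  shows "opnorm A \<le> c"
  unfolding opnorm_def
proof (rule cSup_least)
  show "{vnorm (A *\<^sub>v v) | v. dim_vec v = dim_col A \<and> vnorm v \<le> 1} \<noteq> {}"
    using index_zero_vec(2)[of "dim_col A"] by (auto intro!: exI[of _ "0\<^sub>v (dim_col A)"] simp: vnorm_def)
next
  fix t assume "t \<in> {vnorm (A *\<^sub>v v) | v. dim_vec v = dim_col A \<and> vnorm v \<le> 1}"
  then show "t \<le> c" using assms mult_left_le[of _ c] by (auto intro: order.trans)
qed

lemma opnorm_nonneg [simp]: "0 \<le> opnorm A"
proof -
  have "vnorm (A *\<^sub>v 0\<^sub>v (dim_col A)) \<le> opnorm A"
    unfolding opnorm_def
    by (rule cSup_upper[OF _ bdd_aboveI[of _ "frob A"]])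
      (auto intro!: exI[of _ "0\<^sub>v (dim_col A)"] order.trans[OF vnorm_mult_frob] mult_left_le simp: vnorm_def[of "0\<^sub>v (dim_col A)"])
  then show ?thesis using vnorm_nonneg order.trans by blast
qed

lemma opnorm_le_frob: "opnorm A \<le> frob A"
  by (rule opnorm_leI) (auto intro: vnorm_mult_frob)

lemma opnorm_add:
  assumes "dim_row A = dim_row B" "dim_col A = dim_col B"
  shows "opnorm (A + B) \<le> opnorm A + opnorm B"
proof (rule opnorm_leI)
  fix v :: "complex vec" assume v: "dim_vec v = dim_col (A + B)"
  have "(A + B) *\<^sub>v v = A *\<^sub>v v + B *\<^sub>v v"
    by (rule add_mult_distrib_mat_vec[OF _ _ carrier_vecI]) (use assms v in auto)
  then have "vnorm ((A + B) *\<^sub>v v) \<le> vnorm (A *\<^sub>v v) + vnorm (B *\<^sub>v v)"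
    using assms by (simp add: vnorm_add)
  then show "vnorm ((A + B) *\<^sub>v v) \<le> (opnorm A + opnorm B) * vnorm v"
    using vnorm_mult_mat_le[of v A] vnorm_mult_mat_le[of v B] assms v by (simp add: algebra_simps)
qed simp

lemma opnorm_mult:
  assumes "dim_col A = dim_row B"
  shows "opnorm (A * B) \<le> opnorm A * opnorm B"
proof (rule opnorm_leI)
  fix v :: "complex vec" assume v: "dim_vec v = dim_col (A * B)"
  have "(A * B) *\<^sub>v v = A *\<^sub>v (B *\<^sub>v v)"
    by (rule assoc_mult_mat_vec[OF _ _ carrier_vecI]) (use assms v in auto)
  then have "vnorm ((A * B) *\<^sub>v v) \<le> opnorm A * vnorm (B *\<^sub>v v)"
    using assms vnorm_mult_mat_le by simp
  also have "\<dots> \<le> opnorm A * (opnorm B * vnorm v)"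
    using v by (intro mult_left_mono vnorm_mult_mat_le) auto
  finally show "vnorm ((A * B) *\<^sub>v v) \<le> opnorm A * opnorm B * vnorm v" by simp
qed simp

lemma opnorm_smult_le: "opnorm (c \<cdot>\<^sub>m A) \<le> cmod c * opnorm A"
proof (rule opnorm_leI)
  fix v :: "complex vec" assume v: "dim_vec v = dim_col (c \<cdot>\<^sub>m A)"
  have "(c \<cdot>\<^sub>m A) *\<^sub>v v = c \<cdot>\<^sub>v (A *\<^sub>v v)"
    by (rule eq_vecI) (use v in \<open>auto simp: index_mult_mat_vec_sum sum_distrib_left mult_ac simp del: index_mult_mat_vec\<close>)
  then show "vnorm ((c \<cdot>\<^sub>m A) *\<^sub>v v) \<le> cmod c * opnorm A * vnorm v"
    using vnorm_mult_mat_le[of v A] v by (simp add: vnorm_smult mult_left_mono mult.assoc)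
qed simp

lemma minus_mat_eq_add_smult:
  fixes A B :: "complex mat"
  assumes "dim_row A = dim_row B" "dim_col A = dim_col B"
  shows "A - B = A + (-1) \<cdot>\<^sub>m B"
  by (rule eq_matI) (use assms in auto)

lemma opnorm_minus:
  assumes "dim_row A = dim_row B" "dim_col A = dim_col B"
  shows "opnorm (A - B) \<le> opnorm A + opnorm B"
  using opnorm_add[of A "(-1) \<cdot>\<^sub>m B"] opnorm_smult_le[of "-1" B] assms
  by (simp add: minus_mat_eq_add_smult)

lemma opnorm_minus_commute:
  assumes "dim_row A = dim_row B" "dim_col A = dim_col B"
  shows "opnorm (A - B) = opnorm (B - A)"
proof -
  have "A - B = (-1) \<cdot>\<^sub>m (B - A)" "B - A = (-1) \<cdot>\<^sub>m (A - B)"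
    by (rule eq_matI; use assms in auto)+
  then show ?thesis
    using opnorm_smult_le[of "-1" "B - A"] opnorm_smult_le[of "-1" "A - B"] by simp
qed

lemma opnorm_triangle:
  assumes "dim_row A = dim_row B" "dim_col A = dim_col B" "dim_row B = dim_row C" "dim_col B = dim_col C"
  shows "opnorm (A - C) \<le> opnorm (A - B) + opnorm (B - C)"
proof -
  have "A - C = (A - B) + (B - C)" by (rule eq_matI) (use assms in auto)
  then show ?thesis using opnorm_add[of "A - B" "B - C"] assms by simp
qed

lemma opnorm_le_diff:
  assumes "dim_row A = dim_row B" "dim_col A = dim_col B"
  shows "opnorm A \<le> opnorm B + opnorm (A - B)"
proof -
  have "A = B + (A - B)" by (rule eq_matI) (use assms in auto)
  then show ?thesis using opnorm_add[of B "A - B"] assms by simp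
qed

lemma opnorm_sum_diff:
  assumes "A \<in> carrier_mat n m" "B \<in> carrier_mat n m" "A' \<in> carrier_mat n m" "B' \<in> carrier_mat n m"
  shows "opnorm (A + B - (A' + B')) \<le> opnorm (A - A') + opnorm (B - B')"
proof -
  have "A + B - (A' + B') = (A - A') + (B - B')" by (rule eq_matI) (use assms in auto)
  then show ?thesis using opnorm_add[of "A - A'" "B - B'"] assms by simp
qed

lemma opnorm_mult_diff:
  assumes "A \<in> carrier_mat n m" "A' \<in> carrier_mat n m" "B \<in> carrier_mat m l" "B' \<in> carrier_mat m l"
  shows "opnorm (A * B - A' * B') \<le> opnorm (A - A') * opnorm B + opnorm A' * opnorm (B - B')"
proof -
  have "A * B - A' * B' = (A - A') * B + A' * (B - B')"
    using assms by (simp add: mat_dim_simps) (rule eq_matI; auto)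
  then have "opnorm (A * B - A' * B') \<le> opnorm ((A - A') * B) + opnorm (A' * (B - B'))"
    using opnorm_add[of "(A - A') * B" "A' * (B - B')"] assms by simp
  also have "\<dots> \<le> opnorm (A - A') * opnorm B + opnorm A' * opnorm (B - B')"
    using assms by (intro add_mono opnorm_mult) auto
  finally show ?thesis .
qed

text \<open>One half of the C*-identity, from the fact that the squared norm of
  \<open>A *\<^sub>v v\<close> is the inner product of \<open>madj A * A *\<^sub>v v\<close> with
  \<open>v\<close>. It yields the invariance of the norm under adjoints and the contractivity of
  isometries.\<close>

lemma opnorm_sq_le: "(opnorm A)\<^sup>2 \<le> opnorm (madj A * A)"
proof -
  have "opnorm A \<le> sqrt (opnorm (madj A * A))"
  proof (rule opnorm_leI)
    fix v :: "complex vec" assume v: "dim_vec v = dim_col A"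
    have "madj A * A *\<^sub>v v = madj A *\<^sub>v (A *\<^sub>v v)"
      by (rule assoc_mult_mat_vec[OF _ _ carrier_vecI]) (use v in auto)
    then have "complex_of_real ((vnorm (A *\<^sub>v v))\<^sup>2) = cinner (madj A * A *\<^sub>v v) v"
      using v by (simp only: cinner_self[symmetric]) (simp add: cinner_madj)
    then have "(vnorm (A *\<^sub>v v))\<^sup>2 = cmod (cinner (madj A * A *\<^sub>v v) v)"
      by (metis abs_power2 norm_of_real)
    also have "\<dots> \<le> vnorm (madj A * A *\<^sub>v v) * vnorm v"
      by (rule norm_cinner_le) (use v in auto)
    also have "\<dots> \<le> opnorm (madj A * A) * vnorm v * vnorm v"
      using vnorm_mult_mat_le[of v "madj A * A"] v by (intro mult_right_mono) auto
    also have "\<dots> = (sqrt (opnorm (madj A * A)) * vnorm v)\<^sup>2"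
      by (simp add: power_mult_distrib power2_eq_square)
    finally show "vnorm (A *\<^sub>v v) \<le> sqrt (opnorm (madj A * A)) * vnorm v"
      by (rule power2_le_imp_le) simp
  qed simp
  then show ?thesis using power_mono[of "opnorm A" "sqrt (opnorm (madj A * A))" 2] by simp
qed

lemma opnorm_madj: "opnorm (madj A) = opnorm A"
proof -
  have *: "opnorm B \<le> opnorm (madj B)" for B
  proof (cases "opnorm B = 0")
    case False
    have "(opnorm B)\<^sup>2 \<le> opnorm (madj B) * opnorm B"
      using opnorm_sq_le[of B] opnorm_mult[of "madj B" B] by simp
    then show ?thesis using False opnorm_nonneg[of B] by (simp add: power2_eq_square)
  qed simp
  from *[of A] *[of "madj A"] show ?thesis by simp
qed

lemma opnorm_one: "opnorm (1\<^sub>m k) \<le> 1"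
  by (rule opnorm_leI) (auto simp: one_mult_mat_vec[OF carrier_vecI])

lemma opnorm_isometry: "madj V * V = 1\<^sub>m k \<Longrightarrow> opnorm V \<le> 1"
  using opnorm_sq_le[of V] opnorm_one[of k] abs_square_le_1[of "opnorm V"] by simp

lemma opnorm_zero [simp]: "opnorm (0\<^sub>m k l) = 0"
proof -
  have "opnorm (0 \<cdot>\<^sub>m 0\<^sub>m k l) \<le> 0" using opnorm_smult_le[of 0 "0\<^sub>m k l"] by simp
  moreover have "0 \<cdot>\<^sub>m 0\<^sub>m k l = (0\<^sub>m k l :: complex mat)" by (rule eq_matI) auto
  ultimately show ?thesis using opnorm_nonneg[of "0\<^sub>m k l"] by simp
qed

lemma frob_mult_right:
  assumes "dim_col A = dim_row B"
  shows "frob (A * B) \<le> opnorm A * frob B"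
proof -
  have "frob (A * B) \<le> L2_set (\<lambda>j. opnorm A * vnorm (col B j)) {..<dim_col B}"
    unfolding frob_def
  proof (simp, rule L2_set_mono)
    fix j assume "j \<in> {..<dim_col B}"
    then have "col (A * B) j = A *\<^sub>v col B j" by (intro eq_vecI) auto
    then show "vnorm (col (A * B) j) \<le> opnorm A * vnorm (col B j)"
      using assms by (simp add: vnorm_mult_mat_le)
  qed simp
  then show ?thesis by (simp add: frob_def L2_set_right_distrib)
qed

lemma frob_mult_left:
  assumes "dim_col A = dim_row B"
  shows "frob (A * B) \<le> frob A * opnorm B"
  using frob_mult_right[of "madj B" "madj A"] assms
  by (simp add: madj_mult[symmetric] frob_madj opnorm_madj mult.commute)

lemma frob_add:
  assumes "dim_row A = dim_row B" "dim_col A = dim_col B"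
  shows "frob (A + B) \<le> frob A + frob B"
proof -
  have "frob (A + B) \<le> L2_set (\<lambda>j. vnorm (col A j) + vnorm (col B j)) {..<dim_col B}"
    unfolding frob_def
  proof (simp, rule L2_set_mono)
    fix j assume "j \<in> {..<dim_col B}"
    then have "col (A + B) j = col A j + col B j" using assms by (intro eq_vecI) auto
    then show "vnorm (col (A + B) j) \<le> vnorm (col A j) + vnorm (col B j)"
      using assms by (simp add: vnorm_add)
  qed simp
  also have "\<dots> \<le> frob A + frob B"
    using assms by (simp add: frob_def L2_set_triangle_ineq)
  finally show ?thesis .
qed

lemma frob_smult: "frob (c \<cdot>\<^sub>m A) = cmod c * frob A"
proof -
  have "(frob (c \<cdot>\<^sub>m A))\<^sup>2 = (cmod c * frob A)\<^sup>2"
    unfolding power_mult_distrib frob_square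
    by (simp add: norm_mult power_mult_distrib sum_distrib_left)
  then show ?thesis by (simp add: power2_eq_iff_nonneg)
qed

lemma frob_minus_commute:
  assumes "dim_row A = dim_row B" "dim_col A = dim_col B"
  shows "frob (A - B) = frob (B - A)"
proof -
  have "A - B = (-1) \<cdot>\<^sub>m (B - A)" by (rule eq_matI; use assms in auto)+
  then show ?thesis by (simp add: frob_smult)
qed

lemma frob_triangle:
  assumes "dim_row A = dim_row B" "dim_col A = dim_col B" "dim_row B = dim_row C" "dim_col B = dim_col C"
  shows "frob (A - C) \<le> frob (A - B) + frob (B - C)"
proof -
  have "A - C = (A - B) + (B - C)" by (rule eq_matI) (use assms in auto)
  then show ?thesis using frob_add[of "A - B" "B - C"] assms by simp
qed

lemma frob_one: "frob (1\<^sub>m k) = sqrt (real k)"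
proof -
  have "(frob (1\<^sub>m k))\<^sup>2 = (\<Sum>j<k. \<Sum>i<k. if i = j then 1 else 0)"
    unfolding frob_square by (intro sum.cong) auto
  then show ?thesis by (simp add: real_sqrt_unique)
qed

lemma frob_le_opnorm: "frob A \<le> opnorm A * sqrt (real (dim_col A))"
  using frob_mult_right[of A "1\<^sub>m (dim_col A)"] by (simp add: frob_one)

lemma norm_index_le_opnorm:
  assumes "i < dim_row A" "j < dim_col A"
  shows "cmod (A $$ (i, j)) \<le> opnorm A"
proof -
  have "cmod (A $$ (i, j)) = cmod (col A j $ i)" using assms by simp
  also have "\<dots> \<le> vnorm (col A j)"
    unfolding vnorm_L2 using assms by (intro member_le_L2_set) auto
  also have "col A j = A *\<^sub>v unit_vec (dim_col A) j"
    using assms by (auto intro!: eq_vecI)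
  also have "vnorm \<dots> \<le> opnorm A * vnorm (unit_vec (dim_col A) j)"
    by (rule vnorm_mult_mat_le) simp
  also have "vnorm (unit_vec (dim_col A) j) = 1"
    using assms by (simp add: vnorm_def if_distrib[of cmod] if_distrib[of "\<lambda>x. x ^ 2"] cong: if_cong)
  finally show ?thesis by simp
qed

subsection \<open>Almost projections\<close>

text \<open>Entries of products stay atomic from here on: identities between sums of products,
  normalised by \<open>mat_dim_simps\<close>, can then be checked entrywise.\<close>

declare index_mult_mat(1) [simp del]

section \<open>Traces, and projections as ranges of isometries\<close>

lemma mtrace_mult_comm:
  assumes "dim_col A = dim_row B" "dim_col B = dim_row A"
  shows "mtrace (A * B) = mtrace (B * A)"
proof -
  have "mtrace (A * B) = (\<Sum>i<dim_row A. \<Sum>l<dim_row B. A $$ (i, l) * B $$ (l, i))"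
    using assms by (simp add: mtrace_def index_mult_mat_sum)
  also have "\<dots> = (\<Sum>l<dim_row B. \<Sum>i<dim_row A. A $$ (i, l) * B $$ (l, i))"
    by (rule sum.swap)
  also have "\<dots> = mtrace (B * A)"
    using assms by (simp add: mtrace_def index_mult_mat_sum mult.commute)
  finally show ?thesis .
qed

lemma mtrace_add: "A \<in> carrier_mat k k \<Longrightarrow> B \<in> carrier_mat k k \<Longrightarrow> mtrace (A + B) = mtrace A + mtrace B"
  by (simp add: mtrace_def sum.distrib)

lemma mtrace_minus: "A \<in> carrier_mat k k \<Longrightarrow> B \<in> carrier_mat k k \<Longrightarrow> mtrace (A - B) = mtrace A - mtrace B"
  by (simp add: mtrace_def sum_subtractf)

lemma mtrace_one: "mtrace (1\<^sub>m k) = of_nat k"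
  by (simp add: mtrace_def)

lemma mtrace_madj_mult_self: "mtrace (madj A * A) = complex_of_real ((frob A)\<^sup>2)"
  unfolding frob_square mtrace_def
  by (simp add: index_mult_mat_sum complex_norm_square mult.commute del: of_real_power)

text \<open>Induction on the rank, measured by the trace: a nonzero column of \<open>E\<close>, once
  normalised, is a unit vector in the range of \<open>E\<close>, and removing its rank-one
  projection lowers the trace by 1.\<close>

lemma projection_isometry_aux:
  "E \<in> carrier_mat k k \<Longrightarrow> madj E = E \<Longrightarrow> E * E = E \<Longrightarrow> Re (mtrace E) < real n \<Longrightarrow>
    \<exists>m V. V \<in> carrier_mat k m \<and> madj V * V = 1\<^sub>m m \<and> V * madj V = E"
proof (induction n arbitrary: E)
  case 0
  \<comment> \<open>The trace of a projection is the trace of \<open>madj E * E\<close>, hence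
    nonnegative, and the bound by 0 is contradictory.\<close>
  have "Re (mtrace E) = (frob E)\<^sup>2"
    using mtrace_madj_mult_self[of E] 0 by (simp del: of_real_power)
  with 0 show ?case by (metis not_less of_nat_0 zero_le_power2)
next
  case (Suc n)
  have dE [simp]: "dim_row E = k" "dim_col E = k" using Suc.prems(1) by auto
  show ?case
  proof (cases "\<exists>j<k. vnorm (col E j) \<noteq> 0")
    case False
    have "E = 0\<^sub>m k k"
    proof (rule eq_matI)
      fix i j assume "i < dim_row (0\<^sub>m k k)" "j < dim_col (0\<^sub>m k k)"
      with False vnorm_eq_0D[of "col E j" i] show "E $$ (i, j) = 0\<^sub>m k k $$ (i, j)" by simp
    qed auto
    then show ?thesis
      by (intro exI[of _ 0] exI[of _ "0\<^sub>m k 0"]) (auto intro!: eq_matI simp: index_mult_mat_sum)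
  next
    case True
    then obtain j where j: "j < k" "vnorm (col E j) \<noteq> 0" by blast
    define c where "c = vnorm (col E j)"
    define v where "v = mat k 1 (\<lambda>(i, _). E $$ (i, j) / complex_of_real c)"
    have c: "c > 0" using j vnorm_nonneg[of "col E j"] unfolding c_def by linarith
    have dv [simp]: "dim_row v = k" "dim_col v = 1" "v \<in> carrier_mat k 1" by (auto simp: v_def)
    have Ev: "E * v = v"
    proof (rule eq_matI)
      fix i l assume il: "i < dim_row v" "l < dim_col v"
      have "(E * v) $$ (i, l) = (\<Sum>a<k. E $$ (i, a) * E $$ (a, j)) / complex_of_real c"
        using il by (simp add: index_mult_mat_sum v_def sum_divide_distrib)
      also have "(\<Sum>a<k. E $$ (i, a) * E $$ (a, j)) = (E * E) $$ (i, j)"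
        using il j by (simp add: index_mult_mat_sum)
      finally show "(E * v) $$ (i, l) = v $$ (i, l)" using il Suc.prems by (simp add: v_def)
    qed auto
    have vE: "madj v * E = madj v"
      using arg_cong[OF Ev, of madj] Suc.prems(2) by (simp add: madj_mult)
    have vv: "madj v * v = 1\<^sub>m 1"
    proof (rule eq_matI)
      fix a b assume ab: "a < dim_row (1\<^sub>m 1)" "b < dim_col (1\<^sub>m 1)"
      have "(madj v * v) $$ (a, b) = (\<Sum>i<k. E $$ (i, j) * cnj (E $$ (i, j))) / complex_of_real (c\<^sup>2)"
        using ab by (simp add: index_mult_mat_sum v_def sum_divide_distrib power2_eq_square mult.commute)
      also have "(\<Sum>i<k. E $$ (i, j) * cnj (E $$ (i, j))) = (\<Sum>i<k. complex_of_real ((cmod (E $$ (i, j)))\<^sup>2))"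
        by (simp only: complex_norm_square)
      also have "(\<Sum>i<k. complex_of_real ((cmod (E $$ (i, j)))\<^sup>2)) = complex_of_real (c\<^sup>2)"
        using j by (simp add: c_def vnorm_def sum_nonneg)
      finally show "(madj v * v) $$ (a, b) = 1\<^sub>m 1 $$ (a, b)" using c ab by simp
    qed auto
    define F where "F = E - v * madj v"
    have dF [simp]: "F \<in> carrier_mat k k" "dim_row F = k" "dim_col F = k" by (auto simp: F_def)
    have Fv: "F * v = 0\<^sub>m k 1"
      using Ev vv by (auto simp: F_def mat_dim_simps)
    have "madj F = F"
      using Suc.prems(2) by (simp add: F_def madj_minus madj_mult)
    moreover have "F * F = F"
    proof -
      have "F * F = F * E - F * v * madj v" 
        by (subst (2) F_def, subst mult_minus_distrib_mat_dim) (auto simp: assoc_mult_mat_dim)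
      also have "\<dots> = F * E" by (rule eq_matI) (auto simp: Fv)
      also have "F * E = F"
        using Suc.prems(3) vE by (simp add: F_def mat_dim_simps)
      finally show ?thesis .
    qed
    moreover have "mtrace (v * madj v) = 1"
      using mtrace_mult_comm[of v "madj v"] vv mtrace_one[of 1] by simp
    then have "Re (mtrace F) < real n"
      using Suc.prems(4) mtrace_minus[OF Suc.prems(1) carrier_matI, of "v * madj v"] by (simp add: F_def)
    ultimately obtain m V where V: "V \<in> carrier_mat k m" "madj V * V = 1\<^sub>m m" "V * madj V = F"
      using Suc.IH[of F] by auto
    have Vd [simp]: "dim_row V = k" "dim_col V = m" using V by auto
    \<comment> \<open>The columns of \<open>V\<close> span the range of \<open>F\<close>, which
      \<open>v\<close> is orthogonal to, so \<open>v\<close> can be appended to them as a further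
      orthonormal column.\<close>
    have "madj V * v = madj V * V * madj V * v" using V(2) by simp
    also have "\<dots> = madj V * (F * v)" by (simp add: mat_dim_simps flip: V(3))
    finally have Vv: "madj V * v = 0\<^sub>m m 1" by (simp add: Fv)
    define U where "U = mat k (Suc m) (\<lambda>(i, a). if a < m then V $$ (i, a) else v $$ (i, 0))"
    have dU [simp]: "dim_row U = k" "dim_col U = Suc m" by (auto simp: U_def)
    have U1: "U $$ (i, a) = V $$ (i, a)" if "i < k" "a < m" for i a using that by (simp add: U_def)
    have U2: "U $$ (i, m) = v $$ (i, 0)" if "i < k" for i using that by (simp add: U_def)
    have entries: "(\<Sum>i<k. cnj (V $$ (i, a)) * V $$ (i, b)) = (if a = b then 1 else 0)" if "a < m" "b < m" for a b
      using that arg_cong[OF V(2), of "\<lambda>M. M $$ (a, b)"] by (simp add: index_mult_mat_sum)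
    have cross: "(\<Sum>i<k. cnj (V $$ (i, a)) * v $$ (i, 0)) = 0" if "a < m" for a
      using that arg_cong[OF Vv, of "\<lambda>M. M $$ (a, 0)"] by (simp add: index_mult_mat_sum)
    have cross': "(\<Sum>i<k. cnj (v $$ (i, 0)) * V $$ (i, a)) = 0" if "a < m" for a
      using arg_cong[OF cross[OF that], of cnj] by (simp add: mult.commute)
    have vself: "(\<Sum>i<k. cnj (v $$ (i, 0)) * v $$ (i, 0)) = 1"
      using arg_cong[OF vv, of "\<lambda>M. M $$ (0, 0)"] by (simp add: index_mult_mat_sum)
    have "madj U * U = 1\<^sub>m (Suc m)"
    proof (rule eq_matI)
      fix a b assume ab: "a < dim_row (1\<^sub>m (Suc m))" "b < dim_col (1\<^sub>m (Suc m))"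
      then have eq: "(madj U * U) $$ (a, b) = (\<Sum>i<k. cnj (U $$ (i, a)) * U $$ (i, b))"
        by (simp add: index_mult_mat_sum)
      show "(madj U * U) $$ (a, b) = 1\<^sub>m (Suc m) $$ (a, b)"
      proof (cases "a < m"; cases "b < m")
        assume "a < m" "b < m"
        then show ?thesis using eq entries[of a b] U1 by simp
      next
        assume "a < m" "\<not> b < m"
        then show ?thesis using eq ab cross[of a] U1 U2 by (simp add: less_Suc_eq)
      next
        assume "\<not> a < m" "b < m"
        then show ?thesis using eq ab cross'[of b] U1 U2 by (simp add: less_Suc_eq)
      next
        assume "\<not> a < m" "\<not> b < m"
        then show ?thesis using eq ab vself U2 by (simp add: less_Suc_eq)
      qed
    qed auto
    moreover have "U * madj U = E"
    proof (rule eq_matI)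
      fix i l assume il: "i < dim_row E" "l < dim_col E"
      then have "(U * madj U) $$ (i, l) = (\<Sum>a<Suc m. U $$ (i, a) * cnj (U $$ (l, a)))"
        by (simp add: index_mult_mat_sum del: sum.lessThan_Suc)
      also have "\<dots> = (V * madj V) $$ (i, l) + (v * madj v) $$ (i, l)"
        using il U1 U2 by (simp add: index_mult_mat_sum)
      also have "\<dots> = E $$ (i, l)"
        using il unfolding V(3) F_def by simp
      finally show "(U * madj U) $$ (i, l) = E $$ (i, l)" .
    qed auto
    ultimately show ?thesis by (intro exI[of _ "Suc m"] exI[of _ U]) auto
  qed
qed

lemma projection_isometry:
  assumes "E \<in> carrier_mat k k" "madj E = E" "E * E = E"
  obtains m V where "V \<in> carrier_mat k m" "madj V * V = 1\<^sub>m m" "V * madj V = E"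
proof -
  obtain n where "Re (mtrace E) < real n" using reals_Archimedean2 by blast
  from projection_isometry_aux[OF assms this] show ?thesis using that by blast
qed

text \<open>This iteration turns the defect \<open>D = T * T - T\<close> into a multiple of \<open>D * D\<close>, hence
  converges quadratically to a projection.\<close>

definition newton_step :: "complex mat \<Rightarrow> complex mat" where
  "newton_step T = 3 \<cdot>\<^sub>m (T * T) - 2 \<cdot>\<^sub>m (T * (T * T))"

lemma newton_step_carrier [simp]: "T \<in> carrier_mat k k \<Longrightarrow> newton_step T \<in> carrier_mat k k"
  by (intro carrier_matI) (auto simp: newton_step_def)

lemma newton_step_hermitian: "T \<in> carrier_mat k k \<Longrightarrow> madj T = T \<Longrightarrow> madj (newton_step T) = newton_step T"
  by (simp add: newton_step_def madj_minus madj_smult madj_mult mat_dim_simps)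

lemma newton_step_diff:
  assumes "T \<in> carrier_mat k k"
  shows "newton_step T - T = (1\<^sub>m k - 2 \<cdot>\<^sub>m T) * (T * T - T)"
  using assms unfolding newton_step_def
  by (simp add: mat_dim_simps) (rule eq_matI; simp add: algebra_simps)

lemma newton_step_defect:
  assumes "T \<in> carrier_mat k k"
  defines "D \<equiv> T * T - T"
  shows "newton_step T * newton_step T - newton_step T = D * D * (4 \<cdot>\<^sub>m D - 3 \<cdot>\<^sub>m 1\<^sub>m k)"
  using assms(1) unfolding newton_step_def D_def
  by (simp add: mat_dim_simps) (rule eq_matI; simp add: algebra_simps)

text \<open>The threshold 1/16 turns the quadratic bound 4 d^2 on the new defect into d/4; this
  geometric decay is what the convergence argument uses. The factor 2 bounds the norm of 1 - 2 T,
  whose square is 1 + 4 (T^2 - T).\<close>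

lemma newton_step_bounds:
  assumes T: "T \<in> carrier_mat k k" "madj T = T" and d: "opnorm (T * T - T) \<le> d" "d \<le> 1 / 16"
  shows "opnorm (newton_step T - T) \<le> 2 * d"
    and "opnorm (newton_step T * newton_step T - newton_step T) \<le> d / 4"
proof -
  let ?D = "T * T - T"
  have dT [simp]: "dim_row T = k" "dim_col T = k" using T by auto
  have d0: "0 \<le> d" using d(1) opnorm_nonneg[of ?D] by linarith
  have "madj (1\<^sub>m k - 2 \<cdot>\<^sub>m T) * (1\<^sub>m k - 2 \<cdot>\<^sub>m T) = 1\<^sub>m k + 4 \<cdot>\<^sub>m ?D"
    using T by (simp add: madj_minus madj_smult mat_dim_simps) (rule eq_matI; simp add: algebra_simps)
  then have "(opnorm (1\<^sub>m k - 2 \<cdot>\<^sub>m T))\<^sup>2 \<le> opnorm (1\<^sub>m k + 4 \<cdot>\<^sub>m ?D)"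
    using opnorm_sq_le[of "1\<^sub>m k - 2 \<cdot>\<^sub>m T"] by simp
  also have "\<dots> \<le> opnorm (1\<^sub>m k) + opnorm (4 \<cdot>\<^sub>m ?D)"
    by (rule opnorm_add) auto
  also have "\<dots> \<le> 1 + 4 * d"
    using opnorm_one[of k] opnorm_smult_le[of 4 ?D] d by simp
  also have "\<dots> \<le> 2\<^sup>2" using d by simp
  finally have *: "opnorm (1\<^sub>m k - 2 \<cdot>\<^sub>m T) \<le> 2" by (rule power2_le_imp_le) simp
  have "opnorm (newton_step T - T) \<le> opnorm (1\<^sub>m k - 2 \<cdot>\<^sub>m T) * opnorm ?D"
    unfolding newton_step_diff[OF T(1)] by (rule opnorm_mult) simp
  also have "\<dots> \<le> 2 * d" using * d by (intro mult_mono) auto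
  finally show "opnorm (newton_step T - T) \<le> 2 * d" .
  have "opnorm (4 \<cdot>\<^sub>m ?D - 3 \<cdot>\<^sub>m 1\<^sub>m k) \<le> opnorm (4 \<cdot>\<^sub>m ?D) + opnorm (3 \<cdot>\<^sub>m 1\<^sub>m k)"
    by (rule opnorm_minus) auto
  also have "\<dots> \<le> 4 * d + 3"
    using opnorm_smult_le[of 4 ?D] opnorm_smult_le[of 3 "1\<^sub>m k"] opnorm_one[of k] d by simp
  also have "\<dots> \<le> 4" using d by simp
  finally have a: "opnorm (4 \<cdot>\<^sub>m ?D - 3 \<cdot>\<^sub>m 1\<^sub>m k) \<le> 4" .
  have "opnorm (?D * ?D) \<le> opnorm ?D * opnorm ?D" by (rule opnorm_mult) simp
  also have "\<dots> \<le> d * d" using d d0 by (intro mult_mono) auto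
  finally have b: "opnorm (?D * ?D) \<le> d * d" .
  have "opnorm (?D * ?D * (4 \<cdot>\<^sub>m ?D - 3 \<cdot>\<^sub>m 1\<^sub>m k)) \<le> opnorm (?D * ?D) * opnorm (4 \<cdot>\<^sub>m ?D - 3 \<cdot>\<^sub>m 1\<^sub>m k)"
    by (rule opnorm_mult) simp
  also have "\<dots> \<le> (d * d) * 4" using a b d0 by (intro mult_mono) auto
  also have "\<dots> \<le> (d * (1 / 16)) * 4" using d d0 by (intro mult_right_mono mult_left_mono) auto
  finally show "opnorm (newton_step T * newton_step T - newton_step T) \<le> d / 4"
    unfolding newton_step_defect[OF T(1)] by simp
qed

text \<open>The operator norm dominates every entry and is dominated by the Frobenius norm, so
  entrywise limits exist and are limits in norm.\<close>

lemma mat_Cauchy_limit: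
  fixes S :: "nat \<Rightarrow> complex mat"
  assumes S: "\<And>n. S n \<in> carrier_mat k l"
    and C: "\<And>m n. n \<le> m \<Longrightarrow> opnorm (S m - S n) \<le> c n" and c: "c \<longlonglongrightarrow> 0"
  obtains E where "E \<in> carrier_mat k l" "\<And>i j. i < k \<Longrightarrow> j < l \<Longrightarrow> (\<lambda>n. S n $$ (i, j)) \<longlonglongrightarrow> E $$ (i, j)"
    "(\<lambda>n. opnorm (E - S n)) \<longlonglongrightarrow> 0"
proof -
  have dS [simp]: "dim_row (S n) = k" "dim_col (S n) = l" for n using S[of n] by auto
  have conv: "convergent (\<lambda>n. S n $$ (i, j))" if "i < k" "j < l" for i j
  proof (rule Cauchy_convergent, rule metric_CauchyI)
    fix e :: real assume "e > 0"
    then obtain N where N: "\<And>n. n \<ge> N \<Longrightarrow> \<bar>c n\<bar> < e / 2"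
      using LIMSEQ_D[OF c, of "e / 2"] by auto
    have *: "dist (S n $$ (i, j)) (S N $$ (i, j)) < e / 2" if "n \<ge> N" for n
      using norm_index_le_opnorm[of i "S n - S N" j] C[of N n] N[of N] that \<open>i < k\<close> \<open>j < l\<close>
      by (simp add: dist_norm)
    show "\<exists>M. \<forall>m\<ge>M. \<forall>n\<ge>M. dist (S m $$ (i, j)) (S n $$ (i, j)) < e"
      by (rule exI[of _ N]) (use * dist_triangle_half_r dist_commute in metis)
  qed
  define E where "E = mat k l (\<lambda>(i, j). lim (\<lambda>n. S n $$ (i, j)))"
  have dE [simp]: "dim_row E = k" "dim_col E = l" by (auto simp: E_def)
  have lim: "(\<lambda>n. S n $$ (i, j)) \<longlonglongrightarrow> E $$ (i, j)" if "i < k" "j < l" for i j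
    using conv[OF that] that by (simp add: E_def convergent_LIMSEQ_iff)
  have "(\<lambda>n. sqrt (\<Sum>j<l. \<Sum>i<k. (cmod (E $$ (i, j) - S n $$ (i, j)))\<^sup>2)) \<longlonglongrightarrow>
      sqrt (\<Sum>j<l. \<Sum>i<k. (cmod (E $$ (i, j) - E $$ (i, j)))\<^sup>2)"
    by (intro tendsto_intros lim) auto
  moreover have "frob (E - S n) = sqrt (\<Sum>j<l. \<Sum>i<k. (cmod (E $$ (i, j) - S n $$ (i, j)))\<^sup>2)" for n
    using frob_square[of "E - S n"] by (simp add: real_sqrt_unique)
  ultimately have "(\<lambda>n. frob (E - S n)) \<longlonglongrightarrow> 0" by simp
  then have "(\<lambda>n. opnorm (E - S n)) \<longlonglongrightarrow> 0"
    by (rule tendsto_sandwich[rotated 3]) (auto simp: opnorm_le_frob)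
  with lim show ?thesis by (intro that[of E]) auto
qed

lemma almost_projection:
  assumes T: "T \<in> carrier_mat k k" "madj T = T" and d: "opnorm (T * T - T) \<le> d" "d \<le> 1 / 16"
  obtains E where "E \<in> carrier_mat k k" "madj E = E" "E * E = E" "opnorm (E - T) \<le> 4 * d"
proof -
  define S where "S n = (newton_step ^^ n) T" for n
  have S0: "S 0 = T" and SS: "S (Suc n) = newton_step (S n)" for n by (auto simp: S_def)
  have d0: "0 \<le> d" using d(1) opnorm_nonneg[of "T * T - T"] by linarith
  have inv: "S n \<in> carrier_mat k k \<and> madj (S n) = S n \<and> opnorm (S n * S n - S n) \<le> d / 4 ^ n" for n
  proof (induction n)
    case (Suc n)
    moreover have "d / 4 ^ n \<le> d" using divide_left_mono[of 1 "4 ^ n" d] d0 by simp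
    ultimately show ?case
      using newton_step_bounds(2)[of "S n" k "d / 4 ^ n", OF _ _ _ order.trans[OF _ d(2)]]
      by (auto simp: SS newton_step_hermitian mult.commute)
  qed (use T d in \<open>auto simp: S0\<close>)
  have [simp]: "S n \<in> carrier_mat k k" "dim_row (S n) = k" "dim_col (S n) = k" for n
    using inv[of n] by auto
  have step: "opnorm (S (Suc n) - S n) \<le> 2 * (d / 4 ^ n)" for n
  proof -
    have "d / 4 ^ n \<le> d" using divide_left_mono[of 1 "4 ^ n" d] d0 by simp
    then show ?thesis
      using inv[of n] newton_step_bounds(1)[of "S n" k "d / 4 ^ n", OF _ _ _ order.trans[OF _ d(2)]] by (auto simp: SS)
  qed
  \<comment> \<open>The step at index m has length at most 2 d / 4^m, and 4 d (1 / 4^m - 1 /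
    4^(m+1)) is 3 d / 4^m, so the bounds telescope. Starting from 0 this gives the constant 4 of the
    conclusion.\<close>
  have cau: "opnorm (S m - S n) \<le> 4 * d * (1 / 4 ^ n - 1 / 4 ^ m)" if "n \<le> m" for m n
    using that
  proof (induction m rule: dec_induct)
    case base
    have "S n - S n = 0\<^sub>m k k" by (rule eq_matI) auto
    then show ?case by (simp only: opnorm_zero) simp
  next
    case (step m)
    have "opnorm (S (Suc m) - S n) \<le> opnorm (S (Suc m) - S m) + opnorm (S m - S n)"
      by (rule opnorm_triangle) auto
    also have "\<dots> \<le> 2 * (d / 4 ^ m) + 4 * d * (1 / 4 ^ n - 1 / 4 ^ m)"
      using step.IH \<open>\<And>n. opnorm (S (Suc n) - S n) \<le> 2 * (d / 4 ^ n)\<close>[of m] by (intro add_mono)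
    also have "\<dots> \<le> 4 * d * (1 / 4 ^ n - 1 / 4 ^ Suc m)"
      using d0 by (simp add: field_simps)
    finally show ?case .
  qed
  obtain E where E: "E \<in> carrier_mat k k"
      "\<And>i j. i < k \<Longrightarrow> j < k \<Longrightarrow> (\<lambda>n. S n $$ (i, j)) \<longlonglongrightarrow> E $$ (i, j)"
      "(\<lambda>n. opnorm (E - S n)) \<longlonglongrightarrow> 0"
  proof (rule mat_Cauchy_limit[of S k k "\<lambda>n. 4 * d / 4 ^ n"])
    show "opnorm (S m - S n) \<le> 4 * d / 4 ^ n" if "n \<le> m" for m n
    proof -
      have "4 * d * (1 / 4 ^ n - 1 / 4 ^ m) \<le> 4 * d * (1 / 4 ^ n)" using d0 by (intro mult_left_mono) auto
      then show ?thesis using cau[OF that] by simp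
    qed
    show "(\<lambda>n. 4 * d / 4 ^ n) \<longlonglongrightarrow> 0"
      using LIMSEQ_divide_realpow_zero[of 4 "4 * d"] by simp
  qed auto
  have dE [simp]: "dim_row E = k" "dim_col E = k" using E(1) by auto
  have "madj E = E"
  proof (rule eq_matI)
    fix i j assume ij: "i < dim_row E" "j < dim_col E"
    have "(\<lambda>n. cnj (S n $$ (j, i))) \<longlonglongrightarrow> cnj (E $$ (j, i))"
      using ij E(2)[of j i] by (intro tendsto_intros) auto
    moreover have "cnj (S n $$ (j, i)) = S n $$ (i, j)" for n
      using ij index_madj[of i "S n" j] inv[of n] by simp
    ultimately show "madj E $$ (i, j) = E $$ (i, j)"
      using ij E(2)[of i j] LIMSEQ_unique by auto
  qed auto
  moreover have "E * E = E"
  proof (rule eq_matI)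
    fix i j assume ij: "i < dim_row E" "j < dim_col E"
    have "(\<lambda>n. (\<Sum>l<k. S n $$ (i, l) * S n $$ (l, j)) - S n $$ (i, j)) \<longlonglongrightarrow>
        (\<Sum>l<k. E $$ (i, l) * E $$ (l, j)) - E $$ (i, j)"
      using ij by (intro tendsto_intros E(2)) auto
    then have "(\<lambda>n. (S n * S n - S n) $$ (i, j)) \<longlonglongrightarrow> (E * E) $$ (i, j) - E $$ (i, j)"
      using ij by (simp add: index_mult_mat_sum)
    moreover have "(\<lambda>n. (S n * S n - S n) $$ (i, j)) \<longlonglongrightarrow> 0"
    proof (rule Lim_null_comparison)
      show "\<forall>\<^sub>F n in sequentially. cmod ((S n * S n - S n) $$ (i, j)) \<le> d / 4 ^ n"
      proof (intro always_eventually allI)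
        fix n
        show "cmod ((S n * S n - S n) $$ (i, j)) \<le> d / 4 ^ n"
          by (rule order.trans[OF norm_index_le_opnorm]) (use ij inv in auto)
      qed
      show "(\<lambda>n. d / 4 ^ n) \<longlonglongrightarrow> 0"
        using LIMSEQ_divide_realpow_zero[of 4 d] by simp
    qed
    ultimately show "(E * E) $$ (i, j) = E $$ (i, j)"
      using LIMSEQ_unique by fastforce
  qed auto
  moreover have "opnorm (E - T) \<le> 4 * d"
  proof (rule LIMSEQ_le_const)
    show "(\<lambda>n. opnorm (E - S n) + 4 * d) \<longlonglongrightarrow> 4 * d"
      using tendsto_add[OF E(3) tendsto_const[of "4 * d"]] by simp
    show "\<exists>N. \<forall>n\<ge>N. opnorm (E - T) \<le> opnorm (E - S n) + 4 * d"
    proof (intro exI allI impI)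
      fix n
      have "opnorm (E - T) \<le> opnorm (E - S n) + opnorm (S n - S 0)"
        unfolding S0[symmetric] by (rule opnorm_triangle) auto
      also have "opnorm (S n - S 0) \<le> 4 * d"
      proof -
        have "4 * d * (1 / 4 ^ 0 - 1 / 4 ^ n) \<le> 4 * d * 1" using d0 by (intro mult_left_mono) auto
        then show ?thesis using cau[of 0 n] by simp
      qed
      finally show "opnorm (E - T) \<le> opnorm (E - S n) + 4 * d" by simp
    qed
  qed
  ultimately show ?thesis using that E(1) by blast
qed

text \<open>Equivalently, the block matrix \<open>(V1 V2)\<close> is unitary.\<close>

definition isometry_pair :: "nat \<Rightarrow> nat \<Rightarrow> nat \<Rightarrow> complex mat \<Rightarrow> complex mat \<Rightarrow> bool" where
  "isometry_pair k k1 k2 V1 V2 \<longleftrightarrow> V1 \<in> carrier_mat k k1 \<and> V2 \<in> carrier_mat k k2 \<and>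
     madj V1 * V1 = 1\<^sub>m k1 \<and> madj V2 * V2 = 1\<^sub>m k2 \<and> V1 * madj V1 + V2 * madj V2 = 1\<^sub>m k"

text \<open>Inserting the resolution of the identity between the two factors produces twice the same
  product, which must therefore vanish.\<close>

lemma isometry_pair_orthogonal:
  assumes "isometry_pair k k1 k2 V1 V2"
  shows "madj V1 * V2 = 0\<^sub>m k1 k2" "madj V2 * V1 = 0\<^sub>m k2 k1"
proof -
  have V: "V1 \<in> carrier_mat k k1" "V2 \<in> carrier_mat k k2" "madj V1 * V1 = 1\<^sub>m k1" "madj V2 * V2 = 1\<^sub>m k2"
      "V1 * madj V1 + V2 * madj V2 = 1\<^sub>m k"
    using assms by (auto simp: isometry_pair_def)
  have d [simp]: "dim_row V1 = k" "dim_col V1 = k1" "dim_row V2 = k" "dim_col V2 = k2" using V by auto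
  have "madj V1 * V2 = madj V1 * (V1 * madj V1 + V2 * madj V2) * V2" using V(5) by simp
  also have "\<dots> = (madj V1 * V1) * (madj V1 * V2) + madj V1 * V2 * (madj V2 * V2)"
    by (simp add: mat_dim_simps)
  also have "\<dots> = madj V1 * V2 + madj V1 * V2" using V(3,4) by simp
  finally have eq: "madj V1 * V2 = madj V1 * V2 + madj V1 * V2" .
  show z: "madj V1 * V2 = 0\<^sub>m k1 k2"
  proof (rule eq_matI)
    fix i j assume "i < dim_row (0\<^sub>m k1 k2)" "j < dim_col (0\<^sub>m k1 k2)"
    then show "(madj V1 * V2) $$ (i, j) = 0\<^sub>m k1 k2 $$ (i, j)"
      using arg_cong[OF eq, of "\<lambda>M. M $$ (i, j)"] by simp
  qed auto
  show "madj V2 * V1 = 0\<^sub>m k2 k1" using arg_cong[OF z, of madj] by (simp add: madj_mult)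
qed

text \<open>Traces of the resolution of the identity. This bounds both sizes by \<open>k\<close> and
  keeps the number of cases finite.\<close>

lemma isometry_pair_dim:
  assumes "isometry_pair k k1 k2 V1 V2"
  shows "k1 + k2 = k"
proof -
  have V: "V1 \<in> carrier_mat k k1" "V2 \<in> carrier_mat k k2" "madj V1 * V1 = 1\<^sub>m k1" "madj V2 * V2 = 1\<^sub>m k2"
      "V1 * madj V1 + V2 * madj V2 = 1\<^sub>m k"
    using assms by (auto simp: isometry_pair_def)
  have "of_nat k = mtrace (V1 * madj V1) + mtrace (V2 * madj V2)"
    using V by (subst mtrace_add[symmetric, of _ k]) (auto simp: mtrace_one)
  also have "\<dots> = of_nat k1 + of_nat k2"
    using V mtrace_mult_comm[of V1 "madj V1"] mtrace_mult_comm[of V2 "madj V2"] by (simp add: mtrace_one)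
  finally show ?thesis by (metis of_nat_add of_nat_eq_iff)
qed

lemma almost_projection_isometry_pair:
  assumes T: "T \<in> carrier_mat k k" "madj T = T" and d: "opnorm (T * T - T) \<le> d" "d \<le> 1 / 16"
  obtains k1 k2 V1 V2 where "isometry_pair k k1 k2 V1 V2" "opnorm (V1 * madj V1 - T) \<le> 4 * d"
proof -
  obtain E where E: "E \<in> carrier_mat k k" "madj E = E" "E * E = E" "opnorm (E - T) \<le> 4 * d"
    using almost_projection[OF assms] .
  have [simp]: "dim_row E = k" "dim_col E = k" using E(1) by auto
  obtain k1 V1 where V1: "V1 \<in> carrier_mat k k1" "madj V1 * V1 = 1\<^sub>m k1" "V1 * madj V1 = E"
    using projection_isometry[OF E(1-3)] .
  let ?F = "1\<^sub>m k - E"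
  have "?F * ?F = ?F" using E(3) by (simp add: mat_dim_simps) (rule eq_matI; simp)
  moreover have "madj ?F = ?F" using E(2) by (simp add: madj_minus)
  moreover have "?F \<in> carrier_mat k k" by (intro carrier_matI) auto
  ultimately obtain k2 V2 where V2: "V2 \<in> carrier_mat k k2" "madj V2 * V2 = 1\<^sub>m k2" "V2 * madj V2 = ?F"
    by (elim projection_isometry)
  have "E + ?F = 1\<^sub>m k" by (rule eq_matI) auto
  with V1 V2 E(4) show ?thesis
    by (intro that[of k1 k2 V1 V2]) (auto simp: isometry_pair_def)
qed

subsection \<open>Noncommutative polynomials\<close>

definition nc_add :: "(nat list \<Rightarrow> complex) \<Rightarrow> (nat list \<Rightarrow> complex) \<Rightarrow> nat list \<Rightarrow> complex" where
  "nc_add P Q = (\<lambda>w. P w + Q w)"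

definition nc_scale :: "complex \<Rightarrow> (nat list \<Rightarrow> complex) \<Rightarrow> nat list \<Rightarrow> complex" where
  "nc_scale c P = (\<lambda>w. c * P w)"

definition nc_zero :: "nat list \<Rightarrow> complex" where
  "nc_zero = (\<lambda>_. 0)"

definition nc_mon :: "nat list \<Rightarrow> nat list \<Rightarrow> complex" where
  "nc_mon w = (\<lambda>v. if v = w then 1 else 0)"

definition nc_shift :: "nat \<Rightarrow> (nat list \<Rightarrow> complex) \<Rightarrow> nat list \<Rightarrow> complex" where
  "nc_shift i P = (\<lambda>w. case w of [] \<Rightarrow> 0 | j # v \<Rightarrow> if j = i then P v else 0)"

definition nc_support :: "(nat list \<Rightarrow> complex) \<Rightarrow> nat list list" where
  "nc_support P = sorted_list_of_set {w. P w \<noteq> 0}"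

text \<open>Products are assembled from shifts because prefixing a letter is monotone for the lexicographic
  order, in which \<open>ncpoly_eval\<close> adds up its terms.\<close>

definition nc_mult :: "(nat list \<Rightarrow> complex) \<Rightarrow> (nat list \<Rightarrow> complex) \<Rightarrow> nat list \<Rightarrow> complex" where
  "nc_mult P Q = foldr (\<lambda>w R. nc_add (nc_scale (P w) (foldr nc_shift w Q)) R) (nc_support P) nc_zero"

text \<open>Letters are not starred: the definition represents the adjoint only at self-adjoint
  tuples, as \<open>ncpoly_eval_star\<close> assumes.\<close>

definition nc_star :: "(nat list \<Rightarrow> complex) \<Rightarrow> nat list \<Rightarrow> complex" where
  "nc_star P = foldr (\<lambda>w R. nc_add (nc_scale (cnj (P w)) (nc_mon (rev w))) R) (nc_support P) nc_zero"

section \<open>Closure properties of complex and of rational polynomials\<close>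

lemma ncpolys_finite: "P \<in> ncpolys n \<Longrightarrow> finite {w. P w \<noteq> 0}"
  by (simp add: ncpolys_def)

lemma nc_support_words: "P \<in> ncpolys n \<Longrightarrow> w \<in> set (nc_support P) \<Longrightarrow> set w \<subseteq> {..<n}"
  by (auto simp: ncpolys_def nc_support_def)

lemma nc_zero_ncpolys: "nc_zero \<in> ncpolys n"
  by (simp add: ncpolys_def nc_zero_def)

lemma nc_add_ncpolys: "P \<in> ncpolys n \<Longrightarrow> Q \<in> ncpolys n \<Longrightarrow> nc_add P Q \<in> ncpolys n"
proof -
  assume P: "P \<in> ncpolys n" and Q: "Q \<in> ncpolys n"
  have "finite {w. P w + Q w \<noteq> 0}"
    by (rule finite_subset[OF _ finite_UnI[OF ncpolys_finite[OF P] ncpolys_finite[OF Q]]]) auto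
  moreover have "set w \<subseteq> {..<n}" if "P w + Q w \<noteq> 0" for w
    using that P Q by (cases "P w = 0") (auto simp: ncpolys_def)
  ultimately show ?thesis by (auto simp: ncpolys_def nc_add_def)
qed

lemma nc_scale_ncpolys: "P \<in> ncpolys n \<Longrightarrow> nc_scale c P \<in> ncpolys n"
  by (auto simp: ncpolys_def nc_scale_def)

lemma nc_mon_ncpolys: "set w \<subseteq> {..<n} \<Longrightarrow> nc_mon w \<in> ncpolys n"
  by (auto simp: ncpolys_def nc_mon_def)

lemma nc_shift_support: "{w. nc_shift i P w \<noteq> 0} = (#) i ` {w. P w \<noteq> 0}"
proof (intro equalityI subsetI)
  fix w assume "w \<in> {w. nc_shift i P w \<noteq> 0}"
  then show "w \<in> (#) i ` {w. P w \<noteq> 0}"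
    by (cases w) (auto simp: nc_shift_def split: if_splits)
qed (auto simp: nc_shift_def)

lemma nc_shift_ncpolys: "P \<in> ncpolys n \<Longrightarrow> i < n \<Longrightarrow> nc_shift i P \<in> ncpolys n"
  using nc_shift_support[of i P]
  by (fastforce simp: ncpolys_def nc_shift_def split: list.splits if_splits)

lemma rat_ncpolys_ncpolys: "P \<in> rat_ncpolys n \<Longrightarrow> P \<in> ncpolys n"
  by (simp add: rat_ncpolys_def)

lemma nc_zero_rat: "nc_zero \<in> rat_ncpolys n"
  by (simp add: rat_ncpolys_def nc_zero_ncpolys) (simp add: nc_zero_def)

lemma nc_add_rat: "P \<in> rat_ncpolys n \<Longrightarrow> Q \<in> rat_ncpolys n \<Longrightarrow> nc_add P Q \<in> rat_ncpolys n"
  by (simp add: rat_ncpolys_def nc_add_ncpolys) (simp add: nc_add_def)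

lemma nc_scale_rat:
  "Re c \<in> \<rat> \<Longrightarrow> Im c \<in> \<rat> \<Longrightarrow> P \<in> rat_ncpolys n \<Longrightarrow> nc_scale c P \<in> rat_ncpolys n"
  by (simp add: rat_ncpolys_def nc_scale_ncpolys) (simp add: nc_scale_def)

lemma nc_mon_rat: "set w \<subseteq> {..<n} \<Longrightarrow> nc_mon w \<in> rat_ncpolys n"
  by (simp add: rat_ncpolys_def nc_mon_ncpolys) (simp add: nc_mon_def)

lemma nc_shift_rat: "P \<in> rat_ncpolys n \<Longrightarrow> i < n \<Longrightarrow> nc_shift i P \<in> rat_ncpolys n"
  by (simp add: rat_ncpolys_def nc_shift_ncpolys) (simp add: nc_shift_def split: list.splits)

text \<open>Microstates control the norms of rational polynomials only, so approximants of products
  have to be rational again.\<close>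

lemma nc_mult_rat:
  assumes P: "P \<in> rat_ncpolys n" and Q: "Q \<in> rat_ncpolys n"
  shows "nc_mult P Q \<in> rat_ncpolys n"
proof -
  have sh: "foldr nc_shift w Q \<in> rat_ncpolys n" if "set w \<subseteq> {..<n}" for w
    using that by (induction w) (auto intro: Q nc_shift_rat)
  have "foldr (\<lambda>w R. nc_add (nc_scale (P w) (foldr nc_shift w Q)) R) ws nc_zero \<in> rat_ncpolys n"
    if "set ws \<subseteq> set (nc_support P)" for ws
    using that
  proof (induction ws)
    case (Cons w ws)
    then have "set w \<subseteq> {..<n}" using P by (auto dest: nc_support_words[OF rat_ncpolys_ncpolys])
    moreover have "Re (P w) \<in> \<rat>" "Im (P w) \<in> \<rat>" using P by (auto simp: rat_ncpolys_def)
    ultimately show ?case using Cons sh by (simp add: nc_add_rat nc_scale_rat)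
  qed (simp add: nc_zero_rat)
  then show ?thesis by (simp add: nc_mult_def)
qed

lemma nc_star_rat:
  assumes P: "P \<in> rat_ncpolys n"
  shows "nc_star P \<in> rat_ncpolys n"
proof -
  have "foldr (\<lambda>w R. nc_add (nc_scale (cnj (P w)) (nc_mon (rev w))) R) ws nc_zero \<in> rat_ncpolys n"
    if "set ws \<subseteq> set (nc_support P)" for ws
    using that
  proof (induction ws)
    case (Cons w ws)
    then have "set w \<subseteq> {..<n}" using P by (auto dest: nc_support_words[OF rat_ncpolys_ncpolys])
    moreover have "Re (P w) \<in> \<rat>" "Im (P w) \<in> \<rat>" using P by (auto simp: rat_ncpolys_def)
    ultimately show ?case using Cons by (simp add: nc_add_rat nc_scale_rat nc_mon_rat)
  qed (simp add: nc_zero_rat)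
  then show ?thesis by (simp add: nc_star_def)
qed

text \<open>Unlike in \<open>ncpoly_eval\<close>, the list of words is independent of the
  coefficients. This permits induction on the list, and the evaluation of several polynomials along
  a common one.\<close>

definition word_sum :: "'a calg \<Rightarrow> 'a list \<Rightarrow> (nat list \<Rightarrow> complex) \<Rightarrow> nat list list \<Rightarrow> 'a" where
  "word_sum A x P ws = foldr (\<lambda>w acc. cadd A (cscale A (P w) (ncmon A x w)) acc) ws (czero A)"

lemma word_sum_Nil [simp]: "word_sum A x P [] = czero A"
  and word_sum_Cons [simp]: "word_sum A x P (w # ws) = cadd A (cscale A (P w) (ncmon A x w)) (word_sum A x P ws)"
  by (simp_all add: word_sum_def)

lemma ncmon_Nil [simp]: "ncmon A x [] = cone A"
  and ncmon_Cons [simp]: "ncmon A x (i # w) = cmul A (x ! i) (ncmon A x w)"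
  by (simp_all add: ncmon_def)

lemma ncpoly_eval_word_sum: "ncpoly_eval A x P = word_sum A x P (nc_support P)"
  by (simp add: ncpoly_eval_def word_sum_def nc_support_def)

text \<open>The carrier is explicit because \<open>matalg k\<close> satisfies the algebra laws only on
  \<open>carrier_mat k k\<close>.\<close>

locale star_algebra_on =
  fixes A :: "'a calg" and S :: "'a set"
  assumes zero_closed [simp]: "czero A \<in> S"
    and one_closed [simp]: "cone A \<in> S"
    and add_closed [simp]: "a \<in> S \<Longrightarrow> b \<in> S \<Longrightarrow> cadd A a b \<in> S"
    and mul_closed [simp]: "a \<in> S \<Longrightarrow> b \<in> S \<Longrightarrow> cmul A a b \<in> S"
    and scale_closed [simp]: "a \<in> S \<Longrightarrow> cscale A s a \<in> S"
    and star_closed [simp]: "a \<in> S \<Longrightarrow> cstar A a \<in> S"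
    and add_assoc: "a \<in> S \<Longrightarrow> b \<in> S \<Longrightarrow> c \<in> S \<Longrightarrow> cadd A (cadd A a b) c = cadd A a (cadd A b c)"
    and add_commute: "a \<in> S \<Longrightarrow> b \<in> S \<Longrightarrow> cadd A a b = cadd A b a"
    and add_zero [simp]: "a \<in> S \<Longrightarrow> cadd A (czero A) a = a"
    and scale_scale: "a \<in> S \<Longrightarrow> cscale A s (cscale A t a) = cscale A (s * t) a"
    and scale_one [simp]: "a \<in> S \<Longrightarrow> cscale A 1 a = a"
    and scale_zero [simp]: "a \<in> S \<Longrightarrow> cscale A 0 a = czero A"
    and scale_right_zero [simp]: "cscale A s (czero A) = czero A"
    and scale_add: "a \<in> S \<Longrightarrow> b \<in> S \<Longrightarrow> cscale A s (cadd A a b) = cadd A (cscale A s a) (cscale A s b)"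
    and add_scale: "a \<in> S \<Longrightarrow> cscale A (s + t) a = cadd A (cscale A s a) (cscale A t a)"
    and mul_assoc: "a \<in> S \<Longrightarrow> b \<in> S \<Longrightarrow> c \<in> S \<Longrightarrow> cmul A (cmul A a b) c = cmul A a (cmul A b c)"
    and mul_add: "a \<in> S \<Longrightarrow> b \<in> S \<Longrightarrow> c \<in> S \<Longrightarrow> cmul A a (cadd A b c) = cadd A (cmul A a b) (cmul A a c)"
    and add_mul: "a \<in> S \<Longrightarrow> b \<in> S \<Longrightarrow> c \<in> S \<Longrightarrow> cmul A (cadd A a b) c = cadd A (cmul A a c) (cmul A b c)"
    and scale_mul: "a \<in> S \<Longrightarrow> b \<in> S \<Longrightarrow> cmul A (cscale A s a) b = cscale A s (cmul A a b)"
    and mul_scale: "a \<in> S \<Longrightarrow> b \<in> S \<Longrightarrow> cmul A a (cscale A s b) = cscale A s (cmul A a b)"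
    and one_mul [simp]: "a \<in> S \<Longrightarrow> cmul A (cone A) a = a"
    and mul_one [simp]: "a \<in> S \<Longrightarrow> cmul A a (cone A) = a"
    and zero_mul [simp]: "a \<in> S \<Longrightarrow> cmul A (czero A) a = czero A"
    and mul_zero [simp]: "a \<in> S \<Longrightarrow> cmul A a (czero A) = czero A"
    and star_add: "a \<in> S \<Longrightarrow> b \<in> S \<Longrightarrow> cstar A (cadd A a b) = cadd A (cstar A a) (cstar A b)"
    and star_scale: "a \<in> S \<Longrightarrow> cstar A (cscale A s a) = cscale A (cnj s) (cstar A a)"
    and star_mul: "a \<in> S \<Longrightarrow> b \<in> S \<Longrightarrow> cstar A (cmul A a b) = cmul A (cstar A b) (cstar A a)"
    and star_one [simp]: "cstar A (cone A) = cone A"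
    and star_zero [simp]: "cstar A (czero A) = czero A"
begin

lemma add_left_commute: "a \<in> S \<Longrightarrow> b \<in> S \<Longrightarrow> c \<in> S \<Longrightarrow> cadd A a (cadd A b c) = cadd A b (cadd A a c)"
  by (metis add_assoc add_commute)

end

locale star_algebra_tuple = star_algebra_on +
  fixes x :: "'a list" and n :: nat
  assumes x_closed: "i < n \<Longrightarrow> x ! i \<in> S"
begin

lemma ncmon_closed: "set w \<subseteq> {..<n} \<Longrightarrow> ncmon A x w \<in> S"
  by (induction w) (auto simp: x_closed)

lemma word_sum_closed: "(\<And>w. w \<in> set ws \<Longrightarrow> set w \<subseteq> {..<n}) \<Longrightarrow> word_sum A x P ws \<in> S"
  by (induction ws) (auto simp: ncmon_closed)

lemma ncpoly_eval_closed: "P \<in> ncpolys n \<Longrightarrow> ncpoly_eval A x P \<in> S"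
  unfolding ncpoly_eval_word_sum by (rule word_sum_closed) (rule nc_support_words)

lemma word_sum_filter:
  "(\<And>w. w \<in> set ws \<Longrightarrow> set w \<subseteq> {..<n}) \<Longrightarrow>
    word_sum A x P (filter (\<lambda>w. P w \<noteq> 0) ws) = word_sum A x P ws"
  by (induction ws) (auto simp: ncmon_closed word_sum_closed)

text \<open>Cancellation may make the support of a sum smaller than the union of the supports. Words
  with coefficient 0 contribute nothing, so in \<open>ncpoly_eval_add\<close> all three polynomials
  can be evaluated along the union.\<close>

lemma ncpoly_eval_superset:
  assumes "finite F" "{w. P w \<noteq> 0} \<subseteq> F" "\<And>w. w \<in> F \<Longrightarrow> set w \<subseteq> {..<n}"
  shows "ncpoly_eval A x P = word_sum A x P (sorted_list_of_set F)"
proof -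
  have "filter (\<lambda>w. P w \<noteq> 0) (sorted_list_of_set F) = sorted_list_of_set {w. P w \<noteq> 0}"
    by (rule sorted_distinct_set_unique)
      (use assms finite_subset[OF assms(2,1)] in \<open>auto simp: sorted_wrt_filter\<close>)
  then show ?thesis
    using word_sum_filter[of "sorted_list_of_set F" P] assms
    by (simp add: ncpoly_eval_word_sum nc_support_def)
qed

lemma word_sum_add:
  "(\<And>w. w \<in> set ws \<Longrightarrow> set w \<subseteq> {..<n}) \<Longrightarrow>
    word_sum A x (nc_add P Q) ws = cadd A (word_sum A x P ws) (word_sum A x Q ws)"
  by (induction ws)
    (simp_all add: nc_add_def ncmon_closed word_sum_closed add_scale add_assoc add_left_commute)

lemma ncpoly_eval_add:
  assumes P: "P \<in> ncpolys n" and Q: "Q \<in> ncpolys n"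
  shows "ncpoly_eval A x (nc_add P Q) = cadd A (ncpoly_eval A x P) (ncpoly_eval A x Q)"
proof -
  let ?F = "{w. P w \<noteq> 0} \<union> {w. Q w \<noteq> 0}"
  have F: "finite ?F" "\<And>w. w \<in> ?F \<Longrightarrow> set w \<subseteq> {..<n}"
    using P Q by (auto simp: ncpolys_def)
  have "ncpoly_eval A x R = word_sum A x R (sorted_list_of_set ?F)" if "R \<in> {P, Q, nc_add P Q}" for R
    by (rule ncpoly_eval_superset) (use F that in \<open>auto simp: nc_add_def\<close>)
  moreover have "word_sum A x (nc_add P Q) (sorted_list_of_set ?F) =
      cadd A (word_sum A x P (sorted_list_of_set ?F)) (word_sum A x Q (sorted_list_of_set ?F))"
    using F by (intro word_sum_add) simp
  ultimately show ?thesis by simp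
qed

lemma word_sum_scale:
  "(\<And>w. w \<in> set ws \<Longrightarrow> set w \<subseteq> {..<n}) \<Longrightarrow>
    word_sum A x (nc_scale c P) ws = cscale A c (word_sum A x P ws)"
  by (induction ws) (simp_all add: nc_scale_def ncmon_closed word_sum_closed scale_add scale_scale)

lemma ncpoly_eval_scale:
  assumes P: "P \<in> ncpolys n"
  shows "ncpoly_eval A x (nc_scale c P) = cscale A c (ncpoly_eval A x P)"
proof -
  have "ncpoly_eval A x R = word_sum A x R (nc_support P)" if "R \<in> {P, nc_scale c P}" for R
    unfolding nc_support_def
    by (rule ncpoly_eval_superset) (use P that in \<open>auto simp: nc_scale_def ncpolys_def\<close>)
  then show ?thesis using nc_support_words[OF P] by (simp add: word_sum_scale)
qed

lemma ncpoly_eval_zero: "ncpoly_eval A x nc_zero = czero A"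
  by (simp add: ncpoly_eval_def nc_zero_def)

lemma ncpoly_eval_mon: "set w \<subseteq> {..<n} \<Longrightarrow> ncpoly_eval A x (nc_mon w) = ncmon A x w"
  using ncmon_closed[of w] add_commute[of "ncmon A x w" "czero A"]
  by (simp add: ncpoly_eval_def nc_mon_def)

lemma ncpoly_eval_shift:
  assumes P: "P \<in> ncpolys n" and i: "i < n"
  shows "ncpoly_eval A x (nc_shift i P) = cmul A (x ! i) (ncpoly_eval A x P)"
proof -
  have "sorted_list_of_set ((#) i ` {w. P w \<noteq> 0}) = map ((#) i) (nc_support P)"
    by (rule sorted_distinct_set_unique)
      (use ncpolys_finite[OF P] in \<open>auto simp: nc_support_def sorted_map distinct_map
        sorted_list_of_set.sorted_sorted_key_list_of_set sorted_list_of_set(3)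
        intro: sorted_wrt_mono_rel[of _ "(\<le>)"]\<close>)
  then have "nc_support (nc_shift i P) = map ((#) i) (nc_support P)"
    by (simp add: nc_support_def nc_shift_support)
  then have "ncpoly_eval A x (nc_shift i P) = word_sum A x (nc_shift i P) (map ((#) i) (nc_support P))"
    by (simp add: ncpoly_eval_word_sum)
  also have "\<dots> = cmul A (x ! i) (word_sum A x P (nc_support P))"
  proof -
    have "word_sum A x (nc_shift i P) (map ((#) i) ws) = cmul A (x ! i) (word_sum A x P ws)"
      if "\<And>w. w \<in> set ws \<Longrightarrow> set w \<subseteq> {..<n}" for ws
      using that
      by (induction ws) (simp_all add: i x_closed ncmon_closed word_sum_closed nc_shift_def mul_add mul_scale)
    then show ?thesis using nc_support_words[OF P] by blast
  qed
  finally show ?thesis by (simp add: ncpoly_eval_word_sum)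
qed

lemma ncpoly_eval_shifts:
  assumes Q: "Q \<in> ncpolys n" and w: "set w \<subseteq> {..<n}"
  shows "foldr nc_shift w Q \<in> ncpolys n \<and>
    ncpoly_eval A x (foldr nc_shift w Q) = cmul A (ncmon A x w) (ncpoly_eval A x Q)"
  using w by (induction w) (auto simp: Q ncpoly_eval_closed nc_shift_ncpolys ncpoly_eval_shift x_closed
      ncmon_closed mul_assoc)

lemma ncpoly_eval_mult:
  assumes P: "P \<in> ncpolys n" and Q: "Q \<in> ncpolys n"
  shows "ncpoly_eval A x (nc_mult P Q) = cmul A (ncpoly_eval A x P) (ncpoly_eval A x Q)"
proof -
  let ?R = "\<lambda>ws. foldr (\<lambda>w R. nc_add (nc_scale (P w) (foldr nc_shift w Q)) R) ws nc_zero"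
  have "?R ws \<in> ncpolys n \<and> ncpoly_eval A x (?R ws) = cmul A (word_sum A x P ws) (ncpoly_eval A x Q)"
    if "\<And>w. w \<in> set ws \<Longrightarrow> set w \<subseteq> {..<n}" for ws
    using that
  proof (induction ws)
    case Nil
    then show ?case by (simp add: nc_zero_ncpolys ncpoly_eval_zero ncpoly_eval_closed[OF Q])
  next
    case (Cons w ws)
    then have IH: "?R ws \<in> ncpolys n" "ncpoly_eval A x (?R ws) = cmul A (word_sum A x P ws) (ncpoly_eval A x Q)"
      and w: "set w \<subseteq> {..<n}" and ws: "word_sum A x P ws \<in> S"
      by (auto intro: word_sum_closed)
    note sh = ncpoly_eval_shifts[OF Q w]
    show ?case
      using sh IH w ws ncpoly_eval_closed[OF Q] ncmon_closed[OF w]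
      by (simp add: nc_add_ncpolys nc_scale_ncpolys ncpoly_eval_add ncpoly_eval_scale add_mul scale_mul)
  qed
  from this[of "nc_support P"] nc_support_words[OF P] show ?thesis
    by (simp add: nc_mult_def ncpoly_eval_word_sum[of A x P])
qed

lemma ncmon_append:
  "set u \<subseteq> {..<n} \<Longrightarrow> set w \<subseteq> {..<n} \<Longrightarrow> ncmon A x (u @ w) = cmul A (ncmon A x u) (ncmon A x w)"
  by (induction u) (auto simp: ncmon_closed mul_assoc x_closed)

lemma ncmon_rev:
  assumes "\<And>i. i < n \<Longrightarrow> cstar A (x ! i) = x ! i"
  shows "set w \<subseteq> {..<n} \<Longrightarrow> ncmon A x (rev w) = cstar A (ncmon A x w)"
  by (induction w) (auto simp: ncmon_append ncmon_closed star_mul assms x_closed)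

lemma ncpoly_eval_star:
  assumes sa: "\<And>i. i < n \<Longrightarrow> cstar A (x ! i) = x ! i" and P: "P \<in> ncpolys n"
  shows "ncpoly_eval A x (nc_star P) = cstar A (ncpoly_eval A x P)"
proof -
  let ?R = "\<lambda>ws. foldr (\<lambda>w R. nc_add (nc_scale (cnj (P w)) (nc_mon (rev w))) R) ws nc_zero"
  have "?R ws \<in> ncpolys n \<and> ncpoly_eval A x (?R ws) = cstar A (word_sum A x P ws)"
    if "\<And>w. w \<in> set ws \<Longrightarrow> set w \<subseteq> {..<n}" for ws
    using that
  proof (induction ws)
    case (Cons w ws)
    then have IH: "?R ws \<in> ncpolys n" "ncpoly_eval A x (?R ws) = cstar A (word_sum A x P ws)"
      and w: "set w \<subseteq> {..<n}" and ws: "word_sum A x P ws \<in> S"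
      by (auto intro: word_sum_closed)
    have rw: "nc_mon (rev w) \<in> ncpolys n" using w by (intro nc_mon_ncpolys) simp
    show ?case
      using rw IH w ws ncmon_closed[OF w]
      by (simp add: nc_add_ncpolys nc_scale_ncpolys ncpoly_eval_add ncpoly_eval_scale ncpoly_eval_mon
          ncmon_rev[OF sa] star_add star_scale)
  qed (simp add: nc_zero_ncpolys ncpoly_eval_zero)
  from this[of "nc_support P"] nc_support_words[OF P] show ?thesis
    by (simp add: nc_star_def ncpoly_eval_word_sum[of A x P])
qed

end

section \<open>Matrix algebras and C*-algebras as instances\<close>

lemma matalg_simps [simp]:
  "cadd (matalg k) = (+)" "cmul (matalg k) = (*)" "cscale (matalg k) = (\<cdot>\<^sub>m)" "cstar (matalg k) = madj"
  "czero (matalg k) = 0\<^sub>m k k" "cone (matalg k) = 1\<^sub>m k"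
  by (auto simp: matalg_def madj_def fun_eq_iff)

lemma matalg_star_algebra: "star_algebra_on (matalg k) (carrier_mat k k)"
proof
qed (auto simp: mat_dim_simps madj_add madj_smult madj_mult add_smult_distrib_left_mat[of _ k k]
    add_smult_distrib_right_mat assoc_add_mat[of _ k k] comm_add_mat[of _ k k] intro!: eq_matI)

lemma matalg_star_algebra_tuple:
  "C \<in> tuples n k \<Longrightarrow> star_algebra_tuple (matalg k) (carrier_mat k k) C n"
  by (intro star_algebra_tuple.intro matalg_star_algebra star_algebra_tuple_axioms.intro)
    (auto simp: tuples_def)

locale cstar_algebra =
  fixes A :: "'a calg"
  assumes unital_cstar: "unital_cstar_algebra A"
begin

lemma
  shows cadd_assoc: "cadd A (cadd A a b) c = cadd A a (cadd A b c)"
    and cadd_commute: "cadd A a b = cadd A b a"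
    and cadd_zero [simp]: "cadd A (czero A) a = a"
    and cadd_neg: "cadd A a (cscale A (-1) a) = czero A"
    and cscale_cscale: "cscale A s (cscale A t a) = cscale A (s * t) a"
    and cscale_one [simp]: "cscale A 1 a = a"
    and cscale_add: "cscale A s (cadd A a b) = cadd A (cscale A s a) (cscale A s b)"
    and cadd_scale: "cscale A (s + t) a = cadd A (cscale A s a) (cscale A t a)"
    and cmul_assoc: "cmul A (cmul A a b) c = cmul A a (cmul A b c)"
    and cmul_add: "cmul A a (cadd A b c) = cadd A (cmul A a b) (cmul A a c)"
    and cadd_mul: "cmul A (cadd A a b) c = cadd A (cmul A a c) (cmul A b c)"
    and cscale_mul: "cmul A (cscale A s a) b = cscale A s (cmul A a b)"
    and cmul_scale: "cmul A a (cscale A s b) = cscale A s (cmul A a b)"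
    and cone_mul [simp]: "cmul A (cone A) a = a"
    and cmul_one [simp]: "cmul A a (cone A) = a"
    and cone_neq_zero: "cone A \<noteq> czero A"
    and cstar_add: "cstar A (cadd A a b) = cadd A (cstar A a) (cstar A b)"
    and cstar_scale: "cstar A (cscale A s a) = cscale A (cnj s) (cstar A a)"
    and cstar_mul: "cstar A (cmul A a b) = cmul A (cstar A b) (cstar A a)"
    and cstar_cstar [simp]: "cstar A (cstar A a) = a"
    and cnorm_eq_0: "cnorm A a = 0 \<longleftrightarrow> a = czero A"
    and cnorm_nonneg [simp]: "0 \<le> cnorm A a"
    and cnorm_add: "cnorm A (cadd A a b) \<le> cnorm A a + cnorm A b"
    and cnorm_scale: "cnorm A (cscale A s a) = cmod s * cnorm A a"
    and cnorm_mul: "cnorm A (cmul A a b) \<le> cnorm A a * cnorm A b"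
    and cnorm_star_mul: "cnorm A (cmul A (cstar A a) a) = (cnorm A a)\<^sup>2"
  using unital_cstar unfolding unital_cstar_algebra_def by (blast | simp)+

lemma cauchy_convergent:
  fixes f :: "nat \<Rightarrow> 'a"
  assumes "\<And>e. e > 0 \<Longrightarrow> \<exists>N. \<forall>m\<ge>N. \<forall>n\<ge>N. cnorm A (csub A (f m) (f n)) < e"
  obtains l where "\<And>e. e > 0 \<Longrightarrow> \<exists>N. \<forall>n\<ge>N. cnorm A (csub A (f n) l) < e"
proof -
  have "\<forall>f :: nat \<Rightarrow> 'a. (\<forall>e>0. \<exists>N. \<forall>m\<ge>N. \<forall>n\<ge>N. cnorm A (csub A (f m) (f n)) < e) \<longrightarrow>
        (\<exists>l. \<forall>e>0. \<exists>N. \<forall>n\<ge>N. cnorm A (csub A (f n) l) < e)"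
    using unital_cstar unfolding unital_cstar_algebra_def by (elim conjE)
  then show ?thesis using assms that by blast
qed

lemma cnorm_zero [simp]: "cnorm A (czero A) = 0"
  by (simp add: cnorm_eq_0)

text \<open>The absorption laws of zero are read off from the norm, which vanishes at
  \<open>czero A\<close> only.\<close>

lemma cscale_zero_right [simp]: "cscale A s (czero A) = czero A"
  using cnorm_scale[of s "czero A"] by (simp flip: cnorm_eq_0)

lemma cscale_zero [simp]: "cscale A 0 a = czero A"
  using cnorm_scale[of 0 a] by (simp flip: cnorm_eq_0)

lemma cmul_zero [simp]: "cmul A a (czero A) = czero A"
  using cnorm_mul[of a "czero A"] cnorm_nonneg[of "cmul A a (czero A)"]
  by (simp flip: cnorm_eq_0)

lemma czero_mul [simp]: "cmul A (czero A) a = czero A"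
  using cnorm_mul[of "czero A" a] cnorm_nonneg[of "cmul A (czero A) a"]
  by (simp flip: cnorm_eq_0)

lemma cstar_one [simp]: "cstar A (cone A) = cone A"
  using cstar_mul[of "cstar A (cone A)" "cone A"] by simp

lemma cstar_zero [simp]: "cstar A (czero A) = czero A"
  using cstar_scale[of 0 "czero A"] by simp

lemma cnorm_star: "cnorm A (cstar A a) = cnorm A a"
proof -
  have *: "cnorm A a \<le> cnorm A (cstar A a)" for a
  proof (cases "cnorm A a = 0")
    case False
    have "(cnorm A a)\<^sup>2 \<le> cnorm A (cstar A a) * cnorm A a"
      using cnorm_mul[of "cstar A a" a] by (simp add: cnorm_star_mul)
    then show ?thesis using False cnorm_nonneg[of a] by (simp add: power2_eq_square)
  qed simp
  from *[of a] *[of "cstar A a"] show ?thesis by simp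
qed

lemma cnorm_one: "cnorm A (cone A) = 1"
  using cnorm_star_mul[of "cone A"] cone_neq_zero cnorm_eq_0[of "cone A"]
  by (simp add: power2_eq_square)

lemma csub_triangle: "cnorm A (csub A a c) \<le> cnorm A (csub A a b) + cnorm A (csub A b c)"
proof -
  have "csub A a c = cadd A (csub A a b) (csub A b c)"
  proof -
    have "cadd A (csub A a b) (csub A b c)
        = cadd A a (cadd A (cadd A b (cscale A (-1) b)) (cscale A (-1) c))"
      unfolding csub_def using cadd_assoc cadd_commute by metis
    then show ?thesis by (simp add: cadd_neg csub_def)
  qed
  then show ?thesis by (simp add: cnorm_add)
qed

lemma csub_self [simp]: "csub A a a = czero A"
  by (simp add: csub_def cadd_neg)

lemma csub_zero [simp]: "csub A a (czero A) = a"
  using cadd_commute[of a "czero A"] by (simp add: csub_def)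

lemma cnorm_csub_commute: "cnorm A (csub A a b) = cnorm A (csub A b a)"
proof -
  have "csub A a b = cscale A (-1) (csub A b a)"
    by (simp add: csub_def cscale_add cscale_cscale cadd_commute)
  then show ?thesis by (simp add: cnorm_scale)
qed

lemma cnorm_le_csub: "cnorm A a \<le> cnorm A b + cnorm A (csub A a b)"
  using csub_triangle[of a "czero A" b] by simp

lemma cnorm_csub_add: "cnorm A (csub A (cadd A a b) (cadd A c d)) \<le> cnorm A (csub A a c) + cnorm A (csub A b d)"
proof -
  have "csub A (cadd A a b) (cadd A c d) = cadd A (csub A a c) (csub A b d)"
    unfolding csub_def cscale_add using cadd_assoc cadd_commute by metis
  then show ?thesis by (simp add: cnorm_add)
qed

lemma cnorm_csub_scale: "cnorm A (csub A (cscale A s a) (cscale A s b)) = cmod s * cnorm A (csub A a b)"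
proof -
  have "csub A (cscale A s a) (cscale A s b) = cscale A s (csub A a b)"
    by (simp add: csub_def cscale_add cscale_cscale)
  then show ?thesis by (simp add: cnorm_scale)
qed

lemma cnorm_csub_scale_left: "cnorm A (csub A (cscale A s a) (cscale A t a)) = cmod (s - t) * cnorm A a"
proof -
  have "csub A (cscale A s a) (cscale A t a) = cscale A (s - t) a"
    using cadd_scale[of s "- t" a] by (simp add: csub_def cscale_cscale)
  then show ?thesis by (simp add: cnorm_scale)
qed

lemma cnorm_csub_mul:
  "cnorm A (csub A (cmul A a b) (cmul A c d)) \<le> cnorm A (csub A a c) * cnorm A b + cnorm A c * cnorm A (csub A b d)"
proof -
  have 1: "csub A (cmul A a b) (cmul A c b) = cmul A (csub A a c) b"
    by (simp add: csub_def cadd_mul cscale_mul)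
  have 2: "csub A (cmul A c b) (cmul A c d) = cmul A c (csub A b d)"
    by (simp add: csub_def cmul_add cmul_scale)
  have "cnorm A (csub A (cmul A a b) (cmul A c d))
      \<le> cnorm A (cmul A (csub A a c) b) + cnorm A (cmul A c (csub A b d))"
    using csub_triangle[of "cmul A a b" "cmul A c d" "cmul A c b"] unfolding 1 2 .
  then show ?thesis
    using cnorm_mul[of "csub A a c" b] cnorm_mul[of c "csub A b d"] by linarith
qed

lemma cnorm_csub_star: "cnorm A (csub A (cstar A a) (cstar A b)) = cnorm A (csub A a b)"
proof -
  have "csub A (cstar A a) (cstar A b) = cstar A (csub A a b)"
    by (simp add: csub_def cstar_add cstar_scale)
  then show ?thesis by (simp add: cnorm_star)
qed

lemma star_algebra_tuple: "star_algebra_tuple A UNIV x n"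
  by unfold_locales
    (simp_all add: cscale_cscale cscale_add cadd_scale cmul_assoc cmul_add cadd_mul
      cscale_mul cmul_scale cstar_add cstar_scale cstar_mul, rule cadd_assoc, rule cadd_commute)

end

subsection \<open>Matrix models of a C*-algebra\<close>

lemma opnorm_self_minus [simp]: "opnorm (A - A) = 0"
proof -
  have "A - A = 0\<^sub>m (dim_row A) (dim_col A)" by (rule eq_matI) auto
  then show ?thesis by (simp only: opnorm_zero)
qed

lemma opnorm_smult_diff:
  assumes "dim_row A = dim_row B" "dim_col A = dim_col B"
  shows "opnorm (s \<cdot>\<^sub>m A - t \<cdot>\<^sub>m B) \<le> cmod s * opnorm (A - B) + cmod (s - t) * opnorm B"
proof -
  have "s \<cdot>\<^sub>m A - t \<cdot>\<^sub>m B = s \<cdot>\<^sub>m (A - B) + (s - t) \<cdot>\<^sub>m B"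
    by (rule eq_matI) (use assms in \<open>auto simp: algebra_simps\<close>)
  then have "opnorm (s \<cdot>\<^sub>m A - t \<cdot>\<^sub>m B) \<le> opnorm (s \<cdot>\<^sub>m (A - B)) + opnorm ((s - t) \<cdot>\<^sub>m B)"
    using opnorm_add[of "s \<cdot>\<^sub>m (A - B)" "(s - t) \<cdot>\<^sub>m B"] assms by simp
  then show ?thesis
    using opnorm_smult_le[of s "A - B"] opnorm_smult_le[of "s - t" B] by linarith
qed

lemma opnorm_madj_diff:
  assumes "dim_row A = dim_row B" "dim_col A = dim_col B"
  shows "opnorm (madj A - madj B) = opnorm (A - B)"
  using opnorm_madj[of "A - B"] assms by (simp add: madj_minus)

lemma rational_complex_approx:
  assumes "e > 0"
  obtains q where "Re q \<in> \<rat>" "Im q \<in> \<rat>" "cmod (c - q) < e"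
proof -
  obtain a b where a: "a \<in> \<rat>" "Re c < a" "a < Re c + e / 2" and b: "b \<in> \<rat>" "Im c < b" "b < Im c + e / 2"
    using Rats_dense_in_real[of "Re c" "Re c + e / 2"] Rats_dense_in_real[of "Im c" "Im c + e / 2"] assms
    by auto
  have "cmod (c - Complex a b) \<le> \<bar>Re (c - Complex a b)\<bar> + \<bar>Im (c - Complex a b)\<bar>"
    by (rule cmod_le)
  also have "\<dots> < e" using a b by simp
  finally show ?thesis using a b by (intro that[of "Complex a b"]) auto
qed

text \<open>Every element of the algebra is modelled by a sequence of matrices, uniquely up to null
  sequences, as in a norm ultraproduct.\<close>

locale microstate_sequence = cstar_algebra D for D :: "'d calg" +
  fixes z :: "'d list" and k :: "nat \<Rightarrow> nat" and C :: "nat \<Rightarrow> complex mat list"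
  assumes z_self_adjoint: "i < length z \<Longrightarrow> cstar D (z ! i) = z ! i"
    and C_tuples: "C m \<in> tuples (length z) (k m)"
    and C_hermitian: "i < length z \<Longrightarrow> madj (C m ! i) = C m ! i"
    and norm_converges: "P \<in> rat_ncpolys (length z) \<Longrightarrow>
      (\<lambda>m. opnorm (ncpoly_eval (matalg (k m)) (C m) P)) \<longlonglongrightarrow> cnorm D (ncpoly_eval D z P)"
    and z_generates: "generates D z"
begin

abbreviation ev :: "nat \<Rightarrow> (nat list \<Rightarrow> complex) \<Rightarrow> complex mat" where
  "ev m P \<equiv> ncpoly_eval (matalg (k m)) (C m) P"

sublocale tz: star_algebra_tuple D UNIV z "length z"
  by (rule star_algebra_tuple)

sublocale tC: star_algebra_tuple "matalg (k m)" "carrier_mat (k m) (k m)" "C m" "length z" for m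
  by (rule matalg_star_algebra_tuple) (rule C_tuples)

lemma ev_carrier: "P \<in> ncpolys (length z) \<Longrightarrow> ev m P \<in> carrier_mat (k m) (k m)"
  by (rule tC.ncpoly_eval_closed)

text \<open>One suitable \<open>P\<close> for each tolerance is enough: convergence of norms,
  applied to differences of polynomials, forces any other rational polynomial near \<open>d\<close>
  to be near \<open>M\<close> eventually.\<close>

definition models :: "(nat \<Rightarrow> complex mat) \<Rightarrow> 'd \<Rightarrow> bool" where
  "models M d \<longleftrightarrow> (\<forall>m. M m \<in> carrier_mat (k m) (k m)) \<and>
     (\<forall>e>0. \<exists>P\<in>rat_ncpolys (length z). cnorm D (csub D d (ncpoly_eval D z P)) < e \<and>
        (\<forall>\<^sub>F m in sequentially. opnorm (M m - ev m P) < e))"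

lemma models_carrier: "models M d \<Longrightarrow> M m \<in> carrier_mat (k m) (k m)"
  by (simp add: models_def)

lemma models_dim: "models M d \<Longrightarrow> dim_row (M m) = k m \<and> dim_col (M m) = k m"
  using models_carrier by auto

lemma modelsE:
  assumes "models M d" "e > 0"
  obtains P where "P \<in> rat_ncpolys (length z)" "cnorm D (csub D d (ncpoly_eval D z P)) < e"
    "\<forall>\<^sub>F m in sequentially. opnorm (M m - ev m P) < e"
    "\<forall>m. ev m P \<in> carrier_mat (k m) (k m)"
proof -
  obtain P where "P \<in> rat_ncpolys (length z)" "cnorm D (csub D d (ncpoly_eval D z P)) < e"
    "\<forall>\<^sub>F m in sequentially. opnorm (M m - ev m P) < e"
    using assms unfolding models_def by blast
  then show ?thesis using that[of P] ev_carrier rat_ncpolys_ncpolys by blast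
qed

lemma models_rat_ncpoly: "P \<in> rat_ncpolys (length z) \<Longrightarrow> models (\<lambda>m. ev m P) (ncpoly_eval D z P)"
  unfolding models_def by (auto intro!: bexI[of _ P] ev_carrier simp: rat_ncpolys_ncpolys)

lemma models_approx:
  assumes "\<And>m. M m \<in> carrier_mat (k m) (k m)"
    and "\<And>e. e > 0 \<Longrightarrow> \<exists>N d'. models N d' \<and> cnorm D (csub D d d') < e \<and>
      (\<forall>\<^sub>F m in sequentially. opnorm (M m - N m) < e)"
  shows "models M d"
  unfolding models_def
proof (intro conjI allI impI)
  fix e :: real assume "e > 0"
  then obtain N d' where N: "models N d'" "cnorm D (csub D d d') < e / 2"
      "\<forall>\<^sub>F m in sequentially. opnorm (M m - N m) < e / 2"
    using assms(2)[of "e / 2"] by auto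
  obtain P where P: "P \<in> rat_ncpolys (length z)" "cnorm D (csub D d' (ncpoly_eval D z P)) < e / 2"
      "\<forall>\<^sub>F m in sequentially. opnorm (N m - ev m P) < e / 2" "\<forall>m. ev m P \<in> carrier_mat (k m) (k m)"
    using modelsE[OF N(1), of "e / 2"] \<open>e > 0\<close> by auto
  have "cnorm D (csub D d (ncpoly_eval D z P)) < e"
    using csub_triangle[of d "ncpoly_eval D z P" d'] N(2) P(2) by simp
  moreover have "\<forall>\<^sub>F m in sequentially. opnorm (M m - ev m P) < e"
    using N(3) P(3)
  proof eventually_elim
    case (elim m)
    have "opnorm (M m - ev m P) \<le> opnorm (M m - N m) + opnorm (N m - ev m P)"
      by (rule opnorm_triangle) (use assms(1)[of m] models_carrier[OF N(1), of m] P(4)[rule_format, of m] in auto)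
    with elim show ?case by simp
  qed
  ultimately show "\<exists>P\<in>rat_ncpolys (length z). cnorm D (csub D d (ncpoly_eval D z P)) < e \<and>
        (\<forall>\<^sub>F m in sequentially. opnorm (M m - ev m P) < e)"
    using P(1) by blast
qed (rule assms(1))

lemma models_cong:
  assumes M: "models M d" and N: "\<And>m. N m \<in> carrier_mat (k m) (k m)"
    and "(\<lambda>m. opnorm (N m - M m)) \<longlonglongrightarrow> 0"
  shows "models N d"
proof (rule models_approx[OF N])
  fix e :: real assume "e > 0"
  with M assms(3) show "\<exists>M' d'. models M' d' \<and> cnorm D (csub D d d') < e \<and>
      (\<forall>\<^sub>F m in sequentially. opnorm (N m - M' m) < e)"
    by (intro exI[of _ M] exI[of _ d]) (auto dest: order_tendstoD(2))
qed

text \<open>A three-epsilon argument through \<open>P\<close>. Applied to a difference that is zero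
  in \<open>D\<close>, it says that a relation valid in \<open>D\<close> holds for the models up to
  a null sequence.\<close>

lemma models_norm:
  assumes M: "models M d"
  shows "(\<lambda>m. opnorm (M m)) \<longlonglongrightarrow> cnorm D d"
proof (rule tendstoI)
  fix e :: real assume "e > 0"
  then obtain P where P: "P \<in> rat_ncpolys (length z)" "cnorm D (csub D d (ncpoly_eval D z P)) < e / 3"
      "\<forall>\<^sub>F m in sequentially. opnorm (M m - ev m P) < e / 3" "\<forall>m. ev m P \<in> carrier_mat (k m) (k m)"
    using modelsE[OF M, of "e / 3"] by auto
  have "\<forall>\<^sub>F m in sequentially. dist (opnorm (ev m P)) (cnorm D (ncpoly_eval D z P)) < e / 3"
    using tendstoD[OF norm_converges[OF P(1)], of "e / 3"] \<open>e > 0\<close> by simp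
  with P(3) show "\<forall>\<^sub>F m in sequentially. dist (opnorm (M m)) (cnorm D d) < e"
  proof eventually_elim
    case (elim m)
    have "opnorm (M m) \<le> opnorm (ev m P) + opnorm (M m - ev m P)"
      by (rule opnorm_le_diff) (use models_dim[OF M, of m] P(4)[rule_format, of m] in auto)
    moreover have "opnorm (ev m P) \<le> opnorm (M m) + opnorm (ev m P - M m)"
      by (rule opnorm_le_diff) (use models_dim[OF M, of m] P(4)[rule_format, of m] in auto)
    moreover have "opnorm (ev m P - M m) = opnorm (M m - ev m P)"
      by (rule opnorm_minus_commute) (use models_dim[OF M, of m] P(4)[rule_format, of m] in auto)
    ultimately show ?case
      using elim P(2) cnorm_le_csub[of d "ncpoly_eval D z P"] cnorm_le_csub[of "ncpoly_eval D z P" d]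
        cnorm_csub_commute[of d "ncpoly_eval D z P"]
      unfolding dist_real_def by linarith
  qed
qed

lemma models_add:
  assumes M: "models M d" and N: "models N d'"
  shows "models (\<lambda>m. M m + N m) (cadd D d d')"
  unfolding models_def
proof (intro conjI allI impI)
  show "M m + N m \<in> carrier_mat (k m) (k m)" for m
    using models_carrier[OF M] models_carrier[OF N] by auto
  fix e :: real assume "e > 0"
  then have e2: "e / 2 > 0" by simp
  obtain P where P: "P \<in> rat_ncpolys (length z)" "cnorm D (csub D d (ncpoly_eval D z P)) < e / 2"
      "\<forall>\<^sub>F m in sequentially. opnorm (M m - ev m P) < e / 2" "\<forall>m. ev m P \<in> carrier_mat (k m) (k m)"
    using modelsE[OF M e2] .
  obtain Q where Q: "Q \<in> rat_ncpolys (length z)" "cnorm D (csub D d' (ncpoly_eval D z Q)) < e / 2"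
      "\<forall>\<^sub>F m in sequentially. opnorm (N m - ev m Q) < e / 2" "\<forall>m. ev m Q \<in> carrier_mat (k m) (k m)"
    using modelsE[OF N e2] .
  note PQ = rat_ncpolys_ncpolys[OF P(1)] rat_ncpolys_ncpolys[OF Q(1)]
  have "cnorm D (csub D (cadd D d d') (ncpoly_eval D z (nc_add P Q))) < e"
    using cnorm_csub_add[of d d' "ncpoly_eval D z P" "ncpoly_eval D z Q"] P(2) Q(2)
    by (simp add: tz.ncpoly_eval_add[OF PQ])
  moreover have "\<forall>\<^sub>F m in sequentially. opnorm (M m + N m - ev m (nc_add P Q)) < e"
    using P(3) Q(3)
  proof eventually_elim
    case (elim m)
    have "opnorm (M m + N m - (ev m P + ev m Q)) \<le> opnorm (M m - ev m P) + opnorm (N m - ev m Q)"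
      by (rule opnorm_sum_diff) (rule models_carrier[OF M] models_carrier[OF N] P(4)[rule_format] Q(4)[rule_format])+
    with elim show ?case by (simp add: tC.ncpoly_eval_add[OF PQ])
  qed
  ultimately show "\<exists>P\<in>rat_ncpolys (length z). cnorm D (csub D (cadd D d d') (ncpoly_eval D z P)) < e \<and>
        (\<forall>\<^sub>F m in sequentially. opnorm (M m + N m - ev m P) < e)"
    using nc_add_rat[OF P(1) Q(1)] by blast
qed

lemma models_scale:
  assumes M: "models M d"
  shows "models (\<lambda>m. c \<cdot>\<^sub>m M m) (cscale D c d)"
  unfolding models_def
proof (intro conjI allI impI)
  show "c \<cdot>\<^sub>m M m \<in> carrier_mat (k m) (k m)" for m
    using models_carrier[OF M] by auto
  fix e :: real assume e: "e > 0"
  define e' where "e' = e / (2 * (cmod c + 1))"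
  have e': "e' > 0" "cmod c * e' < e / 2"
    using e by (auto simp: e'_def field_simps add_pos_nonneg)
  obtain P where P: "P \<in> rat_ncpolys (length z)" "cnorm D (csub D d (ncpoly_eval D z P)) < e'"
      "\<forall>\<^sub>F m in sequentially. opnorm (M m - ev m P) < e'" "\<forall>m. ev m P \<in> carrier_mat (k m) (k m)"
    using modelsE[OF M e'(1)] .
  \<comment> \<open>The scalar \<open>c\<close> has to be replaced by a rational \<open>q\<close>,
    at a cost of \<open>cmod (c - q)\<close> times the norm of the evaluation of \<open>P\<close>.
    \<open>K\<close> bounds this norm in \<open>D\<close> and, for large \<open>m\<close>, at the
    microstates.\<close>
  define K where "K = cnorm D (ncpoly_eval D z P) + 1"
  have K: "K > 0" by (simp add: K_def add_nonneg_pos)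
  then obtain q where q: "Re q \<in> \<rat>" "Im q \<in> \<rat>" "cmod (c - q) < e / (2 * K)"
    using rational_complex_approx[of "e / (2 * K)" c] e by (metis divide_pos_pos mult_pos_pos zero_less_numeral)
  have small: "cmod c * s + cmod (c - q) * t < e" if "s < e'" "t \<le> K" "0 \<le> t" for s t
  proof -
    have "cmod c * s \<le> cmod c * e'" using that by (intro mult_left_mono) auto
    moreover have "cmod (c - q) * t \<le> e / (2 * K) * K" using that q K e by (intro mult_mono) auto
    ultimately show ?thesis using e' K by (simp add: field_simps)
  qed
  have "cnorm D (csub D (cscale D c d) (cscale D q (ncpoly_eval D z P)))
      \<le> cmod c * cnorm D (csub D d (ncpoly_eval D z P)) + cmod (c - q) * cnorm D (ncpoly_eval D z P)"
    using csub_triangle[of "cscale D c d" "cscale D q (ncpoly_eval D z P)" "cscale D c (ncpoly_eval D z P)"]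
    by (simp add: cnorm_csub_scale cnorm_csub_scale_left)
  also have "\<dots> < e" using P(2) by (intro small) (auto simp: K_def)
  finally have "cnorm D (csub D (cscale D c d) (ncpoly_eval D z (nc_scale q P))) < e"
    by (simp add: tz.ncpoly_eval_scale[OF rat_ncpolys_ncpolys[OF P(1)]])
  moreover
  have "\<forall>\<^sub>F m in sequentially. opnorm (ev m P) < K"
    by (rule order_tendstoD(2)[OF norm_converges[OF P(1)]]) (simp add: K_def)
  with P(3) have "\<forall>\<^sub>F m in sequentially. opnorm (c \<cdot>\<^sub>m M m - ev m (nc_scale q P)) < e"
  proof eventually_elim
    case (elim m)
    have "opnorm (c \<cdot>\<^sub>m M m - q \<cdot>\<^sub>m ev m P) \<le> cmod c * opnorm (M m - ev m P) + cmod (c - q) * opnorm (ev m P)"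
      by (rule opnorm_smult_diff) (use models_dim[OF M, of m] P(4)[rule_format, of m] in auto)
    also have "\<dots> < e" using elim by (intro small) auto
    finally show ?case by (simp add: tC.ncpoly_eval_scale[OF rat_ncpolys_ncpolys[OF P(1)]])
  qed
  ultimately show "\<exists>P\<in>rat_ncpolys (length z). cnorm D (csub D (cscale D c d) (ncpoly_eval D z P)) < e \<and>
        (\<forall>\<^sub>F m in sequentially. opnorm (c \<cdot>\<^sub>m M m - ev m P) < e)"
    using nc_scale_rat[OF q(1,2) P(1)] by blast
qed

lemma models_mult:
  assumes M: "models M d" and N: "models N d'"
  shows "models (\<lambda>m. M m * N m) (cmul D d d')"
  unfolding models_def
proof (intro conjI allI impI)
  show "M m * N m \<in> carrier_mat (k m) (k m)" for m
    using models_dim[OF M, of m] models_dim[OF N, of m] by (intro carrier_matI) auto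
  fix e :: real assume e: "e > 0"
  \<comment> \<open>This is the sum of \<open>cnorm D d + 1\<close> and
    \<open>cnorm D d' + 1\<close>, which bound the factors that survive in the two terms of the
    product estimate.\<close>
  define K where "K = cnorm D d + cnorm D d' + 2"
  have K: "K > 0" by (simp add: K_def add_nonneg_pos)
  define e' where "e' = min 1 (e / (2 * K))"
  have e': "e' > 0" "e' \<le> 1" "e' * K < e" using e K by (auto simp: e'_def min_def field_simps)
  obtain P where P: "P \<in> rat_ncpolys (length z)" "cnorm D (csub D d (ncpoly_eval D z P)) < e'"
      "\<forall>\<^sub>F m in sequentially. opnorm (M m - ev m P) < e'" "\<forall>m. ev m P \<in> carrier_mat (k m) (k m)"
    using modelsE[OF M e'(1)] .
  obtain Q where Q: "Q \<in> rat_ncpolys (length z)" "cnorm D (csub D d' (ncpoly_eval D z Q)) < e'"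
      "\<forall>\<^sub>F m in sequentially. opnorm (N m - ev m Q) < e'" "\<forall>m. ev m Q \<in> carrier_mat (k m) (k m)"
    using modelsE[OF N e'(1)] .
  note PQ = rat_ncpolys_ncpolys[OF P(1)] rat_ncpolys_ncpolys[OF Q(1)]
  have small: "s * a + b * t < e"
    if "s < e'" "t < e'" "a < cnorm D d' + 1" "b < cnorm D d + 1" "0 \<le> s" "0 \<le> t" "0 \<le> a" "0 \<le> b" for s t a b
  proof -
    have "s * a + b * t \<le> e' * (cnorm D d' + 1) + (cnorm D d + 1) * e'"
      using that by (intro add_mono mult_mono) auto
    also have "\<dots> = e' * K" by (simp add: K_def algebra_simps)
    finally show ?thesis using e'(3) by simp
  qed
  have nP: "cnorm D (ncpoly_eval D z P) < cnorm D d + 1"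
    using cnorm_le_csub[of "ncpoly_eval D z P" d] P(2) e'(2) cnorm_csub_commute[of d "ncpoly_eval D z P"] by simp
  have "cnorm D (csub D (cmul D d d') (cmul D (ncpoly_eval D z P) (ncpoly_eval D z Q))) < e"
    by (rule le_less_trans[OF cnorm_csub_mul]) (use P(2) Q(2) nP in \<open>auto intro!: small\<close>)
  then have dist: "cnorm D (csub D (cmul D d d') (ncpoly_eval D z (nc_mult P Q))) < e"
    by (simp add: tz.ncpoly_eval_mult[OF PQ])
  have "\<forall>\<^sub>F m in sequentially. opnorm (ev m P) < cnorm D d + 1"
    by (rule order_tendstoD(2)[OF norm_converges[OF P(1)] nP])
  moreover have "\<forall>\<^sub>F m in sequentially. opnorm (N m) < cnorm D d' + 1"
    by (rule order_tendstoD(2)[OF models_norm[OF N]]) simp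
  ultimately have "\<forall>\<^sub>F m in sequentially. opnorm (M m * N m - ev m (nc_mult P Q)) < e"
    using P(3) Q(3)
  proof eventually_elim
    case (elim m)
    have "opnorm (M m * N m - ev m P * ev m Q)
        \<le> opnorm (M m - ev m P) * opnorm (N m) + opnorm (ev m P) * opnorm (N m - ev m Q)"
      by (rule opnorm_mult_diff) (rule models_carrier[OF M] models_carrier[OF N] P(4)[rule_format] Q(4)[rule_format])+
    also have "\<dots> < e" using elim by (intro small) auto
    finally show ?case by (simp add: tC.ncpoly_eval_mult[OF PQ])
  qed
  then show "\<exists>P\<in>rat_ncpolys (length z). cnorm D (csub D (cmul D d d') (ncpoly_eval D z P)) < e \<and>
        (\<forall>\<^sub>F m in sequentially. opnorm (M m * N m - ev m P) < e)"
    using nc_mult_rat[OF P(1) Q(1)] dist by blast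
qed

lemma models_star:
  assumes M: "models M d"
  shows "models (\<lambda>m. madj (M m)) (cstar D d)"
  unfolding models_def
proof (intro conjI allI impI)
  show "madj (M m) \<in> carrier_mat (k m) (k m)" for m
    using models_carrier[OF M] by auto
  fix e :: real assume e: "e > 0"
  obtain P where P: "P \<in> rat_ncpolys (length z)" "cnorm D (csub D d (ncpoly_eval D z P)) < e"
      "\<forall>\<^sub>F m in sequentially. opnorm (M m - ev m P) < e" "\<forall>m. ev m P \<in> carrier_mat (k m) (k m)"
    using modelsE[OF M e] .
  note PP = rat_ncpolys_ncpolys[OF P(1)]
  have "cnorm D (csub D (cstar D d) (ncpoly_eval D z (nc_star P))) < e"
    using P(2) by (simp add: tz.ncpoly_eval_star[OF z_self_adjoint PP] cnorm_csub_star)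
  moreover have "\<forall>\<^sub>F m in sequentially. opnorm (madj (M m) - ev m (nc_star P)) < e"
    using P(3)
  proof eventually_elim
    case (elim m)
    have "opnorm (madj (M m) - madj (ev m P)) = opnorm (M m - ev m P)"
      by (rule opnorm_madj_diff) (use models_dim[OF M, of m] P(4)[rule_format, of m] in auto)
    with elim show ?case using tC.ncpoly_eval_star[of m P] PP C_hermitian by simp
  qed
  ultimately show "\<exists>P\<in>rat_ncpolys (length z). cnorm D (csub D (cstar D d) (ncpoly_eval D z P)) < e \<and>
        (\<forall>\<^sub>F m in sequentially. opnorm (madj (M m) - ev m P) < e)"
    using nc_star_rat[OF P(1)] by blast
qed

lemma models_minus:
  assumes M: "models M d" and N: "models N d'"
  shows "models (\<lambda>m. M m - N m) (csub D d d')"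
proof -
  have "M m - N m = M m + (-1) \<cdot>\<^sub>m N m" for m
    by (rule minus_mat_eq_add_smult) (use models_dim[OF M, of m] models_dim[OF N, of m] in auto)
  then show ?thesis
    using models_add[OF M models_scale[OF N, of "-1"]] by (simp add: csub_def)
qed

lemma models_generator: "i < length z \<Longrightarrow> models (\<lambda>m. C m ! i) (z ! i)"
proof -
  assume i: "i < length z"
  have "C m ! i * 1\<^sub>m (k m) = C m ! i" for m
    using C_tuples[of m] i by (intro right_mult_one_mat) (auto simp: tuples_def)
  then show ?thesis
    using models_rat_ncpoly[OF nc_mon_rat[of "[i]"]] i
    by (simp add: tz.ncpoly_eval_mon tC.ncpoly_eval_mon)
qed

lemma models_one: "models (\<lambda>m. 1\<^sub>m (k m)) (cone D)"
  using models_rat_ncpoly[OF nc_mon_rat[of "[]"]] by (simp add: tz.ncpoly_eval_mon tC.ncpoly_eval_mon)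

lemma models_zero: "models (\<lambda>m. 0\<^sub>m (k m) (k m)) (czero D)"
  using models_rat_ncpoly[OF nc_zero_rat] by (simp add: tz.ncpoly_eval_zero tC.ncpoly_eval_zero)

text \<open>\<open>generates\<close> supplies polynomials with arbitrary complex coefficients, while
  the microstates test rational ones. Adding up the monomials one by one bridges the gap.\<close>

lemma models_ncpoly:
  assumes P: "P \<in> ncpolys (length z)"
  shows "models (\<lambda>m. ev m P) (ncpoly_eval D z P)"
proof -
  have mon: "models (\<lambda>m. ncmon (matalg (k m)) (C m) w) (ncmon D z w)" if "set w \<subseteq> {..<length z}" for w
    using models_rat_ncpoly[OF nc_mon_rat[OF that]] that by (simp add: tz.ncpoly_eval_mon tC.ncpoly_eval_mon)
  have "models (\<lambda>m. word_sum (matalg (k m)) (C m) P ws) (word_sum D z P ws)"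
    if "set ws \<subseteq> set (nc_support P)" for ws
    using that
  proof (induction ws)
    case (Cons w ws)
    then show ?case using nc_support_words[OF P] by (auto intro!: models_add models_scale mon)
  qed (simp add: models_zero)
  then show ?thesis by (simp add: ncpoly_eval_word_sum)
qed

text \<open>A diagonal sequence: the index of the approximating polynomial grows with \<open>m\<close> as long as
  the evaluations at \<open>C m\<close> reflect the Cauchy estimates in \<open>D\<close>.\<close>

lemma models_exists: "\<exists>M. models M d"
proof -
  define \<rho> :: "nat \<Rightarrow> real" where "\<rho> j = 1 / 2 ^ j" for j
  have \<rho>: "\<rho> j > 0" "i \<le> j \<Longrightarrow> \<rho> j \<le> \<rho> i" for i j by (auto simp: \<rho>_def frac_le power_increasing)
  have "\<exists>P\<in>ncpolys (length z). cnorm D (csub D d (ncpoly_eval D z P)) < \<rho> j" for j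
    using z_generates \<rho>(1) unfolding generates_def by blast
  then obtain P where P: "\<And>j. P j \<in> ncpolys (length z)" "\<And>j. cnorm D (csub D d (ncpoly_eval D z (P j))) < \<rho> j"
    by metis
  \<comment> \<open>In \<open>D\<close> the approximants with indices i \<le> j differ by less than
    \<open>\<rho> i + \<rho> j\<close>, which is at most \<open>2 * \<rho> i\<close>. The slack up
    to \<open>3 * \<rho> i\<close> makes \<open>good m j\<close> true for all large
    \<open>m\<close>.\<close>
  define good where "good m j \<longleftrightarrow> (\<forall>i\<le>j. opnorm (ev m (P i) - ev m (P j)) \<le> 3 * \<rho> i)" for m j
  \<comment> \<open>The restriction to j \<le> m keeps the set finite, and j = 0 is always in
    it.\<close>
  define J where "J m = Max {j. j \<le> m \<and> good m j}" for m
  have "good m 0" for m using \<rho>(1)[of 0] by (simp add: good_def)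
  then have J: "good m (J m)" for m
    using Max_in[of "{j. j \<le> m \<and> good m j}"] by (auto simp: J_def)
  have evgood: "\<forall>\<^sub>F m in sequentially. good m j" for j
    unfolding good_def
  proof -
    have "\<forall>\<^sub>F m in sequentially. \<forall>i\<in>{..j}. opnorm (ev m (P i) - ev m (P j)) < 3 * \<rho> i"
    proof (intro eventually_ball_finite ballI)
      fix i assume "i \<in> {..j}"
      then have "i \<le> j" by simp
      have "cnorm D (csub D (ncpoly_eval D z (P i)) (ncpoly_eval D z (P j))) < 3 * \<rho> i"
        using csub_triangle[of "ncpoly_eval D z (P i)" "ncpoly_eval D z (P j)" d] P(2)[of i] P(2)[of j]
          \<rho>(2)[OF \<open>i \<le> j\<close>] \<rho>(1)[of i] cnorm_csub_commute[of d "ncpoly_eval D z (P i)"] by linarith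
      then show "\<forall>\<^sub>F m in sequentially. opnorm (ev m (P i) - ev m (P j)) < 3 * \<rho> i"
        by (rule order_tendstoD(2)[OF models_norm[OF models_minus[OF models_ncpoly[OF P(1)] models_ncpoly[OF P(1)]]]])
    qed simp
    then show "\<forall>\<^sub>F m in sequentially. \<forall>i\<le>j. opnorm (ev m (P i) - ev m (P j)) \<le> 3 * \<rho> i"
      by eventually_elim (auto intro: less_imp_le)
  qed
  have "models (\<lambda>m. ev m (P (J m))) d"
  proof (rule models_approx)
    show "ev m (P (J m)) \<in> carrier_mat (k m) (k m)" for m by (rule ev_carrier) (rule P)
    fix e :: real assume "e > 0"
    then obtain i where i: "3 * \<rho> i < e"
      using reals_power_lt_ex[of "e / 3" 2] unfolding \<rho>_def by (auto simp: field_simps power_one_over)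
    have "\<forall>\<^sub>F m in sequentially. opnorm (ev m (P (J m)) - ev m (P i)) < e"
      using evgood[of i] eventually_ge_at_top[of i]
    proof eventually_elim
      case (elim m)
      then have "i \<le> J m" unfolding J_def by (intro Max_ge) auto
      then have "opnorm (ev m (P i) - ev m (P (J m))) \<le> 3 * \<rho> i"
        using J[of m] by (auto simp: good_def)
      moreover have "opnorm (ev m (P i) - ev m (P (J m))) = opnorm (ev m (P (J m)) - ev m (P i))"
        by (rule opnorm_minus_commute) (simp_all add: carrier_matD[OF ev_carrier[OF P(1)]])
      ultimately show ?case using i by simp
    qed
    moreover have "cnorm D (csub D d (ncpoly_eval D z (P i))) < e"
      using P(2)[of i] \<rho>(1)[of i] i by linarith
    ultimately show "\<exists>N d'. models N d' \<and> cnorm D (csub D d d') < e \<and>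
        (\<forall>\<^sub>F m in sequentially. opnorm (ev m (P (J m)) - N m) < e)"
      using models_ncpoly[OF P(1)] by blast
  qed
  then show ?thesis by blast
qed

text \<open>Microstates are exactly self-adjoint, so an arbitrary model is replaced by its hermitian
  part, which models the same element.\<close>

lemma models_hermitian_exists:
  assumes "cstar D d = d"
  obtains M where "models M d" "\<And>m. madj (M m) = M m"
proof -
  obtain M where M: "models M d" using models_exists by blast
  define N where "N m = (1 / 2) \<cdot>\<^sub>m (M m + madj (M m))" for m
  have "models N (cscale D (1 / 2) (cadd D d (cstar D d)))"
    unfolding N_def by (intro models_scale models_add models_star M)
  also have "cscale D (1 / 2) (cadd D d (cstar D d)) = d"
    using cadd_scale[of "1 / 2" "1 / 2" d] by (simp add: assms cscale_add)
  finally have "models N d" .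
  moreover have "madj (N m) = N m" for m
    using models_dim[OF M, of m] by (auto simp: N_def madj_smult madj_add intro!: eq_matI)
  ultimately show ?thesis by (rule that)
qed

end

subsection \<open>Corners and direct sums\<close>

lemma opnorm_isometry_conj:
  assumes "N \<in> carrier_mat l l" "V \<in> carrier_mat k l" "madj V * V = 1\<^sub>m l"
  shows "opnorm (V * N * madj V) = opnorm N"
proof (rule antisym)
  have [simp]: "dim_row N = l" "dim_col N = l" "dim_row V = k" "dim_col V = l" using assms by auto
  have V: "opnorm V \<le> 1" "opnorm (madj V) \<le> 1"
    using opnorm_isometry[OF assms(3)] by (auto simp: opnorm_madj)
  have conj: "opnorm (X * M * Y) \<le> opnorm M"
    if "opnorm X \<le> 1" "opnorm Y \<le> 1" "dim_col X = dim_row M" "dim_col M = dim_row Y" for X M Y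
  proof -
    have "opnorm (X * M * Y) \<le> opnorm X * opnorm M * opnorm Y"
      using that by (intro order.trans[OF opnorm_mult] mult_right_mono opnorm_mult) auto
    also have "\<dots> \<le> 1 * opnorm M * 1" using that by (intro mult_mono) auto
    finally show ?thesis by simp
  qed
  show "opnorm (V * N * madj V) \<le> opnorm N" by (rule conj) (use V in auto)
  have "madj V * (V * N * madj V) * V = (madj V * V) * N * (madj V * V)"
    by (simp add: mat_dim_simps)
  also have "\<dots> = N" using assms by simp
  finally show "opnorm N \<le> opnorm (V * N * madj V)"
    using conj[of "madj V" V "V * N * madj V"] V by simp
qed

lemma Gamma_topI:
  assumes "X \<in> tuples (length x) k" "\<And>i. i < length x \<Longrightarrow> madj (X ! i) = X ! i"
    and "\<And>i. i < length x \<Longrightarrow> opnorm (X ! i) \<le> R"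
    and "\<And>j. j \<in> {1..r} \<Longrightarrow>
      \<bar>opnorm (ncpoly_eval (matalg k) X (P j)) - cnorm A (ncpoly_eval A x (P j))\<bar> \<le> \<epsilon>"
  shows "X \<in> Gamma_top A x R k \<epsilon> P r"
  using assms by (simp add: Gamma_top_def)

locale corner_embedding = A: cstar_algebra A + D: cstar_algebra D
  for A :: "'a calg" and D :: "'d calg" +
  fixes \<iota> :: "'a \<Rightarrow> 'd"
  assumes emb_zero: "\<iota> (czero A) = czero D"
    and emb_add: "\<iota> (cadd A a b) = cadd D (\<iota> a) (\<iota> b)"
    and emb_mul: "\<iota> (cmul A a b) = cmul D (\<iota> a) (\<iota> b)"
    and emb_scale: "\<iota> (cscale A s a) = cscale D s (\<iota> a)"
    and emb_star: "\<iota> (cstar A a) = cstar D (\<iota> a)"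
    and emb_norm: "cnorm D (\<iota> a) = cnorm A a"

locale microstate_corner =
  microstate_sequence D z k C + corner_embedding A D \<iota>
  for D :: "'d calg" and z k C and A :: "'a calg" and \<iota> +
  fixes l :: "nat \<Rightarrow> nat" and V :: "nat \<Rightarrow> complex mat"
  assumes V_carrier: "V m \<in> carrier_mat (k m) (l m)"
    and V_isometry: "madj (V m) * V m = 1\<^sub>m (l m)"
    and models_range: "models (\<lambda>m. V m * madj (V m)) (\<iota> (cone A))"
begin

lemma V_dim [simp]: "dim_row (V m) = k m" "dim_col (V m) = l m"
  using V_carrier[of m] by auto

text \<open>The unit of \<open>A\<close> has norm 1, hence so have the range projections in the
  limit, and they cannot vanish. Covering numbers of size 0 do not occur in the final sum.\<close>

lemma eventually_nonempty: "\<forall>\<^sub>F m in sequentially. 1 \<le> l m"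
proof -
  have "(\<lambda>m. opnorm (V m * madj (V m))) \<longlonglongrightarrow> 1"
    using models_norm[OF models_range] by (simp add: emb_norm A.cnorm_one)
  then have "\<forall>\<^sub>F m in sequentially. 0 < opnorm (V m * madj (V m))"
    by (rule order_tendstoD) simp
  then show ?thesis
  proof eventually_elim
    case (elim m)
    show ?case
    proof (rule ccontr)
      assume "\<not> 1 \<le> l m"
      then have "l m = 0" by simp
      then have "V m * madj (V m) = 0\<^sub>m (k m) (k m)"
        by (intro eq_matI) (simp_all add: index_mult_mat_sum)
      with elim show False by simp
    qed
  qed
qed

text \<open>\<open>X\<close> compresses hermitian models of the generators by \<open>V\<close>.
  Conjugating back by the isometry \<open>V\<close> is multiplicative and sends the identity to the
  range projection, which models \<open>\<iota> (cone A)\<close>; hence constant terms are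
  transported correctly as well.\<close>

lemma corner_tuple_exists:
  assumes x: "\<And>i. i < length x \<Longrightarrow> cstar A (x ! i) = x ! i"
  obtains X where "\<And>m. X m \<in> tuples (length x) (l m)"
    "\<And>m i. i < length x \<Longrightarrow> madj (X m ! i) = X m ! i"
    "\<And>P. P \<in> ncpolys (length x) \<Longrightarrow>
       models (\<lambda>m. V m * ncpoly_eval (matalg (l m)) (X m) P * madj (V m)) (\<iota> (ncpoly_eval A x P))"
proof -
  have "\<exists>M. models M (\<iota> (x ! i)) \<and> (\<forall>m. madj (M m) = M m)" if "i < length x" for i
    using models_hermitian_exists[of "\<iota> (x ! i)"] emb_star[of "x ! i"] x[OF that] by metis
  then obtain Y where Y: "\<And>i. i < length x \<Longrightarrow> models (Y i) (\<iota> (x ! i))"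
      "\<And>i m. i < length x \<Longrightarrow> madj (Y i m) = Y i m"
    by metis
  have Y_dim: "dim_row (Y i m) = k m" "dim_col (Y i m) = k m" if "i < length x" for i m
    using models_dim[OF Y(1)[OF that]] by auto
  define X where "X m = map (\<lambda>i. madj (V m) * Y i m * V m) [0..<length x]" for m
  have X_nth: "X m ! i = madj (V m) * Y i m * V m" if "i < length x" for m i
    using that by (simp add: X_def)
  have X_tuples: "X m \<in> tuples (length x) (l m)" for m
    by (auto simp: tuples_def X_def intro!: carrier_matI)
  interpret tX: star_algebra_tuple "matalg (l m)" "carrier_mat (l m) (l m)" "X m" "length x" for m
    by (rule matalg_star_algebra_tuple[OF X_tuples])
  have gen: "models (\<lambda>m. V m * X m ! i * madj (V m)) (\<iota> (x ! i))" if i: "i < length x" for i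
  proof -
    have "models (\<lambda>m. V m * madj (V m) * Y i m * (V m * madj (V m)))
        (cmul D (cmul D (\<iota> (cone A)) (\<iota> (x ! i))) (\<iota> (cone A)))"
      by (intro models_mult models_range Y i)
    then show ?thesis
      using i Y_dim[OF i] by (simp add: X_nth mat_dim_simps flip: emb_mul)
  qed
  have mon: "models (\<lambda>m. V m * ncmon (matalg (l m)) (X m) w * madj (V m)) (\<iota> (ncmon A x w))"
    if "set w \<subseteq> {..<length x}" for w
    using that
  proof (induction w)
    case Nil
    show ?case using models_range by simp
  next
    case (Cons i w)
    then have i: "i < length x" and w: "set w \<subseteq> {..<length x}" by auto
    have "V m * X m ! i * madj (V m) * (V m * ncmon (matalg (l m)) (X m) w * madj (V m))
        = V m * (X m ! i * ncmon (matalg (l m)) (X m) w) * madj (V m)" for m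
    proof -
      have d: "dim_row (ncmon (matalg (l m)) (X m) w) = l m" "dim_col (ncmon (matalg (l m)) (X m) w) = l m"
        "dim_row (X m ! i) = l m" "dim_col (X m ! i) = l m"
        using tX.ncmon_closed[OF w, of m] tX.x_closed[OF i, of m] by auto
      have "V m * X m ! i * madj (V m) * (V m * ncmon (matalg (l m)) (X m) w * madj (V m))
          = V m * (X m ! i * ((madj (V m) * V m) * (ncmon (matalg (l m)) (X m) w * madj (V m))))"
        using d by (simp add: mat_dim_simps)
      also have "\<dots> = V m * (X m ! i * ncmon (matalg (l m)) (X m) w) * madj (V m)"
        unfolding V_isometry using d by (simp add: mat_dim_simps)
      finally show ?thesis .
    qed
    then show ?case
      using models_mult[OF gen[OF i] Cons.IH[OF w]] by (simp add: emb_mul)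
  qed
  have "models (\<lambda>m. V m * ncpoly_eval (matalg (l m)) (X m) P * madj (V m)) (\<iota> (ncpoly_eval A x P))"
    if P: "P \<in> ncpolys (length x)" for P
  proof -
    have "models (\<lambda>m. V m * word_sum (matalg (l m)) (X m) P ws * madj (V m)) (\<iota> (word_sum A x P ws))"
      if "\<And>w. w \<in> set ws \<Longrightarrow> set w \<subseteq> {..<length x}" for ws
      using that
    proof (induction ws)
      case Nil
      then show ?case using models_zero by (simp add: emb_zero)
    next
      case (Cons w ws)
      have w: "set w \<subseteq> {..<length x}" and ws: "\<And>w. w \<in> set ws \<Longrightarrow> set w \<subseteq> {..<length x}"
        using Cons.prems by auto
      have "V m * word_sum (matalg (l m)) (X m) P (w # ws) * madj (V m)
          = P w \<cdot>\<^sub>m (V m * ncmon (matalg (l m)) (X m) w * madj (V m))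
            + V m * word_sum (matalg (l m)) (X m) P ws * madj (V m)" for m
        using carrier_matD[OF tX.ncmon_closed[OF w, of m]] carrier_matD[OF tX.word_sum_closed[OF ws, of ws m P]]
        by (simp add: mat_dim_simps)
      then show ?case
        using models_add[OF models_scale[OF mon[OF w], of "P w"] Cons.IH[OF ws]]
        by (simp add: emb_add emb_scale)
    qed
    from this[of "nc_support P"] nc_support_words[OF P] show ?thesis
      by (simp add: ncpoly_eval_word_sum)
  qed
  moreover have "madj (X m ! i) = X m ! i" if "i < length x" for m i
    using that Y(2)[OF that] Y_dim[OF that] by (simp add: X_nth madj_mult mat_dim_simps)
  ultimately show ?thesis using X_tuples that by blast
qed

text \<open>Conjugation by an isometry preserves norms, so all polynomial norms at
  \<open>X m\<close> converge to those in \<open>A\<close>. The strict inequality in the bound by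
  \<open>R\<close> leaves room for the approximation.\<close>

lemma eventually_microstate:
  assumes X: "\<And>m. X m \<in> tuples (length x) (l m)"
      "\<And>m i. i < length x \<Longrightarrow> madj (X m ! i) = X m ! i"
      "\<And>P. P \<in> ncpolys (length x) \<Longrightarrow>
        models (\<lambda>m. V m * ncpoly_eval (matalg (l m)) (X m) P * madj (V m)) (\<iota> (ncpoly_eval A x P))"
    and R: "\<And>i. i < length x \<Longrightarrow> cnorm A (x ! i) < R"
    and \<epsilon>: "\<epsilon> > 0" and Px: "\<And>j. j \<ge> 1 \<Longrightarrow> Px j \<in> ncpolys (length x)"
  shows "\<forall>\<^sub>F m in sequentially. X m \<in> Gamma_top A x R (l m) \<epsilon> Px r"
proof -
  interpret tX: star_algebra_tuple "matalg (l m)" "carrier_mat (l m) (l m)" "X m" "length x" for m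
    by (rule matalg_star_algebra_tuple[OF X(1)])
  interpret tx: star_algebra_tuple A UNIV x "length x"
    by (rule A.star_algebra_tuple)
  have lim: "(\<lambda>m. opnorm (ncpoly_eval (matalg (l m)) (X m) P)) \<longlonglongrightarrow> cnorm A (ncpoly_eval A x P)"
    if "P \<in> ncpolys (length x)" for P
    using models_norm[OF X(3)[OF that]]
    by (simp add: emb_norm opnorm_isometry_conj[OF tX.ncpoly_eval_closed[OF that] V_carrier V_isometry])
  have "\<forall>\<^sub>F m in sequentially. \<forall>i\<in>{..<length x}. opnorm (X m ! i) < R"
  proof (intro eventually_ball_finite ballI)
    fix i assume "i \<in> {..<length x}"
    then have i: "i < length x" by simp
    have "X m ! i * 1\<^sub>m (l m) = X m ! i" for m
      using tX.x_closed[OF i] by (rule right_mult_one_mat)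
    then have "(\<lambda>m. opnorm (X m ! i)) \<longlonglongrightarrow> cnorm A (x ! i)"
      using lim[OF nc_mon_ncpolys[of "[i]"]] i by (simp add: tX.ncpoly_eval_mon tx.ncpoly_eval_mon)
    then show "\<forall>\<^sub>F m in sequentially. opnorm (X m ! i) < R"
      by (rule order_tendstoD) (rule R[OF i])
  qed simp
  moreover have "\<forall>\<^sub>F m in sequentially. \<forall>j\<in>{1..r}.
      dist (opnorm (ncpoly_eval (matalg (l m)) (X m) (Px j))) (cnorm A (ncpoly_eval A x (Px j))) < \<epsilon>"
    by (intro eventually_ball_finite ballI tendstoD[OF lim] Px \<epsilon>) auto
  ultimately show ?thesis
  proof eventually_elim
    case (elim m)
    then show ?case
      by (intro Gamma_topI X) (auto simp: dist_real_def intro: less_imp_le)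
  qed
qed

end

section \<open>The direct sum and its two corners\<close>

lemma cdirect_sum_simps [simp]:
  "cadd (cdirect_sum A B) u v = (cadd A (fst u) (fst v), cadd B (snd u) (snd v))"
  "cmul (cdirect_sum A B) u v = (cmul A (fst u) (fst v), cmul B (snd u) (snd v))"
  "cscale (cdirect_sum A B) s u = (cscale A s (fst u), cscale B s (snd u))"
  "cstar (cdirect_sum A B) u = (cstar A (fst u), cstar B (snd u))"
  "cnorm (cdirect_sum A B) u = max (cnorm A (fst u)) (cnorm B (snd u))"
  "czero (cdirect_sum A B) = (czero A, czero B)"
  "cone (cdirect_sum A B) = (cone A, cone B)"
  "csub (cdirect_sum A B) u v = (csub A (fst u) (fst v), csub B (snd u) (snd v))"
  by (simp_all add: cdirect_sum_def csub_def)

lemma cdirect_sum_cstar_algebra: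
  fixes A :: "'a calg" and B :: "'b calg"
  assumes "cstar_algebra A" "cstar_algebra B"
  shows "cstar_algebra (cdirect_sum A B)"
proof -
  interpret A: cstar_algebra A by fact
  interpret B: cstar_algebra B by fact
  have complete: "\<exists>l. \<forall>e>0. \<exists>N. \<forall>n\<ge>N. cnorm (cdirect_sum A B) (csub (cdirect_sum A B) (f n) l) < e"
    if f: "\<forall>e>0. \<exists>N. \<forall>m\<ge>N. \<forall>n\<ge>N. cnorm (cdirect_sum A B) (csub (cdirect_sum A B) (f m) (f n)) < e" for f :: "nat \<Rightarrow> 'a \<times> 'b"
  proof -
    obtain a where a: "\<And>e. e > 0 \<Longrightarrow> \<exists>N. \<forall>n\<ge>N. cnorm A (csub A (fst (f n)) a) < e"
      using A.cauchy_convergent[of "\<lambda>n. fst (f n)"] f by (metis cdirect_sum_simps(5,8) fst_conv max_less_iff_conj)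
    obtain b where b: "\<And>e. e > 0 \<Longrightarrow> \<exists>N. \<forall>n\<ge>N. cnorm B (csub B (snd (f n)) b) < e"
      using B.cauchy_convergent[of "\<lambda>n. snd (f n)"] f by (metis cdirect_sum_simps(5,8) snd_conv max_less_iff_conj)
    show ?thesis
    proof (intro exI[of _ "(a, b)"] allI impI)
      fix e :: real assume "e > 0"
      with a[of e] b[of e] obtain N1 N2 where "\<forall>n\<ge>N1. cnorm A (csub A (fst (f n)) a) < e"
          "\<forall>n\<ge>N2. cnorm B (csub B (snd (f n)) b) < e" by blast
      then show "\<exists>N. \<forall>n\<ge>N. cnorm (cdirect_sum A B) (csub (cdirect_sum A B) (f n) (a, b)) < e"
        by (intro exI[of _ "max N1 N2"]) auto
    qed
  qed
  have max_sq: "(max s t)\<^sup>2 = max (s\<^sup>2) (t\<^sup>2)" if "0 \<le> s" "0 \<le> t" for s t :: real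
    using that by (auto simp: max_def power_mono intro: antisym)
  have max_mult: "max (s * s') (t * t') \<le> max s t * max s' t'" if "0 \<le> s" "0 \<le> t" "0 \<le> s'" "0 \<le> t'" for s t s' t' :: real
    using that by (intro max.boundedI mult_mono) auto
  have max_zero: "max s t = 0 \<longleftrightarrow> s = 0 \<and> t = 0" if "0 \<le> s" "0 \<le> t" for s t :: real
    using that by auto
  show ?thesis
    unfolding cstar_algebra_def unital_cstar_algebra_def
  proof (intro conjI allI)
    fix f :: "nat \<Rightarrow> 'a \<times> 'b"
    show "(\<forall>e>0. \<exists>N. \<forall>m\<ge>N. \<forall>n\<ge>N. cnorm (cdirect_sum A B) (csub (cdirect_sum A B) (f m) (f n)) < e) \<longrightarrow>
        (\<exists>l. \<forall>e>0. \<exists>N. \<forall>n\<ge>N. cnorm (cdirect_sum A B) (csub (cdirect_sum A B) (f n) l) < e)"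
      using complete by blast
  next
    fix a b :: "'a \<times> 'b"
    show "cadd (cdirect_sum A B) a b = cadd (cdirect_sum A B) b a"
      by (simp add: A.cadd_commute[of "fst a"] B.cadd_commute[of "snd a"])
    show "cnorm (cdirect_sum A B) (cmul (cdirect_sum A B) a b) \<le> cnorm (cdirect_sum A B) a * cnorm (cdirect_sum A B) b"
      using order.trans[OF max.mono[OF A.cnorm_mul[of "fst a" "fst b"] B.cnorm_mul[of "snd a" "snd b"]] max_mult] by simp
    show "cnorm (cdirect_sum A B) (cadd (cdirect_sum A B) a b) \<le> cnorm (cdirect_sum A B) a + cnorm (cdirect_sum A B) b"
      by simp (intro conjI order.trans[OF A.cnorm_add] order.trans[OF B.cnorm_add] add_mono; simp)
    show "(cnorm (cdirect_sum A B) a = 0) = (a = czero (cdirect_sum A B))"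
      using max_zero[OF A.cnorm_nonneg[of "fst a"] B.cnorm_nonneg[of "snd a"]]
      by (simp add: A.cnorm_eq_0 B.cnorm_eq_0 prod_eq_iff)
  qed (simp_all add: A.cadd_assoc B.cadd_assoc A.cadd_neg B.cadd_neg A.cscale_cscale B.cscale_cscale
      A.cscale_add B.cscale_add A.cadd_scale B.cadd_scale A.cmul_assoc B.cmul_assoc A.cmul_add B.cmul_add
      A.cadd_mul B.cadd_mul A.cscale_mul B.cscale_mul A.cmul_scale B.cmul_scale A.cone_neq_zero
      A.cstar_add B.cstar_add A.cstar_scale B.cstar_scale A.cstar_mul B.cstar_mul
      A.cnorm_scale B.cnorm_scale A.cnorm_star_mul B.cnorm_star_mul max_sq max_mult_distrib_left le_max_iff_disj)
qed

lemma corner_embedding_left: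
  assumes "cstar_algebra A" "cstar_algebra B"
  shows "corner_embedding A (cdirect_sum A B) (\<lambda>a. (a, czero B))"
proof -
  interpret A: cstar_algebra A by fact
  interpret B: cstar_algebra B by fact
  show ?thesis
    by (intro corner_embedding.intro corner_embedding_axioms.intro cdirect_sum_cstar_algebra assms)
      (simp_all add: max_absorb1)
qed

lemma corner_embedding_right:
  assumes "cstar_algebra A" "cstar_algebra B"
  shows "corner_embedding B (cdirect_sum A B) (\<lambda>b. (czero A, b))"
proof -
  interpret A: cstar_algebra A by fact
  interpret B: cstar_algebra B by fact
  show ?thesis
    by (intro corner_embedding.intro corner_embedding_axioms.intro cdirect_sum_cstar_algebra assms)
      (simp_all add: max_absorb2)
qed

text \<open>\<open>G\<close> and \<open>H\<close> are arbitrary families indexed by the matrix size,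
  which keeps the covering estimate \<open>o2_decomposes\<close> free of C*-algebras. The sizes add
  up to \<open>k\<close> by \<open>isometry_pair_dim\<close>.\<close>

definition decomposes ::
  "(nat \<Rightarrow> complex mat list set) \<Rightarrow> (nat \<Rightarrow> complex mat list set) \<Rightarrow> (nat \<Rightarrow> nat list \<Rightarrow> complex) \<Rightarrow>
    (nat \<Rightarrow> nat list \<Rightarrow> complex) \<Rightarrow> real \<Rightarrow> nat \<Rightarrow> complex mat list \<Rightarrow> bool" where
  "decomposes G H g h \<kappa> k C \<longleftrightarrow> (\<exists>k1 k2 V1 V2 X Y. isometry_pair k k1 k2 V1 V2 \<and> 1 \<le> k1 \<and> 1 \<le> k2 \<and>
     X \<in> G k1 \<and> Y \<in> H k2 \<and> (\<forall>l<length C. opnorm (C ! l -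
       (V1 * ncpoly_eval (matalg k1) X (g l) * madj V1 + V2 * ncpoly_eval (matalg k2) Y (h l) * madj V2)) < \<kappa>))"

text \<open>A default splitting for those indices at which the approximate projection is still too
  far from being one.\<close>

lemma isometry_pair_trivial: "isometry_pair k k 0 (1\<^sub>m k) (0\<^sub>m k 0)"
  by (auto simp: isometry_pair_def index_mult_mat_sum intro!: eq_matI)

text \<open>A hermitian model of the projection \<open>d\<close> has defects tending to 0. Passing
  to exact projections nearby changes it by a null sequence, so these still model \<open>d\<close>,
  and their complements model the complement of \<open>d\<close>.\<close>

lemma (in microstate_sequence) isometry_pairs_exist:
  assumes "cstar D d = d" "cmul D d d = d"
  shows "\<exists>l l' V V'. (\<forall>m. isometry_pair (k m) (l m) (l' m) (V m) (V' m)) \<and>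
    models (\<lambda>m. V m * madj (V m)) d \<and> models (\<lambda>m. V' m * madj (V' m)) (csub D (cone D) d)"
proof -
  obtain T where T: "models T d" "\<And>m. madj (T m) = T m"
    using models_hermitian_exists[OF assms(1)] by metis
  define \<delta> where "\<delta> m = opnorm (T m * T m - T m)" for m
  have \<delta>: "\<delta> \<longlonglongrightarrow> 0"
    using models_norm[OF models_minus[OF models_mult[OF T(1) T(1)] T(1)]] assms(2) unfolding \<delta>_def by simp
  have "\<exists>l l' V V'. isometry_pair (k m) l l' V V' \<and> (\<delta> m \<le> 1 / 16 \<longrightarrow> opnorm (V * madj V - T m) \<le> 4 * \<delta> m)" for m
  proof (cases "\<delta> m \<le> 1 / 16")
    case True
    show ?thesis
      by (rule almost_projection_isometry_pair[OF models_carrier[OF T(1)] T(2) order_refl, of m])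
        (use True in \<open>auto simp: \<delta>_def\<close>)
  qed (use isometry_pair_trivial in blast)
  then obtain l l' V V' where V: "\<And>m. isometry_pair (k m) (l m) (l' m) (V m) (V' m)"
      "\<And>m. \<delta> m \<le> 1 / 16 \<Longrightarrow> opnorm (V m * madj (V m) - T m) \<le> 4 * \<delta> m"
    by metis
  have dims [simp]: "dim_row (V m) = k m" "dim_row (V' m) = k m" "dim_col (V m) = l m" "dim_col (V' m) = l' m" for m
    using V(1)[of m] by (auto simp: isometry_pair_def)
  have "\<forall>\<^sub>F m in sequentially. \<delta> m < 1 / 16"
    by (rule order_tendstoD[OF \<delta>]) simp
  then have "\<forall>\<^sub>F m in sequentially. norm (opnorm (V m * madj (V m) - T m)) \<le> 4 * \<delta> m"
    by eventually_elim (use V(2) in simp)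
  then have "(\<lambda>m. opnorm (V m * madj (V m) - T m)) \<longlonglongrightarrow> 0"
    by (rule Lim_null_comparison) (use tendsto_mult_left[OF \<delta>, of 4] in simp)
  then have M: "models (\<lambda>m. V m * madj (V m)) d"
    by (intro models_cong[OF T(1)] carrier_matI) auto
  moreover have "V' m * madj (V' m) = 1\<^sub>m (k m) - V m * madj (V m)" for m
  proof -
    have "1\<^sub>m (k m) - V m * madj (V m) = V m * madj (V m) + V' m * madj (V' m) - V m * madj (V m)"
      using V(1)[of m] by (simp add: isometry_pair_def)
    also have "\<dots> = V' m * madj (V' m)"
      by (rule eq_matI) simp_all
    finally show ?thesis by simp
  qed
  ultimately show ?thesis
    using models_minus[OF models_one M] V(1)
    by (intro exI[of _ l] exI[of _ l'] exI[of _ V] exI[of _ V']) simp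
qed

text \<open>\<open>R1\<close> and \<open>R2\<close> are fixed and strictly above the norms of the
  generators, so that compressed tuples respect them eventually. The cut-off for \<open>z\<close>
  stays free.\<close>

locale direct_sum_generators = A: cstar_algebra A + B: cstar_algebra B
  for A :: "'a calg" and B :: "'b calg" +
  fixes x :: "'a list" and y :: "'b list" and z :: "('a \<times> 'b) list"
    and Px Py Pz :: "nat \<Rightarrow> nat list \<Rightarrow> complex" and R1 R2 :: real
  assumes x: "i < length x \<Longrightarrow> cstar A (x ! i) = x ! i" "i < length x \<Longrightarrow> cnorm A (x ! i) < R1"
      "generates A x" "1 \<le> j \<Longrightarrow> Px j \<in> ncpolys (length x)" "0 < R1"
    and y: "i < length y \<Longrightarrow> cstar B (y ! i) = y ! i" "i < length y \<Longrightarrow> cnorm B (y ! i) < R2"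
      "generates B y" "1 \<le> j \<Longrightarrow> Py j \<in> ncpolys (length y)" "0 < R2"
    and z: "i < length z \<Longrightarrow> cstar (cdirect_sum A B) (z ! i) = z ! i"
      "generates (cdirect_sum A B) z" "enumerates (length z) Pz"
begin

abbreviation D :: "('a \<times> 'b) calg" where
  "D \<equiv> cdirect_sum A B"

abbreviation Gx :: "real \<Rightarrow> nat \<Rightarrow> nat \<Rightarrow> complex mat list set" where
  "Gx \<epsilon> r k \<equiv> Gamma_top A x R1 k \<epsilon> Px r"

abbreviation Gy :: "real \<Rightarrow> nat \<Rightarrow> nat \<Rightarrow> complex mat list set" where
  "Gy \<epsilon> r k \<equiv> Gamma_top B y R2 k \<epsilon> Py r"

abbreviation Gz :: "real \<Rightarrow> real \<Rightarrow> nat \<Rightarrow> nat \<Rightarrow> complex mat list set" where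
  "Gz R \<epsilon> r k \<equiv> Gamma_top D z R k \<epsilon> Pz r"

lemma eventually_decomposes:
  assumes seq: "microstate_sequence D z k C" and eps: "\<epsilon>1 > 0" "\<epsilon>2 > 0"
    and g: "\<And>l. g l \<in> ncpolys (length x)"
      "\<And>l. cnorm A (csub A (fst (z ! l)) (ncpoly_eval A x (g l))) < \<kappa>"
    and h: "\<And>l. h l \<in> ncpolys (length y)"
      "\<And>l. cnorm B (csub B (snd (z ! l)) (ncpoly_eval B y (h l))) < \<kappa>"
  shows "\<forall>\<^sub>F m in sequentially. decomposes (Gx \<epsilon>1 r1) (Gy \<epsilon>2 r2) g h \<kappa> (k m) (C m)"
proof -
  note A = A.cstar_algebra_axioms and B = B.cstar_algebra_axioms
  interpret microstate_sequence D z k C by fact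
  have p: "cstar (D) (cone A, czero B) = (cone A, czero B)"
      "cmul (D) (cone A, czero B) (cone A, czero B) = (cone A, czero B)"
    by simp_all
  obtain l l' V V' where V: "\<And>m. isometry_pair (k m) (l m) (l' m) (V m) (V' m)"
    and MV: "models (\<lambda>m. V m * madj (V m)) (cone A, czero B)"
    and MV': "models (\<lambda>m. V' m * madj (V' m)) (csub (D) (cone (D)) (cone A, czero B))"
    using isometry_pairs_exist[OF p] by blast
  interpret cA: microstate_corner D z k C A "\<lambda>a. (a, czero B)" l V
    by (intro microstate_corner.intro seq corner_embedding_left A B microstate_corner_axioms.intro MV)
      (use V in \<open>auto simp: isometry_pair_def\<close>)
  \<comment> \<open>The complementary projection simplifies to \<open>(czero A, cone B)\<close>, the
    image of the unit of \<open>B\<close>.\<close>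
  interpret cB: microstate_corner D z k C B "\<lambda>b. (czero A, b)" l' V'
    by (intro microstate_corner.intro seq corner_embedding_right A B microstate_corner_axioms.intro)
      (use V MV' in \<open>auto simp: isometry_pair_def\<close>)
  obtain X where X: "\<And>m. X m \<in> tuples (length x) (l m)"
    "\<And>m i. i < length x \<Longrightarrow> madj (X m ! i) = X m ! i"
    "\<And>P. P \<in> ncpolys (length x) \<Longrightarrow>
       models (\<lambda>m. V m * ncpoly_eval (matalg (l m)) (X m) P * madj (V m)) (ncpoly_eval A x P, czero B)"
    using cA.corner_tuple_exists[OF x(1)] by blast
  obtain Y where Y: "\<And>m. Y m \<in> tuples (length y) (l' m)"
    "\<And>m i. i < length y \<Longrightarrow> madj (Y m ! i) = Y m ! i"
    "\<And>P. P \<in> ncpolys (length y) \<Longrightarrow>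
       models (\<lambda>m. V' m * ncpoly_eval (matalg (l' m)) (Y m) P * madj (V' m)) (czero A, ncpoly_eval B y P)"
    using cB.corner_tuple_exists[OF y(1)] by blast
  have "\<forall>\<^sub>F m in sequentially. X m \<in> Gx \<epsilon>1 r1 (l m)"
    by (rule cA.eventually_microstate[OF X x(2) eps(1) x(4)])
  moreover have "\<forall>\<^sub>F m in sequentially. Y m \<in> Gy \<epsilon>2 r2 (l' m)"
    by (rule cB.eventually_microstate[OF Y y(2) eps(2) y(4)])
  moreover have "\<forall>\<^sub>F m in sequentially. \<forall>i\<in>{..<length z}. opnorm (C m ! i -
      (V m * ncpoly_eval (matalg (l m)) (X m) (g i) * madj (V m) +
       V' m * ncpoly_eval (matalg (l' m)) (Y m) (h i) * madj (V' m))) < \<kappa>"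
  proof (intro eventually_ball_finite ballI)
    fix i assume "i \<in> {..<length z}"
    then have i: "i < length z" by simp
    \<comment> \<open>The difference models \<open>z ! i\<close> minus the pair of values of
      \<open>g i\<close> and \<open>h i\<close>. Its norm in \<open>D\<close> is the larger of the
      two approximation errors, hence below \<open>\<kappa>\<close>.\<close>
    show "\<forall>\<^sub>F m in sequentially. opnorm (C m ! i -
      (V m * ncpoly_eval (matalg (l m)) (X m) (g i) * madj (V m) +
       V' m * ncpoly_eval (matalg (l' m)) (Y m) (h i) * madj (V' m))) < \<kappa>"
      by (rule order_tendstoD(2)[OF models_norm[OF models_minus[OF models_generator[OF i]
              models_add[OF X(3)[OF g(1)] Y(3)[OF h(1)]]]]])
        (use i g h A.cadd_commute[of _ "czero A"] B.cadd_commute[of _ "czero B"] in simp)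
  qed simp
  ultimately show ?thesis
    using cA.eventually_nonempty cB.eventually_nonempty
  proof eventually_elim
    case (elim m)
    moreover have "length (C m) = length z" using C_tuples[of m] by (simp add: tuples_def)
    ultimately show ?case
      unfolding decomposes_def
      by (intro exI[of _ "l m"] exI[of _ "l' m"] exI[of _ "V m"] exI[of _ "V' m"] exI[of _ "X m"] exI[of _ "Y m"])
        (simp add: V)
  qed
qed

text \<open>The sizes of the counterexamples are not assumed to tend to infinity, so the splitting
  is obtained for every \<open>k\<close> at once.\<close>

lemma Gz_decomposes:
  assumes eps: "\<epsilon>1 > 0" "\<epsilon>2 > 0"
    and g: "\<And>l. g l \<in> ncpolys (length x)"
      "\<And>l. cnorm A (csub A (fst (z ! l)) (ncpoly_eval A x (g l))) < \<kappa>"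
    and h: "\<And>l. h l \<in> ncpolys (length y)"
      "\<And>l. cnorm B (csub B (snd (z ! l)) (ncpoly_eval B y (h l))) < \<kappa>"
  shows "\<exists>\<epsilon>>0. \<exists>r\<ge>1. \<forall>k. \<forall>C\<in>Gz R \<epsilon> r k. decomposes (Gx \<epsilon>1 r1) (Gy \<epsilon>2 r2) g h \<kappa> k C"
proof (rule ccontr)
  let ?dec = "decomposes (Gx \<epsilon>1 r1) (Gy \<epsilon>2 r2) g h \<kappa>"
  assume no: "\<not> (\<exists>\<epsilon>>0. \<exists>r\<ge>1. \<forall>k. \<forall>C\<in>Gz R \<epsilon> r k. ?dec k C)"
  have "\<exists>k C. C \<in> Gz R (1 / real (Suc m)) (Suc m) k \<and> \<not> ?dec k C" for m
  proof (rule ccontr)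
    assume "\<not> ?thesis"
    then have "\<forall>k. \<forall>C\<in>Gz R (1 / real (Suc m)) (Suc m) k. ?dec k C" by blast
    moreover have "1 / real (Suc m) > 0" "Suc m \<ge> 1" by simp_all
    ultimately show False using no by blast
  qed
  then obtain k C where C: "\<And>m. C m \<in> Gz R (1 / real (Suc m)) (Suc m) (k m)"
      and bad: "\<And>m. \<not> ?dec (k m) (C m)"
    by metis
  have "microstate_sequence D z k C"
  proof (intro microstate_sequence.intro microstate_sequence_axioms.intro cdirect_sum_cstar_algebra
      A.cstar_algebra_axioms B.cstar_algebra_axioms z(1,2))
    show "C m \<in> tuples (length z) (k m)" for m using C[of m] by (simp add: Gamma_top_def)
    show "madj (C m ! i) = C m ! i" if "i < length z" for m i using C[of m] that by (simp add: Gamma_top_def)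
    fix P assume "P \<in> rat_ncpolys (length z)"
    \<comment> \<open>The tests at stage \<open>m\<close> comprise the first \<open>Suc m\<close>
      polynomials, so \<open>P\<close> is tested with tolerance 1/(m+1) as soon as m \<ge>
      j.\<close>
    then obtain j where j: "j \<ge> 1" "P = Pz j"
      using z(3) unfolding enumerates_def bij_betw_def by auto
    show "(\<lambda>m. opnorm (ncpoly_eval (matalg (k m)) (C m) P)) \<longlonglongrightarrow> cnorm D (ncpoly_eval D z P)"
    proof (rule Lim_transform2[OF tendsto_const])
      have "\<forall>\<^sub>F m in sequentially. norm (cnorm D (ncpoly_eval D z P) -
          opnorm (ncpoly_eval (matalg (k m)) (C m) P)) \<le> 1 / real (Suc m)"
        using eventually_ge_at_top[of j]
      proof eventually_elim
        case (elim m)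
        then show ?case using C[of m] j by (auto simp: Gamma_top_def abs_minus_commute)
      qed
      then show "(\<lambda>m. cnorm D (ncpoly_eval D z P) - opnorm (ncpoly_eval (matalg (k m)) (C m) P)) \<longlonglongrightarrow> 0"
        by (rule Lim_null_comparison) (rule LIMSEQ_Suc[OF lim_1_over_n])
    qed
  qed
  then have "\<forall>\<^sub>F m in sequentially. ?dec (k m) (C m)"
    by (rule eventually_decomposes[OF _ eps g h])
  with bad show False by simp
qed

end

subsection \<open>Doubling of microstates\<close>

text \<open>Serves unitary conjugation and doubling, both of which preserve the unit, in contrast to
  the corner maps above.\<close>

lemma ncpoly_eval_hom:
  assumes X: "X \<in> tuples n k" and P: "P \<in> ncpolys n"
    and \<phi>: "\<phi> (0\<^sub>m k k) = 0\<^sub>m k' k'" "\<phi> (1\<^sub>m k) = 1\<^sub>m k'"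
      "\<And>M N. M \<in> carrier_mat k k \<Longrightarrow> N \<in> carrier_mat k k \<Longrightarrow> \<phi> (M + N) = \<phi> M + \<phi> N"
      "\<And>M N. M \<in> carrier_mat k k \<Longrightarrow> N \<in> carrier_mat k k \<Longrightarrow> \<phi> (M * N) = \<phi> M * \<phi> N"
      "\<And>M c. M \<in> carrier_mat k k \<Longrightarrow> \<phi> (c \<cdot>\<^sub>m M) = c \<cdot>\<^sub>m \<phi> M"
  shows "ncpoly_eval (matalg k') (map \<phi> X) P = \<phi> (ncpoly_eval (matalg k) X P)"
proof -
  interpret star_algebra_tuple "matalg k" "carrier_mat k k" X n
    by (rule matalg_star_algebra_tuple[OF X])
  have len: "length X = n" using X by (simp add: tuples_def)
  have mon: "ncmon (matalg k') (map \<phi> X) w = \<phi> (ncmon (matalg k) X w)" if "set w \<subseteq> {..<n}" for w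
    using that by (induction w) (auto simp: \<phi> len x_closed ncmon_closed)
  have "word_sum (matalg k') (map \<phi> X) P ws = \<phi> (word_sum (matalg k) X P ws)"
    if "\<And>w. w \<in> set ws \<Longrightarrow> set w \<subseteq> {..<n}" for ws
    using that
  proof (induction ws)
    case (Cons w ws)
    then have "set w \<subseteq> {..<n}" "word_sum (matalg k) X P ws \<in> carrier_mat k k"
      by (auto intro: word_sum_closed)
    with Cons show ?case by (simp add: \<phi> mon ncmon_closed)
  qed (simp add: \<phi>)
  from this[of "nc_support P"] nc_support_words[OF P] show ?thesis
    by (simp add: ncpoly_eval_word_sum)
qed

lemma ncpoly_eval_unitary_conj:
  assumes X: "X \<in> tuples n k" and P: "P \<in> ncpolys n" and U: "unitary_mat k U"
  shows "ncpoly_eval (matalg k) (map (\<lambda>B. U * B * madj U) X) P = U * ncpoly_eval (matalg k) X P * madj U"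
proof (rule ncpoly_eval_hom[OF X P])
  have [simp]: "dim_row U = k" "dim_col U = k" and UU: "madj U * U = 1\<^sub>m k" "U * madj U = 1\<^sub>m k"
    using U by (auto simp: unitary_mat_def)
  show "U * 0\<^sub>m k k * madj U = 0\<^sub>m k k" "U * 1\<^sub>m k * madj U = 1\<^sub>m k"
    by (simp_all add: UU)
  fix M N :: "complex mat" and c assume M: "M \<in> carrier_mat k k" 
  then show "U * (c \<cdot>\<^sub>m M) * madj U = c \<cdot>\<^sub>m (U * M * madj U)"
    by (simp add: mat_dim_simps)
  assume N: "N \<in> carrier_mat k k"
  show "U * (M + N) * madj U = U * M * madj U + U * N * madj U"
    using M N by (simp add: mat_dim_simps)
  have "U * M * madj U * (U * N * madj U) = U * M * ((madj U * U) * (N * madj U))"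
    using M N by (simp add: mat_dim_simps)
  also have "\<dots> = U * (M * N) * madj U"
    unfolding UU using M N by (simp add: mat_dim_simps)
  finally show "U * (M * N) * madj U = U * M * madj U * (U * N * madj U)" by simp
qed

text \<open>Pythagoras: the cross terms contain \<open>madj V1 * V2\<close> or
  \<open>madj V2 * V1\<close>, which vanish.\<close>

lemma frob_isometry_pair_sum:
  assumes V: "isometry_pair k k1 k2 V1 V2" and "dim_row A = k1" "dim_row B = k2" "dim_col A = dim_col B"
  shows "(frob (V1 * A + V2 * B))\<^sup>2 = (frob A)\<^sup>2 + (frob B)\<^sup>2"
proof -
  note o = isometry_pair_orthogonal[OF V]
  have V': "madj V1 * V1 = 1\<^sub>m k1" "madj V2 * V2 = 1\<^sub>m k2"
    and [simp]: "dim_row V1 = k" "dim_col V1 = k1" "dim_row V2 = k" "dim_col V2 = k2"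
    using V by (auto simp: isometry_pair_def)
  have "madj (V1 * A + V2 * B) * (V1 * A + V2 * B)
      = madj A * (madj V1 * V1) * A + madj A * (madj V1 * V2) * B
        + (madj B * (madj V2 * V1) * A + madj B * (madj V2 * V2) * B)"
    using assms by (simp add: madj_add madj_mult mat_dim_simps) (rule eq_matI; simp)
  also have "\<dots> = madj A * A + madj B * B"
    unfolding o V' using assms by (intro eq_matI) simp_all
  finally have eq: "madj (V1 * A + V2 * B) * (V1 * A + V2 * B) = madj A * A + madj B * B" .
  have "mtrace (madj (V1 * A + V2 * B) * (V1 * A + V2 * B)) = mtrace (madj A * A) + mtrace (madj B * B)"
    unfolding eq by (rule mtrace_add[of _ "dim_col B"]; rule carrier_matI; use assms in simp)
  then have "complex_of_real ((frob (V1 * A + V2 * B))\<^sup>2) = complex_of_real ((frob A)\<^sup>2 + (frob B)\<^sup>2)"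
    unfolding mtrace_madj_mult_self by simp
  then show ?thesis unfolding of_real_eq_iff .
qed

text \<open>A vector is a matrix with one column; in this form the Pythagorean identity for
  \<open>frob\<close> can bound operator norms.\<close>

lemma opnorm_leI_frob:
  assumes "\<And>B. dim_row B = dim_col A \<Longrightarrow> frob (A * B) \<le> c * frob B" "0 \<le> c"
  shows "opnorm A \<le> c"
proof (rule opnorm_leI)
  fix v :: "complex vec" assume v: "dim_vec v = dim_col A"
  let ?B = "mat (dim_vec v) 1 (\<lambda>(i, _). v $ i)"
  have "col ?B 0 = v" by (rule eq_vecI) auto
  moreover have "frob M = vnorm (col M 0)" if "dim_col M = 1" for M
    using that by (simp add: frob_def L2_set_def)
  moreover have "col (A * ?B) 0 = A *\<^sub>v col ?B 0" by (rule eq_vecI) (auto simp: index_mult_mat(1))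
  ultimately show "vnorm (A *\<^sub>v v) \<le> c * vnorm v" using assms(1)[of ?B] v by simp
qed (rule assms)

text \<open>Up to a unitary, the sum is block diagonal with both blocks equal to \<open>M\<close>.
  Pythagoras gives the upper bound, and compression to one block the lower bound.\<close>

lemma opnorm_isometry_pair_sum:
  assumes V: "isometry_pair k l l V1 V2" and M: "M \<in> carrier_mat l l"
  shows "opnorm (V1 * M * madj V1 + V2 * M * madj V2) = opnorm M"
proof (rule antisym)
  note o = isometry_pair_orthogonal[OF V]
  have V': "madj V1 * V1 = 1\<^sub>m l" "madj V2 * V2 = 1\<^sub>m l" "V1 * madj V1 + V2 * madj V2 = 1\<^sub>m k"
    and [simp]: "dim_row V1 = k" "dim_col V1 = l" "dim_row V2 = k" "dim_col V2 = l" "V1 \<in> carrier_mat k l"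
      "dim_row M = l" "dim_col M = l"
    using V M by (auto simp: isometry_pair_def)
  let ?S = "V1 * M * madj V1 + V2 * M * madj V2"
  show "opnorm ?S \<le> opnorm M"
  proof (rule opnorm_leI_frob)
    fix B :: "complex mat" assume "dim_row B = dim_col ?S"
    then have B [simp]: "dim_row B = k" by simp
    have "?S * B = V1 * (M * (madj V1 * B)) + V2 * (M * (madj V2 * B))"
      by (simp add: mat_dim_simps)
    then have "(frob (?S * B))\<^sup>2 = (frob (M * (madj V1 * B)))\<^sup>2 + (frob (M * (madj V2 * B)))\<^sup>2"
      using frob_isometry_pair_sum[OF V] by simp
    also have "\<dots> \<le> (opnorm M * frob (madj V1 * B))\<^sup>2 + (opnorm M * frob (madj V2 * B))\<^sup>2"
      by (intro add_mono power_mono frob_mult_right) auto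
    also have "\<dots> = (opnorm M)\<^sup>2 * (frob (V1 * (madj V1 * B) + V2 * (madj V2 * B)))\<^sup>2"
      using frob_isometry_pair_sum[OF V, of "madj V1 * B" "madj V2 * B"] by (simp add: power_mult_distrib algebra_simps)
    also have "V1 * (madj V1 * B) + V2 * (madj V2 * B) = (V1 * madj V1 + V2 * madj V2) * B"
      by (simp add: mat_dim_simps)
    also have "\<dots> = B" using V' by simp
    finally have "(frob (?S * B))\<^sup>2 \<le> (opnorm M * frob B)\<^sup>2"
      by (simp only: power_mult_distrib)
    then show "frob (?S * B) \<le> opnorm M * frob B"
      by (rule power2_le_imp_le) simp
  qed simp
  have "madj V1 * ?S * V1 = (madj V1 * V1) * M * (madj V1 * V1) + (madj V1 * V2) * M * (madj V2 * V1)"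
    by (simp add: mat_dim_simps)
  also have "\<dots> = M"
    unfolding V' o by (rule eq_matI) simp_all
  finally have "M = madj V1 * ?S * V1" by simp
  then have "opnorm M \<le> opnorm (madj V1) * opnorm ?S * opnorm V1"
    using order.trans[OF opnorm_mult[of "madj V1 * ?S" V1] mult_right_mono[OF opnorm_mult[of "madj V1" ?S]]] by simp
  also have "\<dots> \<le> 1 * opnorm ?S * 1"
    using opnorm_isometry[OF V'(1)] by (intro mult_mono) (auto simp: opnorm_madj)
  finally show "opnorm M \<le> opnorm ?S" by simp
qed

text \<open>Doubling a microstate shows that microstate spaces which are empty for all large sizes are
  empty for all sizes.  This is why the value \<open>-\<infinity>\<close> of one summand is absorbing: in a splitting
  \<open>k1 + k2 = k\<close> one of the sizes may stay small.\<close>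

lemma isometry_pair_doubling:
  obtains V1 V2 where "isometry_pair (2 * k) k k V1 V2"
proof -
  define V1 :: "complex mat" where "V1 = mat (2 * k) k (\<lambda>(i, j). if i = j then 1 else 0)"
  define V2 :: "complex mat" where "V2 = mat (2 * k) k (\<lambda>(i, j). if i = j + k then 1 else 0)"
  have [simp]: "dim_row V1 = 2 * k" "dim_col V1 = k" "dim_row V2 = 2 * k" "dim_col V2 = k"
    by (simp_all add: V1_def V2_def)
  have ind: "cnj (if b then 1 else 0) = (if b then 1 else 0)"
    "(if b then (1::complex) else 0) * c = (if b then c else 0)" for b c by auto
  have "madj V1 * V1 = 1\<^sub>m k"
    by (rule eq_matI) (auto simp: index_mult_mat_sum V1_def ind)
  moreover have "madj V2 * V2 = 1\<^sub>m k"
    by (rule eq_matI) (auto simp: index_mult_mat_sum V2_def ind)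
  moreover have "V1 * madj V1 + V2 * madj V2 = 1\<^sub>m (2 * k)"
  proof (rule eq_matI)
    fix i j assume "i < dim_row (1\<^sub>m (2 * k))" "j < dim_col (1\<^sub>m (2 * k))"
    then have ij: "i < 2 * k" "j < 2 * k" by auto
    have 1: "(V1 * madj V1) $$ (i, j) = (if i = j \<and> i < k then 1 else 0)"
      using ij by (auto simp: index_mult_mat_sum V1_def ind)
    have "(V2 * madj V2) $$ (i, j) = (\<Sum>l<k. (if i = l + k then 1 else 0) * (if j = l + k then 1 else 0))"
      using ij by (simp add: index_mult_mat_sum V2_def ind(1))
    also have "\<dots> = (\<Sum>l<k. if l = i - k then (if i \<ge> k \<and> i = j then 1 else 0) else 0)"
      by (rule sum.cong) auto
    also have "\<dots> = (if i = j \<and> i \<ge> k then 1 else 0)" using ij by auto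
    finally show "(V1 * madj V1 + V2 * madj V2) $$ (i, j) = 1\<^sub>m (2 * k) $$ (i, j)"
      using 1 ij by simp
  qed auto
  ultimately show ?thesis
    by (intro that[of V1 V2]) (auto simp: isometry_pair_def intro!: carrier_matI)
qed

text \<open>\<open>\<phi>\<close> is a unital isometric *-homomorphism, so every polynomial keeps
  its norm and all microstate conditions survive with the same parameters.\<close>

lemma Gamma_top_doubling:
  assumes X: "X \<in> Gamma_top A x R k \<epsilon> P r" and P: "\<And>j. j \<ge> 1 \<Longrightarrow> P j \<in> ncpolys (length x)"
  shows "Gamma_top A x R (2 * k) \<epsilon> P r \<noteq> {}"
proof -
  obtain V1 V2 where V: "isometry_pair (2 * k) k k V1 V2" by (rule isometry_pair_doubling)
  note o = isometry_pair_orthogonal[OF V]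
  have V': "madj V1 * V1 = 1\<^sub>m k" "madj V2 * V2 = 1\<^sub>m k" "V1 * madj V1 + V2 * madj V2 = 1\<^sub>m (2 * k)"
    and [simp]: "dim_row V1 = 2 * k" "dim_col V1 = k" "dim_row V2 = 2 * k" "dim_col V2 = k"
    using V by (auto simp: isometry_pair_def)
  define \<phi> where "\<phi> M = V1 * M * madj V1 + V2 * M * madj V2" for M
  have Xt: "X \<in> tuples (length x) k" using X by (simp add: Gamma_top_def)
  then have len: "length X = length x" and Xc: "X ! i \<in> carrier_mat k k" if "i < length x" for i
    using that by (auto simp: tuples_def)
  have len: "length X = length x" using Xt by (simp add: tuples_def)
  interpret star_algebra_tuple "matalg k" "carrier_mat k k" X "length x"
    by (rule matalg_star_algebra_tuple[OF Xt])
  have ev: "ncpoly_eval (matalg (2 * k)) (map \<phi> X) Q = \<phi> (ncpoly_eval (matalg k) X Q)" if "Q \<in> ncpolys (length x)" for Q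
  proof (rule ncpoly_eval_hom[OF Xt that])
    show "\<phi> (0\<^sub>m k k) = 0\<^sub>m (2 * k) (2 * k)" "\<phi> (1\<^sub>m k) = 1\<^sub>m (2 * k)"
      using V'(3) by (simp_all add: \<phi>_def)
    fix M N :: "complex mat" and c assume M: "M \<in> carrier_mat k k"
    then show "\<phi> (c \<cdot>\<^sub>m M) = c \<cdot>\<^sub>m \<phi> M"
      by (simp add: \<phi>_def mat_dim_simps) (rule eq_matI; simp add: algebra_simps)
    assume N: "N \<in> carrier_mat k k"
    show "\<phi> (M + N) = \<phi> M + \<phi> N"
      using M N by (simp add: \<phi>_def mat_dim_simps) (rule eq_matI; simp)
    have "\<phi> M * \<phi> N = V1 * M * (madj V1 * V1) * N * madj V1 + V2 * M * (madj V2 * V1) * N * madj V1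
        + (V1 * M * (madj V1 * V2) * N * madj V2 + V2 * M * (madj V2 * V2) * N * madj V2)"
      using M N by (simp add: \<phi>_def mat_dim_simps)
    also have "\<dots> = V1 * (M * N) * madj V1 + V2 * (M * N) * madj V2"
      unfolding V' o using M N by (simp add: mat_dim_simps) (rule eq_matI; simp)
    finally show "\<phi> (M * N) = \<phi> M * \<phi> N" by (simp add: \<phi>_def)
  qed
  have norm: "opnorm (\<phi> M) = opnorm M" if "M \<in> carrier_mat k k" for M
    unfolding \<phi>_def by (rule opnorm_isometry_pair_sum[OF V that])
  have "map \<phi> X \<in> Gamma_top A x R (2 * k) \<epsilon> P r"
  proof (rule Gamma_topI)
    show "map \<phi> X \<in> tuples (length x) (2 * k)"
      by (auto simp: tuples_def len \<phi>_def intro!: carrier_matI)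
    show "madj (map \<phi> X ! i) = map \<phi> X ! i" if i: "i < length x" for i
      using X i Xc[OF i] by (simp add: Gamma_top_def len \<phi>_def madj_add madj_mult mat_dim_simps)
    show "opnorm (map \<phi> X ! i) \<le> R" if i: "i < length x" for i
      using X i Xc[OF i] by (simp add: Gamma_top_def len norm)
    show "\<bar>opnorm (ncpoly_eval (matalg (2 * k)) (map \<phi> X) (P j)) - cnorm A (ncpoly_eval A x (P j))\<bar> \<le> \<epsilon>"
      if "j \<in> {1..r}" for j
      using X P[of j] that by (simp add: Gamma_top_def ev norm ncpoly_eval_closed)
  qed
  then show ?thesis by blast
qed

text \<open>Otherwise repeated doubling would produce nonempty spaces of arbitrarily large size. The
  size 0 is excluded because doubling fixes it.\<close>

lemma Gamma_top_empty:
  assumes P: "\<And>j. j \<ge> 1 \<Longrightarrow> P j \<in> ncpolys (length x)"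
    and empty: "\<forall>\<^sub>F k in sequentially. Gamma_top A x R k \<epsilon> P r = {}" and k: "k \<ge> 1"
  shows "Gamma_top A x R k \<epsilon> P r = {}"
proof (rule ccontr)
  assume ne: "Gamma_top A x R k \<epsilon> P r \<noteq> {}"
  have "Gamma_top A x R (2 ^ n * k) \<epsilon> P r \<noteq> {}" for n
  proof (induction n)
    case (Suc n)
    then obtain X where X: "X \<in> Gamma_top A x R (2 ^ n * k) \<epsilon> P r" by blast
    show ?case using Gamma_top_doubling[OF X] P by (simp add: mult.assoc)
  qed (use ne in simp)
  moreover obtain K where "\<And>k. k \<ge> K \<Longrightarrow> Gamma_top A x R k \<epsilon> P r = {}"
    using empty by (auto simp: eventually_sequentially)
  moreover have "2 ^ K * k \<ge> K"
    using k less_exp[of K] by (metis less_imp_le mult.right_neutral mult_le_mono)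
  ultimately show False by blast
qed

subsection \<open>Covering numbers\<close>

lemma frob_le: "dim_row A = k \<Longrightarrow> dim_col A = k \<Longrightarrow> (\<And>i j. i < k \<Longrightarrow> j < k \<Longrightarrow> cmod (A $$ (i, j)) \<le> c) \<Longrightarrow> 0 \<le> c \<Longrightarrow>
    frob A \<le> real k * c"
proof -
  assume d: "dim_row A = k" "dim_col A = k" and e: "\<And>i j. i < k \<Longrightarrow> j < k \<Longrightarrow> cmod (A $$ (i, j)) \<le> c" and c: "0 \<le> c"
  have "(frob A)\<^sup>2 \<le> (\<Sum>j<k. \<Sum>i<k. c\<^sup>2)"
    unfolding frob_square d by (intro sum_mono power_mono e) auto
  also have "\<dots> = (real k * c)\<^sup>2" by (simp add: power2_eq_square algebra_simps)
  finally show ?thesis using c by (intro power2_le_imp_le[of "frob A"]) auto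
qed

lemma hs2_L2_set: "hs2 k A = L2_set (\<lambda>i. frob (A ! i) / sqrt (real k)) {..<length A}"
proof -
  have "Re (\<Sum>i<length A. mtrace (madj (A ! i) * (A ! i)) / of_nat k) = (\<Sum>i<length A. (frob (A ! i) / sqrt (real k))\<^sup>2)"
    by (simp add: mtrace_madj_mult_self power_divide Re_divide_of_nat del: of_real_power)
  then show ?thesis by (simp add: hs2_def L2_set_def)
qed

lemma frob_le_hs2: "i < length A \<Longrightarrow> k \<ge> 1 \<Longrightarrow> frob (A ! i) \<le> sqrt (real k) * hs2 k A"
  using member_le_L2_set[of "{..<length A}" i "\<lambda>i. frob (A ! i) / sqrt (real k)"]
  by (simp add: hs2_L2_set field_simps)

text \<open>The factor from bounding the Euclidean norm by the sum is the number of generators,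
  which is independent of \<open>k\<close>.\<close>

lemma hs2_le:
  assumes "\<And>i. i < length A \<Longrightarrow> frob (A ! i) \<le> sqrt (real k) * c" "0 \<le> c"
  shows "hs2 k A \<le> real (length A) * c"
proof -
  have "frob (A ! i) / sqrt (real k) \<le> c" if "i < length A" for i
    \<comment> \<open>For k = 0 the quotient is 0 by the convention for division.\<close>
    using assms(1)[OF that] assms(2) by (cases "k = 0") (auto simp: field_simps)
  then have "(\<Sum>i<length A. \<bar>frob (A ! i) / sqrt (real k)\<bar>) \<le> (\<Sum>i<length A. c)"
    by (intro sum_mono) auto
  then show ?thesis
    using L2_set_le_sum_abs[of "\<lambda>i. frob (A ! i) / sqrt (real k)" "{..<length A}"] by (simp add: hs2_L2_set)
qed

lemma unitary_mat_one: "unitary_mat k (1\<^sub>m k)"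
  by (simp add: unitary_mat_def)

lemma orbit_ballI:
  assumes "A \<in> tuples n k" "B \<in> tuples n k" "unitary_mat k W"
    and "\<And>i. i < n \<Longrightarrow> frob (A ! i - W * B ! i * madj W) \<le> sqrt (real k) * c" "0 \<le> c" "real n * c < \<omega>"
  shows "A \<in> orbit_ball k \<omega> B"
proof -
  let ?L = "map2 (-) A (map (\<lambda>Bi. W * Bi * madj W) B)"
  have len: "length A = n" "length B = n" using assms by (auto simp: tuples_def)
  have "hs2 k ?L \<le> real (length ?L) * c"
    by (rule hs2_le) (use assms len in auto)
  with assms len show ?thesis by (auto simp: orbit_ball_def intro!: exI[of _ W])
qed

lemma orbit_ball_frob:
  assumes "A \<in> orbit_ball k \<omega> B" "B \<in> tuples n k" "k \<ge> 1"
  obtains W where "unitary_mat k W" "\<And>i. i < n \<Longrightarrow> frob (A ! i - W * B ! i * madj W) \<le> sqrt (real k) * \<omega>"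
proof -
  have len: "length B = n" "length A = n" using assms by (auto simp: tuples_def orbit_ball_def)
  obtain W where W: "unitary_mat k W" "hs2 k (map2 (-) A (map (\<lambda>Bi. W * Bi * madj W) B)) < \<omega>"
    using assms by (auto simp: orbit_ball_def)
  have "frob (A ! i - W * B ! i * madj W) \<le> sqrt (real k) * \<omega>" if "i < n" for i
  proof -
    have "frob (A ! i - W * B ! i * madj W) \<le> sqrt (real k) * hs2 k (map2 (-) A (map (\<lambda>Bi. W * Bi * madj W) B))"
      using frob_le_hs2[of i "map2 (-) A (map (\<lambda>Bi. W * Bi * madj W) B)" k] that len assms(3) by simp
    also have "\<dots> \<le> sqrt (real k) * \<omega>" using W by (intro mult_left_mono) auto
    finally show ?thesis .
  qed
  with W that show ?thesis by blast
qed

text \<open>Since \<open>o2\<close> is a \<open>LEAST\<close>, its value has a meaning only if some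
  finite cover exists. Rounding all entries to a grid leaves finitely many cells, and tuples in one
  cell are close with the identity as the unitary.\<close>

lemma finite_orbit_cover:
  assumes "\<Sigma> \<subseteq> tuples n k" and R: "\<And>X i. X \<in> \<Sigma> \<Longrightarrow> i < n \<Longrightarrow> opnorm (X ! i) \<le> R" and "\<omega> > 0"
  shows "\<exists>C. finite C \<and> C \<subseteq> \<Sigma> \<and> \<Sigma> \<subseteq> (\<Union>B\<in>C. orbit_ball k \<omega> B)"
proof -
  \<comment> \<open>Entries in a common cell differ by at most \<open>2 * \<eta>\<close>, so each
    matrix moves by at most \<open>2 * k * \<eta>\<close> in \<open>frob\<close>. Normalised by sqrt
    k and multiplied by the number n of matrices, this has to stay below
    \<open>\<omega>\<close>.\<close>
  define \<eta> where "\<eta> = \<omega> / (2 * (real n + 1) * (sqrt (real k) + 1))"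
  have \<eta>: "\<eta> > 0" using assms(3) by (simp add: \<eta>_def add_nonneg_pos)
  have small: "real n * (2 * \<eta> * sqrt (real k)) < \<omega>"
  proof -
    have "real n * sqrt (real k) < (real n + 1) * (sqrt (real k) + 1)"
      by (simp add: algebra_simps add_pos_nonneg)
    then have "\<omega> * (real n * sqrt (real k)) < \<omega> * ((real n + 1) * (sqrt (real k) + 1))"
      using assms(3) by simp
    moreover have "(real n + 1) * (sqrt (real k) + 1) > 0" by (simp add: add_nonneg_pos)
    ultimately show ?thesis unfolding \<eta>_def by (simp add: field_simps)
  qed
  define I where "I = {..<n} \<times> {..<k} \<times> {..<k}"
  define M where "M = \<lceil>R / \<eta>\<rceil> + 1"
  define f where "f X = restrict (\<lambda>(l, i, j). (\<lfloor>Re (X ! l $$ (i, j)) / \<eta>\<rfloor>, \<lfloor>Im (X ! l $$ (i, j)) / \<eta>\<rfloor>)) I"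
    for X :: "complex mat list"
  have range: "\<lfloor>t / \<eta>\<rfloor> \<in> {-M..M}" if "\<bar>t\<bar> \<le> R" for t
  proof -
    have "t / \<eta> \<le> R / \<eta>" "- (R / \<eta>) \<le> t / \<eta>" using that \<eta> by (auto simp: field_simps)
    then show ?thesis unfolding M_def by (simp add: le_floor_iff floor_le_iff) linarith
  qed
  have "f X \<in> I \<rightarrow>\<^sub>E {-M..M} \<times> {-M..M}" if X: "X \<in> \<Sigma>" for X
  proof -
    have "cmod (X ! l $$ (i, j)) \<le> R" if "l < n" "i < k" "j < k" for l i j
      using norm_index_le_opnorm[of i "X ! l" j] R[OF X \<open>l < n\<close>] X assms(1) that
      by (fastforce simp: tuples_def)
    then have "\<bar>Re (X ! l $$ (i, j))\<bar> \<le> R" "\<bar>Im (X ! l $$ (i, j))\<bar> \<le> R" if "l < n" "i < k" "j < k" for l i j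
      using that abs_Re_le_cmod[of "X ! l $$ (i, j)"] abs_Im_le_cmod[of "X ! l $$ (i, j)"] order.trans by blast+
    then show ?thesis by (auto simp: f_def I_def intro!: range simp del: atLeastAtMost_iff)
  qed
  then have "f ` \<Sigma> \<subseteq> I \<rightarrow>\<^sub>E {-M..M} \<times> {-M..M}" by blast
  then have fin: "finite (f ` \<Sigma>)"
    by (rule finite_subset) (auto simp: I_def intro!: finite_PiE)
  define s where "s c = (SOME X. X \<in> \<Sigma> \<and> f X = c)" for c
  have s: "s c \<in> \<Sigma> \<and> f (s c) = c" if "c \<in> f ` \<Sigma>" for c
    unfolding s_def by (rule someI_ex) (use that in auto)
  have "X \<in> orbit_ball k \<omega> (s (f X))" if X: "X \<in> \<Sigma>" for X
  proof (rule orbit_ballI[OF _ _ unitary_mat_one _ _ small])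
    have Y: "s (f X) \<in> \<Sigma>" "f (s (f X)) = f X" using s[of "f X"] X by auto
    show "X \<in> tuples n k" "s (f X) \<in> tuples n k" using X Y assms(1) by auto
    fix l assume l: "l < n"
    have c: "X ! l \<in> carrier_mat k k" "s (f X) ! l \<in> carrier_mat k k"
      using X Y assms(1) l by (auto simp: tuples_def)
    have "cmod ((X ! l - s (f X) ! l) $$ (i, j)) \<le> 2 * \<eta>" if ij: "i < k" "j < k" for i j
    proof -
      have fl: "\<bar>a - b\<bar> \<le> \<eta>" if "\<lfloor>a / \<eta>\<rfloor> = \<lfloor>b / \<eta>\<rfloor>" for a b
      proof -
        have "\<bar>a / \<eta> - b / \<eta>\<bar> \<le> 1" using that by linarith
        then have "\<bar>(a - b) / \<eta>\<bar> \<le> 1" by (simp add: diff_divide_distrib)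
        then show ?thesis using \<eta> by (simp add: abs_divide)
      qed
      have "\<lfloor>Re (X ! l $$ (i, j)) / \<eta>\<rfloor> = \<lfloor>Re (s (f X) ! l $$ (i, j)) / \<eta>\<rfloor> \<and>
          \<lfloor>Im (X ! l $$ (i, j)) / \<eta>\<rfloor> = \<lfloor>Im (s (f X) ! l $$ (i, j)) / \<eta>\<rfloor>"
        using fun_cong[OF Y(2), of "(l, i, j)"] l ij by (simp add: f_def I_def)
      then have "\<bar>Re ((X ! l - s (f X) ! l) $$ (i, j))\<bar> \<le> \<eta>" "\<bar>Im ((X ! l - s (f X) ! l) $$ (i, j))\<bar> \<le> \<eta>"
        using c ij by (auto intro!: fl)
      then show ?thesis using cmod_le[of "(X ! l - s (f X) ! l) $$ (i, j)"] by linarith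
    qed
    then have "frob (X ! l - s (f X) ! l) \<le> real k * (2 * \<eta>)"
      using c \<eta> by (intro frob_le) auto
    also have "real k * (2 * \<eta>) = sqrt (real k) * (2 * \<eta> * sqrt (real k))" by simp
    finally show "frob (X ! l - 1\<^sub>m k * s (f X) ! l * madj (1\<^sub>m k)) \<le> sqrt (real k) * (2 * \<eta> * sqrt (real k))"
      using c by simp
  qed (use \<eta> in simp)
  then show ?thesis
    using fin s by (intro exI[of _ "s ` f ` \<Sigma>"]) blast
qed

section \<open>Minimal covers\<close>

lemma o2_attained:
  assumes "\<exists>C. finite C \<and> C \<subseteq> \<Sigma> \<and> \<Sigma> \<subseteq> (\<Union>B\<in>C. orbit_ball k \<omega> B)"
  obtains C where "finite C" "card C = o2 k \<Sigma> \<omega>" "C \<subseteq> \<Sigma>" "\<Sigma> \<subseteq> (\<Union>B\<in>C. orbit_ball k \<omega> B)"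
proof -
  have "\<exists>C. finite C \<and> card C = o2 k \<Sigma> \<omega> \<and> C \<subseteq> \<Sigma> \<and> \<Sigma> \<subseteq> (\<Union>B\<in>C. orbit_ball k \<omega> B)"
    unfolding o2_def by (rule LeastI_ex) (use assms in blast)
  with that show ?thesis by blast
qed

lemma o2_le:
  assumes "finite C" "C \<subseteq> \<Sigma>" "\<Sigma> \<subseteq> (\<Union>B\<in>C. orbit_ball k \<omega> B)"
  shows "o2 k \<Sigma> \<omega> \<le> card C"
  unfolding o2_def by (rule Least_le) (use assms in blast)

text \<open>Centres of a cover must lie in \<open>\<Sigma>\<close>, while the classes will be
  indexed by data from other microstate spaces. Hence a member of each nonempty class is taken as a
  centre, and two members of one class must be close; this doubles the radius later.\<close>

lemma o2_le_card_classes: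
  assumes I: "finite I" and cov: "\<And>X. X \<in> \<Sigma> \<Longrightarrow> \<exists>\<iota>\<in>I. near \<iota> X"
    and ball: "\<And>\<iota> X Y. \<iota> \<in> I \<Longrightarrow> near \<iota> X \<Longrightarrow> near \<iota> Y \<Longrightarrow> X \<in> \<Sigma> \<Longrightarrow> Y \<in> \<Sigma> \<Longrightarrow> X \<in> orbit_ball k \<omega> Y"
  shows "o2 k \<Sigma> \<omega> \<le> card I"
proof -
  define J where "J = {\<iota> \<in> I. \<exists>X\<in>\<Sigma>. near \<iota> X}"
  have J: "finite J" "card J \<le> card I" using I by (auto simp: J_def intro: card_mono)
  have "\<forall>\<iota>\<in>J. \<exists>X. X \<in> \<Sigma> \<and> near \<iota> X" by (auto simp: J_def)
  then obtain c where c: "\<And>\<iota>. \<iota> \<in> J \<Longrightarrow> c \<iota> \<in> \<Sigma> \<and> near \<iota> (c \<iota>)" by metis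
  have "o2 k \<Sigma> \<omega> \<le> card (c ` J)"
  proof (rule o2_le)
    show "\<Sigma> \<subseteq> (\<Union>B\<in>c ` J. orbit_ball k \<omega> B)"
    proof
      fix X assume X: "X \<in> \<Sigma>"
      then obtain \<iota> where \<iota>: "\<iota> \<in> I" "near \<iota> X" using cov by blast
      then have "\<iota> \<in> J" using X by (auto simp: J_def)
      then show "X \<in> (\<Union>B\<in>c ` J. orbit_ball k \<omega> B)" using ball[OF \<iota>] c X by blast
    qed
  qed (use J c in auto)
  also have "\<dots> \<le> card J" by (rule card_image_le[OF J(1)])
  finally show ?thesis using J(2) by simp
qed

section \<open>Lipschitz bounds for polynomial evaluation, and changes of splitting\<close>

lemma frob_mult_diff:
  assumes "A \<in> carrier_mat n m" "A' \<in> carrier_mat n m" "B \<in> carrier_mat m l" "B' \<in> carrier_mat m l"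
  shows "frob (A * B - A' * B') \<le> frob (A - A') * opnorm B + opnorm A' * frob (B - B')"
proof -
  have "A * B - A' * B' = (A - A') * B + A' * (B - B')"
    using assms by (simp add: mat_dim_simps) (rule eq_matI; auto)
  then have "frob (A * B - A' * B') \<le> frob ((A - A') * B) + frob (A' * (B - B'))"
    using frob_add[of "(A - A') * B" "A' * (B - B')"] assms by simp
  also have "\<dots> \<le> frob (A - A') * opnorm B + opnorm A' * frob (B - B')"
    using assms by (intro add_mono frob_mult_left frob_mult_right) auto
  finally show ?thesis .
qed

lemma frob_sum_diff:
  assumes "A \<in> carrier_mat n m" "B \<in> carrier_mat n m" "A' \<in> carrier_mat n m" "B' \<in> carrier_mat n m"
  shows "frob (A + B - (A' + B')) \<le> frob (A - A') + frob (B - B')"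
proof -
  have "A + B - (A' + B') = (A - A') + (B - B')" by (rule eq_matI) (use assms in auto)
  then show ?thesis using frob_add[of "A - A'" "B - B'"] assms by simp
qed

text \<open>The point is that \<open>L\<close> does not depend on the matrix size. The induction on
  words carries an operator norm bound along, because the product rule pairs \<open>frob\<close> of
  one difference with \<open>opnorm\<close> of the other factor.\<close>

lemma ncpoly_eval_Lipschitz:
  assumes P: "P \<in> ncpolys n"
  obtains L where "L \<ge> 0" "\<And>k X Y c. X \<in> tuples n k \<Longrightarrow> Y \<in> tuples n k \<Longrightarrow>
    (\<And>i. i < n \<Longrightarrow> opnorm (X ! i) \<le> R) \<Longrightarrow> (\<And>i. i < n \<Longrightarrow> opnorm (Y ! i) \<le> R) \<Longrightarrow>
    (\<And>i. i < n \<Longrightarrow> frob (X ! i - Y ! i) \<le> c) \<Longrightarrow> 0 \<le> c \<Longrightarrow>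
    frob (ncpoly_eval (matalg k) X P - ncpoly_eval (matalg k) Y P) \<le> L * c"
proof -
  define ok where "ok k X Y c \<longleftrightarrow> X \<in> tuples n k \<and> Y \<in> tuples n k \<and> 0 \<le> c \<and>
    (\<forall>i<n. opnorm (X ! i) \<le> R \<and> opnorm (Y ! i) \<le> R \<and> frob (X ! i - Y ! i) \<le> c)" for k X Y c
  have mon: "\<exists>K L. 0 \<le> K \<and> 0 \<le> L \<and> (\<forall>k X Y c. ok k X Y c \<longrightarrow> opnorm (ncmon (matalg k) X w) \<le> K \<and>
      frob (ncmon (matalg k) X w - ncmon (matalg k) Y w) \<le> L * c)" if "set w \<subseteq> {..<n}" for w
    using that
  proof (induction w)
    case Nil
    show ?case
      by (rule exI[of _ 1], rule exI[of _ 0]) (use opnorm_one frob_le_opnorm in \<open>auto intro: order.trans[OF frob_le_opnorm]\<close>)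
  next
    case (Cons i w)
    then obtain K L where KL: "0 \<le> K" "0 \<le> L" "\<And>k X Y c. ok k X Y c \<Longrightarrow> opnorm (ncmon (matalg k) X w) \<le> K"
        "\<And>k X Y c. ok k X Y c \<Longrightarrow> frob (ncmon (matalg k) X w - ncmon (matalg k) Y w) \<le> L * c"
      by auto
    have i: "i < n" and w: "set w \<subseteq> {..<n}" using Cons.prems by auto
    have "opnorm (X ! i * ncmon (matalg k) X w) \<le> \<bar>R\<bar> * K \<and>
      frob (X ! i * ncmon (matalg k) X w - Y ! i * ncmon (matalg k) Y w) \<le> (K + \<bar>R\<bar> * L) * c" if o: "ok k X Y c" for k X Y c
    proof -
      interpret tX: star_algebra_tuple "matalg k" "carrier_mat k k" X n
        using o by (intro matalg_star_algebra_tuple) (simp add: ok_def)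
      interpret tY: star_algebra_tuple "matalg k" "carrier_mat k k" Y n
        using o by (intro matalg_star_algebra_tuple) (simp add: ok_def)
      note car = tX.x_closed[OF i] tY.x_closed[OF i] tX.ncmon_closed[OF w] tY.ncmon_closed[OF w]
      have R: "opnorm (X ! i) \<le> \<bar>R\<bar>" "opnorm (Y ! i) \<le> \<bar>R\<bar>" "frob (X ! i - Y ! i) \<le> c" "0 \<le> c"
        using o i by (auto simp: ok_def intro: order.trans)
      have "opnorm (X ! i * ncmon (matalg k) X w) \<le> opnorm (X ! i) * opnorm (ncmon (matalg k) X w)"
        using car by (intro opnorm_mult) auto
      also have "\<dots> \<le> \<bar>R\<bar> * K" using R KL(3)[OF o] by (intro mult_mono) auto
      finally have 1: "opnorm (X ! i * ncmon (matalg k) X w) \<le> \<bar>R\<bar> * K" .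
      have "frob (X ! i * ncmon (matalg k) X w - Y ! i * ncmon (matalg k) Y w)
          \<le> frob (X ! i - Y ! i) * opnorm (ncmon (matalg k) X w)
            + opnorm (Y ! i) * frob (ncmon (matalg k) X w - ncmon (matalg k) Y w)"
        by (rule frob_mult_diff) (rule car)+
      also have "\<dots> \<le> c * K + \<bar>R\<bar> * (L * c)"
        using R KL(3,4)[OF o] by (intro add_mono mult_mono) auto
      finally show ?thesis using 1 by (simp add: algebra_simps)
    qed
    then show ?case
      using KL by (intro exI[of _ "\<bar>R\<bar> * K"] exI[of _ "K + \<bar>R\<bar> * L"]) simp
  qed
  have "\<exists>L\<ge>0. \<forall>k X Y c. ok k X Y c \<longrightarrow>
      frob (word_sum (matalg k) X P ws - word_sum (matalg k) Y P ws) \<le> L * c"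
    if "\<And>w. w \<in> set ws \<Longrightarrow> set w \<subseteq> {..<n}" for ws
    using that
  proof (induction ws)
    case Nil
    show ?case by (rule exI[of _ 0]) (auto intro: order.trans[OF frob_le_opnorm])
  next
    case (Cons w ws)
    then obtain L where L: "0 \<le> L" "\<And>k X Y c. ok k X Y c \<Longrightarrow>
        frob (word_sum (matalg k) X P ws - word_sum (matalg k) Y P ws) \<le> L * c" by auto
    have w: "set w \<subseteq> {..<n}" and ws: "\<And>w. w \<in> set ws \<Longrightarrow> set w \<subseteq> {..<n}" using Cons.prems by auto
    obtain L' where L': "0 \<le> L'" "\<And>k X Y c. ok k X Y c \<Longrightarrow>
        frob (ncmon (matalg k) X w - ncmon (matalg k) Y w) \<le> L' * c" using mon[OF w] by auto
    have "frob (word_sum (matalg k) X P (w # ws) - word_sum (matalg k) Y P (w # ws)) \<le> (cmod (P w) * L' + L) * c"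
      if o: "ok k X Y c" for k X Y c
    proof -
      interpret tX: star_algebra_tuple "matalg k" "carrier_mat k k" X n
        using o by (intro matalg_star_algebra_tuple) (simp add: ok_def)
      interpret tY: star_algebra_tuple "matalg k" "carrier_mat k k" Y n
        using o by (intro matalg_star_algebra_tuple) (simp add: ok_def)
      note car = tX.ncmon_closed[OF w] tY.ncmon_closed[OF w]
        tX.word_sum_closed[of ws P, OF ws] tY.word_sum_closed[of ws P, OF ws]
      have "frob (word_sum (matalg k) X P (w # ws) - word_sum (matalg k) Y P (w # ws))
          \<le> frob (P w \<cdot>\<^sub>m ncmon (matalg k) X w - P w \<cdot>\<^sub>m ncmon (matalg k) Y w)
            + frob (word_sum (matalg k) X P ws - word_sum (matalg k) Y P ws)"
        unfolding word_sum_Cons matalg_simps by (rule frob_sum_diff[of _ k k]) (use car in auto)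
      also have "P w \<cdot>\<^sub>m ncmon (matalg k) X w - P w \<cdot>\<^sub>m ncmon (matalg k) Y w
          = P w \<cdot>\<^sub>m (ncmon (matalg k) X w - ncmon (matalg k) Y w)"
        by (rule eq_matI) (use car in \<open>auto simp: algebra_simps\<close>)
      also have "frob \<dots> + frob (word_sum (matalg k) X P ws - word_sum (matalg k) Y P ws)
          \<le> cmod (P w) * (L' * c) + L * c"
        unfolding frob_smult by (intro add_mono mult_left_mono L L' o) simp
      finally show ?thesis by (simp add: algebra_simps)
    qed
    then show ?case
      using L(1) L'(1) by (intro exI[of _ "cmod (P w) * L' + L"]) auto
  qed
  from this[of "nc_support P"] nc_support_words[OF P] obtain L where "L \<ge> 0" "\<forall>k X Y c. ok k X Y c \<longrightarrow>
      frob (ncpoly_eval (matalg k) X P - ncpoly_eval (matalg k) Y P) \<le> L * c"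
    by (auto simp: ncpoly_eval_word_sum)
  then show ?thesis by (intro that[of L]) (auto simp: ok_def)
qed

lemma isometry_pair_unitary:
  assumes V: "isometry_pair k k1 k2 V1 V2" and U: "unitary_mat k1 U1" "unitary_mat k2 U2"
  shows "isometry_pair k k1 k2 (V1 * U1) (V2 * U2)"
proof -
  have V': "madj V1 * V1 = 1\<^sub>m k1" "madj V2 * V2 = 1\<^sub>m k2" "V1 * madj V1 + V2 * madj V2 = 1\<^sub>m k"
    and [simp]: "dim_row V1 = k" "dim_col V1 = k1" "dim_row V2 = k" "dim_col V2 = k2"
    using V by (auto simp: isometry_pair_def)
  have U': "madj U1 * U1 = 1\<^sub>m k1" "madj U2 * U2 = 1\<^sub>m k2" "U1 * madj U1 = 1\<^sub>m k1" "U2 * madj U2 = 1\<^sub>m k2"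
    and [simp]: "dim_row U1 = k1" "dim_col U1 = k1" "dim_row U2 = k2" "dim_col U2 = k2"
    using U by (auto simp: unitary_mat_def)
  have "madj (V1 * U1) * (V1 * U1) = madj U1 * ((madj V1 * V1) * U1)"
    "madj (V2 * U2) * (V2 * U2) = madj U2 * ((madj V2 * V2) * U2)"
    "V1 * U1 * madj (V1 * U1) = V1 * ((U1 * madj U1) * madj V1)"
    "V2 * U2 * madj (V2 * U2) = V2 * ((U2 * madj U2) * madj V2)"
    by (simp_all add: madj_mult mat_dim_simps)
  then show ?thesis
    unfolding isometry_pair_def V' U' by (auto simp: U' V' intro!: carrier_matI)
qed

text \<open>\<open>W\<close> carries \<open>V1'\<close> to \<open>V1\<close> and \<open>V2'\<close>
  to \<open>V2\<close>. This is why orbit balls do not notice where the two summands lie.\<close>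

lemma isometry_pair_change:
  assumes V: "isometry_pair k k1 k2 V1 V2" and V': "isometry_pair k k1 k2 V1' V2'"
  obtains W where "unitary_mat k W"
    "\<And>M N. M \<in> carrier_mat k1 k1 \<Longrightarrow> N \<in> carrier_mat k2 k2 \<Longrightarrow>
      W * (V1' * M * madj V1' + V2' * N * madj V2') * madj W = V1 * M * madj V1 + V2 * N * madj V2"
proof -
  note o = isometry_pair_orthogonal[OF V] isometry_pair_orthogonal[OF V']
  have e: "madj V1 * V1 = 1\<^sub>m k1" "madj V2 * V2 = 1\<^sub>m k2" "V1 * madj V1 + V2 * madj V2 = 1\<^sub>m k"
      "madj V1' * V1' = 1\<^sub>m k1" "madj V2' * V2' = 1\<^sub>m k2" "V1' * madj V1' + V2' * madj V2' = 1\<^sub>m k"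
    and [simp]: "dim_row V1 = k" "dim_col V1 = k1" "dim_row V2 = k" "dim_col V2 = k2"
      "dim_row V1' = k" "dim_col V1' = k1" "dim_row V2' = k" "dim_col V2' = k2"
    using V V' by (auto simp: isometry_pair_def)
  define W where "W = V1 * madj V1' + V2 * madj V2'"
  have dW [simp]: "dim_row W = k" "dim_col W = k" by (auto simp: W_def)
  have "W * V1' = V1 * (madj V1' * V1') + V2 * (madj V2' * V1')"
    "W * V2' = V1 * (madj V1' * V2') + V2 * (madj V2' * V2')"
    by (simp_all add: W_def mat_dim_simps)
  then have WV: "W * V1' = V1" "W * V2' = V2"
    unfolding e o by (auto intro!: eq_matI)
  have VW: "madj V1' * madj W = madj V1" "madj V2' * madj W = madj V2"
    using arg_cong[OF WV(1), of madj] arg_cong[OF WV(2), of madj] by (simp_all add: madj_mult)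
  have conj: "W * (V1' * M * madj V1' + V2' * N * madj V2') * madj W = V1 * M * madj V1 + V2 * N * madj V2"
    if "M \<in> carrier_mat k1 k1" "N \<in> carrier_mat k2 k2" for M N
  proof -
    have "W * (V1' * M * madj V1' + V2' * N * madj V2') * madj W
        = (W * V1') * M * (madj V1' * madj W) + (W * V2') * N * (madj V2' * madj W)"
      using that by (simp add: mat_dim_simps)
    then show ?thesis unfolding WV VW .
  qed
  have "W * madj W = 1\<^sub>m k"
    using conj[of "1\<^sub>m k1" "1\<^sub>m k2"] e by simp
  moreover have "madj W * W = 1\<^sub>m k"
  proof -
    have "madj W = V1' * madj V1 + V2' * madj V2" by (simp add: W_def madj_add madj_mult)
    then have "madj W * W = V1' * (madj V1 * V1) * madj V1' + V1' * (madj V1 * V2) * madj V2'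
        + (V2' * (madj V2 * V1) * madj V1' + V2' * (madj V2 * V2) * madj V2')"
      by (simp add: W_def mat_dim_simps) (rule eq_matI; simp)
    also have "\<dots> = V1' * madj V1' + V2' * madj V2'"
      unfolding e(1,2) o by (rule eq_matI) simp_all
    finally show ?thesis using e by simp
  qed
  ultimately have "unitary_mat k W" by (auto simp: unitary_mat_def intro!: carrier_matI)
  with conj that show ?thesis by blast
qed

lemma frob_conj_isometry_le:
  assumes "V \<in> carrier_mat k l" "madj V * V = 1\<^sub>m l" "M \<in> carrier_mat l l"
  shows "frob (V * M * madj V) \<le> frob M"
proof -
  have V: "opnorm V \<le> 1" "opnorm (madj V) \<le> 1"
    using opnorm_isometry[OF assms(2)] by (auto simp: opnorm_madj)
  have "frob (V * M * madj V) \<le> opnorm V * frob M * opnorm (madj V)"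
    using assms by (intro order.trans[OF frob_mult_left] mult_right_mono frob_mult_right) auto
  also have "\<dots> \<le> 1 * frob M * 1" using V by (intro mult_mono) auto
  finally show ?thesis by simp
qed

definition Lipschitz_evals :: "nat \<Rightarrow> nat \<Rightarrow> (nat \<Rightarrow> nat list \<Rightarrow> complex) \<Rightarrow> real \<Rightarrow> real \<Rightarrow> bool" where
  "Lipschitz_evals p n g R L \<longleftrightarrow> 0 \<le> L \<and> (\<forall>l<p. g l \<in> ncpolys n \<and> (\<forall>k X Y c. X \<in> tuples n k \<longrightarrow> Y \<in> tuples n k \<longrightarrow>
    (\<forall>i<n. opnorm (X ! i) \<le> R \<and> opnorm (Y ! i) \<le> R \<and> frob (X ! i - Y ! i) \<le> c) \<longrightarrow> 0 \<le> c \<longrightarrow>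
    frob (ncpoly_eval (matalg k) X (g l) - ncpoly_eval (matalg k) Y (g l)) \<le> L * c))"

lemma Lipschitz_evals_exists:
  assumes "\<And>l. l < p \<Longrightarrow> g l \<in> ncpolys n"
  obtains L where "Lipschitz_evals p n g R L"
proof -
  have "\<exists>L. 0 \<le> L \<and> (\<forall>k X Y c. X \<in> tuples n k \<longrightarrow> Y \<in> tuples n k \<longrightarrow>
    (\<forall>i<n. opnorm (X ! i) \<le> R \<and> opnorm (Y ! i) \<le> R \<and> frob (X ! i - Y ! i) \<le> c) \<longrightarrow> 0 \<le> c \<longrightarrow>
    frob (ncpoly_eval (matalg k) X (g l) - ncpoly_eval (matalg k) Y (g l)) \<le> L * c)" if "l < p" for l
    by (rule ncpoly_eval_Lipschitz[OF assms[OF that], of R]) blast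
  then obtain L where L: "\<And>l. l < p \<Longrightarrow> 0 \<le> L l"
    "\<And>l k X Y c. l < p \<Longrightarrow> X \<in> tuples n k \<Longrightarrow> Y \<in> tuples n k \<Longrightarrow>
    (\<forall>i<n. opnorm (X ! i) \<le> R \<and> opnorm (Y ! i) \<le> R \<and> frob (X ! i - Y ! i) \<le> c) \<Longrightarrow> 0 \<le> c \<Longrightarrow>
    frob (ncpoly_eval (matalg k) X (g l) - ncpoly_eval (matalg k) Y (g l)) \<le> L l * c"
    by metis
  have "Lipschitz_evals p n g R (\<Sum>l<p. L l)"
    unfolding Lipschitz_evals_def
  proof (intro conjI allI impI)
    show "0 \<le> (\<Sum>l<p. L l)" using L(1) by (intro sum_nonneg) auto
    fix l k X Y and c :: real assume a: "l < p" "X \<in> tuples n k" "Y \<in> tuples n k"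
      "\<forall>i<n. opnorm (X ! i) \<le> R \<and> opnorm (Y ! i) \<le> R \<and> frob (X ! i - Y ! i) \<le> c" "0 \<le> c"
    have "L l \<le> (\<Sum>l<p. L l)" using L(1) a(1) by (intro member_le_sum) auto
    then show "frob (ncpoly_eval (matalg k) X (g l) - ncpoly_eval (matalg k) Y (g l)) \<le> (\<Sum>l<p. L l) * c"
      using L(2)[OF a] a(5) by (meson mult_right_mono order.trans)
  qed (use assms in auto)
  then show ?thesis by (rule that)
qed

text \<open>Evaluation commutes with unitary conjugation, so the unitary that brings
  \<open>Y\<close> near \<open>X\<close> does the same for all values of the polynomials. The factor
  sqrt k undoes the normalisation of \<open>hs2\<close>.\<close>

lemma orbit_ball_eval_conj:
  assumes Lip: "Lipschitz_evals p n g R L"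
    and X: "X \<in> orbit_ball k \<omega> Y" "\<And>i. i < n \<Longrightarrow> opnorm (X ! i) \<le> R"
    and Y: "Y \<in> tuples n k" "\<And>i. i < n \<Longrightarrow> opnorm (Y ! i) \<le> R" and "k \<ge> 1" "\<omega> > 0"
  obtains U where "unitary_mat k U" "\<And>l. l < p \<Longrightarrow> frob (ncpoly_eval (matalg k) X (g l) -
      U * ncpoly_eval (matalg k) Y (g l) * madj U) \<le> sqrt (real k) * (L * \<omega>)"
proof -
  obtain U where U: "unitary_mat k U" "\<And>i. i < n \<Longrightarrow> frob (X ! i - U * Y ! i * madj U) \<le> sqrt (real k) * \<omega>"
    using orbit_ball_frob[OF X(1) Y(1) assms(6)] by blast
  let ?Z = "map (\<lambda>B. U * B * madj U) Y"
  have len: "length Y = n" "length X = n" using X Y by (auto simp: tuples_def orbit_ball_def)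
  have Uc: "U \<in> carrier_mat k k" "madj U * U = 1\<^sub>m k" using U(1) by (auto simp: unitary_mat_def)
  have Yc: "Y ! i \<in> carrier_mat k k" if "i < n" for i using Y(1) that by (simp add: tuples_def)
  have "frob (ncpoly_eval (matalg k) X (g l) - U * ncpoly_eval (matalg k) Y (g l) * madj U) \<le> sqrt (real k) * (L * \<omega>)"
    if l: "l < p" for l
  proof -
    have gl: "g l \<in> ncpolys n" using Lip l by (simp add: Lipschitz_evals_def)
    have "X \<in> tuples n k" using X(1) len by (simp add: orbit_ball_def)
    moreover have "?Z \<in> tuples n k" using len Uc by (auto simp: tuples_def intro!: carrier_matI)
    moreover have "\<forall>i<n. opnorm (X ! i) \<le> R \<and> opnorm (?Z ! i) \<le> R \<and> frob (X ! i - ?Z ! i) \<le> sqrt (real k) * \<omega>"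
      using U(2) X(2) Y(2) len opnorm_isometry_conj[OF Yc Uc] by simp
    ultimately have "frob (ncpoly_eval (matalg k) X (g l) - ncpoly_eval (matalg k) ?Z (g l)) \<le> L * (sqrt (real k) * \<omega>)"
      using Lip l \<open>\<omega> > 0\<close> unfolding Lipschitz_evals_def by simp
    then show ?thesis
      by (simp add: ncpoly_eval_unitary_conj[OF Y(1) gl U(1)] mult_ac)
  qed
  with U(1) that show ?thesis by blast
qed

text \<open>A class is given by two sizes and two centres only; the isometries are quantified inside
  \<open>near\<close> because conjugation by a unitary absorbs them. In the radius, 2 comes from
  comparing two members of a class and p from \<open>hs2_le\<close>.\<close>

lemma o2_decomposes:
  assumes dec: "\<And>C. C \<in> \<Sigma> \<Longrightarrow> decomposes G H g h \<kappa> k C" and \<Sigma>: "\<Sigma> \<subseteq> tuples p k"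
    and G: "\<And>l. G l \<subseteq> tuples n l" "\<And>l X i. X \<in> G l \<Longrightarrow> i < n \<Longrightarrow> opnorm (X ! i) \<le> R"
    and H: "\<And>l. H l \<subseteq> tuples n' l" "\<And>l Y i. Y \<in> H l \<Longrightarrow> i < n' \<Longrightarrow> opnorm (Y ! i) \<le> R'"
    and Lg: "Lipschitz_evals p n g R L" and Lh: "Lipschitz_evals p n' h R' L'"
    and \<omega>1: "\<omega>1 > 0" and \<kappa>: "\<kappa> > 0" and \<omega>: "real p * (2 * (\<kappa> + L * \<omega>1 + L' * \<omega>1)) < \<omega>"
  shows "o2 k \<Sigma> \<omega> \<le> (\<Sum>(k1, k2)\<in>{1..k} \<times> {1..k}. o2 k1 (G k1) \<omega>1 * o2 k2 (H k2) \<omega>1)"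
proof -
  define \<theta> where "\<theta> = \<kappa> + L * \<omega>1 + L' * \<omega>1"
  have L0: "0 \<le> L" "0 \<le> L'" using Lg Lh by (auto simp: Lipschitz_evals_def)
  then have \<theta>: "0 \<le> \<theta>" using \<kappa> \<omega>1 by (simp add: \<theta>_def)
  have "\<exists>C. finite C \<and> card C = o2 l (G l) \<omega>1 \<and> C \<subseteq> G l \<and> G l \<subseteq> (\<Union>B\<in>C. orbit_ball l \<omega>1 B)" for l
    by (rule o2_attained[OF finite_orbit_cover[OF G \<omega>1]]) blast+
  then obtain \<C> where \<C>: "\<And>l. finite (\<C> l)" "\<And>l. card (\<C> l) = o2 l (G l) \<omega>1" "\<And>l. \<C> l \<subseteq> G l"
      "\<And>l. G l \<subseteq> (\<Union>B\<in>\<C> l. orbit_ball l \<omega>1 B)" by metis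
  have "\<exists>C. finite C \<and> card C = o2 l (H l) \<omega>1 \<and> C \<subseteq> H l \<and> H l \<subseteq> (\<Union>B\<in>C. orbit_ball l \<omega>1 B)" for l
    by (rule o2_attained[OF finite_orbit_cover[OF H \<omega>1]]) blast+
  then obtain \<D> where \<D>: "\<And>l. finite (\<D> l)" "\<And>l. card (\<D> l) = o2 l (H l) \<omega>1" "\<And>l. \<D> l \<subseteq> H l"
      "\<And>l. H l \<subseteq> (\<Union>B\<in>\<D> l. orbit_ball l \<omega>1 B)" by metis
  define I where "I = Sigma ({1..k} \<times> {1..k}) (\<lambda>(k1, k2). \<C> k1 \<times> \<D> k2)"
  define near where "near = (\<lambda>((k1, k2), (X0, Y0)) C. \<exists>V1 V2. isometry_pair k k1 k2 V1 V2 \<and>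
    (\<forall>l<p. frob (C ! l - (V1 * ncpoly_eval (matalg k1) X0 (g l) * madj V1 +
       V2 * ncpoly_eval (matalg k2) Y0 (h l) * madj V2)) \<le> sqrt (real k) * \<theta>))"
  have gh: "g l \<in> ncpolys n" "h l \<in> ncpolys n'" if "l < p" for l
    using that Lg Lh by (auto simp: Lipschitz_evals_def)
  have gc: "ncpoly_eval (matalg k1) X (g l) \<in> carrier_mat k1 k1" if "X \<in> tuples n k1" "l < p" for k1 X l
    using star_algebra_tuple.ncpoly_eval_closed[OF matalg_star_algebra_tuple[OF that(1)] gh(1)[OF that(2)]] .
  have hc: "ncpoly_eval (matalg k1) X (h l) \<in> carrier_mat k1 k1" if "X \<in> tuples n' k1" "l < p" for k1 X l
    using star_algebra_tuple.ncpoly_eval_closed[OF matalg_star_algebra_tuple[OF that(1)] gh(2)[OF that(2)]] .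
  have "o2 k \<Sigma> \<omega> \<le> card I"
  proof (rule o2_le_card_classes[of I \<Sigma> near])
    show "finite I" unfolding I_def using \<C>(1) \<D>(1) by (intro finite_SigmaI) auto
  next
    fix C assume C: "C \<in> \<Sigma>"
    then have Cc: "\<And>l. l < p \<Longrightarrow> C ! l \<in> carrier_mat k k" and len: "length C = p" using \<Sigma> by (auto simp: tuples_def)
    obtain k1 k2 V1 V2 X Y where V: "isometry_pair k k1 k2 V1 V2" and k1: "1 \<le> k1" "1 \<le> k2"
      and X: "X \<in> G k1" and Y: "Y \<in> H k2" and close: "\<And>l. l < p \<Longrightarrow> opnorm (C ! l -
       (V1 * ncpoly_eval (matalg k1) X (g l) * madj V1 + V2 * ncpoly_eval (matalg k2) Y (h l) * madj V2)) < \<kappa>"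
      using dec[OF C] len unfolding decomposes_def by blast
    have k: "k1 \<le> k" "k2 \<le> k" using isometry_pair_dim[OF V] by auto
    have Ve: "madj V1 * V1 = 1\<^sub>m k1" "madj V2 * V2 = 1\<^sub>m k2" "V1 \<in> carrier_mat k k1" "V2 \<in> carrier_mat k k2"
      and [simp]: "dim_row V1 = k" "dim_col V1 = k1" "dim_row V2 = k" "dim_col V2 = k2"
      using V by (auto simp: isometry_pair_def)
    obtain X0 where X0: "X0 \<in> \<C> k1" "X \<in> orbit_ball k1 \<omega>1 X0" using \<C>(4)[of k1] X by blast
    obtain Y0 where Y0: "Y0 \<in> \<D> k2" "Y \<in> orbit_ball k2 \<omega>1 Y0" using \<D>(4)[of k2] Y by blast
    have X0G: "X0 \<in> G k1" "X0 \<in> tuples n k1" and Y0H: "Y0 \<in> H k2" "Y0 \<in> tuples n' k2"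
      and Xt: "X \<in> tuples n k1" and Yt: "Y \<in> tuples n' k2"
      using X0 Y0 X Y \<C>(3) \<D>(3) G(1) H(1) by blast+
    obtain U1 where U1: "unitary_mat k1 U1" "\<And>l. l < p \<Longrightarrow> frob (ncpoly_eval (matalg k1) X (g l) -
      U1 * ncpoly_eval (matalg k1) X0 (g l) * madj U1) \<le> sqrt (real k1) * (L * \<omega>1)"
      using orbit_ball_eval_conj[OF Lg X0(2) G(2)[OF X] X0G(2) G(2)[OF X0G(1)] k1(1) \<omega>1] by blast
    obtain U2 where U2: "unitary_mat k2 U2" "\<And>l. l < p \<Longrightarrow> frob (ncpoly_eval (matalg k2) Y (h l) -
      U2 * ncpoly_eval (matalg k2) Y0 (h l) * madj U2) \<le> sqrt (real k2) * (L' * \<omega>1)"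
      using orbit_ball_eval_conj[OF Lh Y0(2) H(2)[OF Y] Y0H(2) H(2)[OF Y0H(1)] k1(2) \<omega>1] by blast
    have [simp]: "dim_row U1 = k1" "dim_col U1 = k1" "dim_row U2 = k2" "dim_col U2 = k2"
      using U1(1) U2(1) by (auto simp: unitary_mat_def)
    \<comment> \<open>The unitaries of the two orbit balls are absorbed into the isometries, so that
      \<open>C\<close> is compared with values at the centres themselves.\<close>
    have "near ((k1, k2), (X0, Y0)) C"
      unfolding near_def case_prod_conv
    proof (intro exI conjI allI impI)
      show "isometry_pair k k1 k2 (V1 * U1) (V2 * U2)"
        by (rule isometry_pair_unitary[OF V U1(1) U2(1)])
      fix l assume l: "l < p"
      let ?x = "ncpoly_eval (matalg k1) X (g l)" and ?u = "ncpoly_eval (matalg k1) X0 (g l)"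
        and ?y = "ncpoly_eval (matalg k2) Y (h l)" and ?v = "ncpoly_eval (matalg k2) Y0 (h l)"
      note car = gc[OF Xt l] gc[OF X0G(2) l] hc[OF Yt l] hc[OF Y0H(2) l] Cc[OF l]
      note d [simp] = car[THEN carrier_matD(1)] car[THEN carrier_matD(2)]
      let ?D = "V1 * ?x * madj V1 + V2 * ?y * madj V2"
      let ?E = "V1 * U1 * ?u * madj (V1 * U1) + V2 * U2 * ?v * madj (V2 * U2)"
      have "frob (C ! l - ?D) \<le> opnorm (C ! l - ?D) * sqrt (real k)"
        using frob_le_opnorm[of "C ! l - ?D"] by simp
      also have "\<dots> \<le> \<kappa> * sqrt (real k)"
        using close[OF l] by (intro mult_right_mono) auto
      finally have 1: "frob (C ! l - ?D) \<le> sqrt (real k) * \<kappa>" by (simp add: mult.commute)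
      have "?D - ?E = V1 * (?x - U1 * ?u * madj U1) * madj V1 + V2 * (?y - U2 * ?v * madj U2) * madj V2"
        by (simp add: madj_mult mat_dim_simps) (rule eq_matI; simp)
      then have "frob (?D - ?E) \<le> frob (V1 * (?x - U1 * ?u * madj U1) * madj V1) + frob (V2 * (?y - U2 * ?v * madj U2) * madj V2)"
        by (simp add: frob_add)
      also have "\<dots> \<le> frob (?x - U1 * ?u * madj U1) + frob (?y - U2 * ?v * madj U2)"
        by (rule add_mono[OF frob_conj_isometry_le[OF Ve(3,1)] frob_conj_isometry_le[OF Ve(4,2)]];
            rule carrier_matI) simp_all
      also have "\<dots> \<le> sqrt (real k1) * (L * \<omega>1) + sqrt (real k2) * (L' * \<omega>1)"
        by (intro add_mono U1 U2 l)
      also have "\<dots> \<le> sqrt (real k) * (L * \<omega>1) + sqrt (real k) * (L' * \<omega>1)"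
        using k L0 \<omega>1 by (intro add_mono mult_right_mono) auto
      finally have 2: "frob (?D - ?E) \<le> sqrt (real k) * (L * \<omega>1) + sqrt (real k) * (L' * \<omega>1)" .
      have "frob (C ! l - ?E) \<le> frob (C ! l - ?D) + frob (?D - ?E)"
        by (rule frob_triangle) auto
      then show "frob (C ! l - ?E) \<le> sqrt (real k) * \<theta>"
        using 1 2 by (simp add: \<theta>_def algebra_simps)
    qed
    moreover have "((k1, k2), (X0, Y0)) \<in> I"
      using k k1 X0(1) Y0(1) by (simp add: I_def)
    ultimately show "\<exists>\<iota>\<in>I. near \<iota> C" by blast
  next
    fix \<iota> C C' assume \<iota>: "\<iota> \<in> I" "near \<iota> C" "near \<iota> C'" and C: "C \<in> \<Sigma>" "C' \<in> \<Sigma>"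
    obtain k1 k2 X0 Y0 where eq: "\<iota> = ((k1, k2), (X0, Y0))" by (metis surj_pair)
    have "X0 \<in> \<C> k1" "Y0 \<in> \<D> k2" using \<iota>(1) by (auto simp: I_def eq)
    then have X0: "X0 \<in> tuples n k1" and Y0: "Y0 \<in> tuples n' k2" using \<C>(3) \<D>(3) G(1) H(1) by blast+
    obtain V1 V2 where V: "isometry_pair k k1 k2 V1 V2"
      and n1: "\<And>l. l < p \<Longrightarrow> frob (C ! l - (V1 * ncpoly_eval (matalg k1) X0 (g l) * madj V1 +
       V2 * ncpoly_eval (matalg k2) Y0 (h l) * madj V2)) \<le> sqrt (real k) * \<theta>"
      using \<iota>(2) unfolding near_def eq by auto
    obtain V1' V2' where V': "isometry_pair k k1 k2 V1' V2'"
      and n2: "\<And>l. l < p \<Longrightarrow> frob (C' ! l - (V1' * ncpoly_eval (matalg k1) X0 (g l) * madj V1' +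
       V2' * ncpoly_eval (matalg k2) Y0 (h l) * madj V2')) \<le> sqrt (real k) * \<theta>"
      using \<iota>(3) unfolding near_def eq by auto
    have [simp]: "dim_row V1 = k" "dim_row V2 = k" "dim_row V1' = k" "dim_row V2' = k"
      using V V' by (auto simp: isometry_pair_def)
    obtain W where W: "unitary_mat k W" "\<And>M N. M \<in> carrier_mat k1 k1 \<Longrightarrow> N \<in> carrier_mat k2 k2 \<Longrightarrow>
      W * (V1' * M * madj V1' + V2' * N * madj V2') * madj W = V1 * M * madj V1 + V2 * N * madj V2"
      using isometry_pair_change[OF V V'] by blast
    have We: "W \<in> carrier_mat k k" "madj W * W = 1\<^sub>m k" and [simp]: "dim_row W = k" "dim_col W = k"
      using W(1) by (auto simp: unitary_mat_def)
    \<comment> \<open>\<open>W\<close> maps the block matrix near \<open>C'\<close> to the one near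
      \<open>C\<close>; each of the two approximations contributes one
      \<open>\<theta>\<close>.\<close>
    show "C \<in> orbit_ball k \<omega> C'"
    proof (rule orbit_ballI[OF _ _ W(1)])
      show "C \<in> tuples p k" "C' \<in> tuples p k" using C \<Sigma> by auto
      show "0 \<le> 2 * \<theta>" "real p * (2 * \<theta>) < \<omega>" using \<theta> \<omega> by (simp_all add: \<theta>_def)
      fix l assume l: "l < p"
      have Cc: "C ! l \<in> carrier_mat k k" "C' ! l \<in> carrier_mat k k" using C \<Sigma> l by (auto simp: tuples_def)
      note d [simp] = Cc[THEN carrier_matD(1)] Cc[THEN carrier_matD(2)]
      let ?D = "V1 * ncpoly_eval (matalg k1) X0 (g l) * madj V1 + V2 * ncpoly_eval (matalg k2) Y0 (h l) * madj V2"
      let ?D' = "V1' * ncpoly_eval (matalg k1) X0 (g l) * madj V1' + V2' * ncpoly_eval (matalg k2) Y0 (h l) * madj V2'"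
      have "frob (C ! l - W * C' ! l * madj W) \<le> frob (C ! l - ?D) + frob (?D - W * C' ! l * madj W)"
        by (rule frob_triangle) auto
      also have "?D - W * C' ! l * madj W = W * (?D' - C' ! l) * madj W"
        using W(2)[OF gc[OF X0 l] hc[OF Y0 l]] by (simp add: mult_minus_distrib_mat_dim minus_mult_distrib_mat_dim)
      also have "frob \<dots> \<le> frob (?D' - C' ! l)"
        by (rule frob_conj_isometry_le[OF We]) (auto intro!: carrier_matI)
      also have "\<dots> = frob (C' ! l - ?D')" by (rule frob_minus_commute) auto
      finally show "frob (C ! l - W * C' ! l * madj W) \<le> sqrt (real k) * (2 * \<theta>)"
        using n1[OF l] n2[OF l] by simp
    qed
  qed
  also have "card I = (\<Sum>(k1, k2)\<in>{1..k} \<times> {1..k}. card (\<C> k1 \<times> \<D> k2))"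
    unfolding I_def using \<C>(1) \<D>(1) by (subst card_SigmaI) (auto simp: case_prod_unfold)
  also have "\<dots> = (\<Sum>(k1, k2)\<in>{1..k} \<times> {1..k}. o2 k1 (G k1) \<omega>1 * o2 k2 (H k2) \<omega>1)"
    by (intro sum.cong) (auto simp: card_cartesian_product \<C>(2) \<D>(2))
  finally show ?thesis .
qed

subsection \<open>The topological orbit dimension\<close>

text \<open>Logarithms of positive integers are nonnegative, so the only negative value is that of
  log 0.\<close>

lemma log_ratio_less_0: "log_ratio N k < 0 \<Longrightarrow> N = 0"
proof (rule ccontr)
  assume neg: "log_ratio N k < 0" and "N \<noteq> 0"
  then have "0 \<le> ln (real N) / (real k)\<^sup>2" by simp
  with neg \<open>N \<noteq> 0\<close> show False by (simp add: log_ratio_def)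
qed

text \<open>A splitting of a large k may involve a small size, so the bound is needed for all sizes.
  The finitely many exceptions go into \<open>M\<close>, whose logarithm disappears after division
  by k^2.\<close>

lemma ex_real_eventual_bound:
  assumes ev: "\<forall>\<^sub>F k in sequentially. log_ratio (N k) k < ereal c"
  obtains M where "M \<ge> 1" "\<And>k. real (N k) \<le> M * exp (c * (real k)\<^sup>2)"
proof -
  obtain K where K: "\<And>k. k \<ge> K \<Longrightarrow> log_ratio (N k) k < ereal c"
    using ev by (auto simp: eventually_sequentially)
  define M where "M = 1 + (\<Sum>k\<le>K. real (N k) / exp (c * (real k)\<^sup>2))"
  have "0 \<le> (\<Sum>k\<le>K. real (N k) / exp (c * (real k)\<^sup>2))"
    by (intro sum_nonneg) auto
  then have M: "M \<ge> 1" by (simp add: M_def)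
  have "real (N k) \<le> M * exp (c * (real k)\<^sup>2)" for k
  proof (cases "k \<le> K")
    case True
    have "real (N k) / exp (c * (real k)\<^sup>2) \<le> (\<Sum>k\<le>K. real (N k) / exp (c * (real k)\<^sup>2))"
      using True by (intro member_le_sum) auto
    also have "\<dots> \<le> M" by (simp add: M_def)
    finally show ?thesis by (simp add: field_simps)
  next
    case False
    show ?thesis
    proof (cases "N k = 0")
      case True
      then show ?thesis using M by simp
    next
      case N: False
      with K[of k] False have "ln (real (N k)) / (real k)\<^sup>2 < c" by (simp add: log_ratio_def)
      moreover have "(real k)\<^sup>2 > 0" using False by simp
      ultimately have "ln (real (N k)) < c * (real k)\<^sup>2" by (simp add: pos_divide_less_eq)
      then have "exp (ln (real (N k))) \<le> exp (c * (real k)\<^sup>2)" by simp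
      then have "real (N k) \<le> 1 * exp (c * (real k)\<^sup>2)" using N by simp
      also have "\<dots> \<le> M * exp (c * (real k)\<^sup>2)" using M by (intro mult_right_mono) auto
      finally show ?thesis .
    qed
  qed
  with M that show ?thesis by blast
qed

text \<open>The number of pairs contributes 2 ln k and the constants ln (M1 M2), both negligible
  against k^2. Nonnegativity of \<open>c1\<close> and \<open>c2\<close> allows k1^2 and k2^2 to be
  replaced by k^2.\<close>

lemma limsup_log_ratio_le:
  assumes N: "\<And>k. N k \<le> (\<Sum>(k1, k2)\<in>{1..k} \<times> {1..k}. N1 k1 * N2 k2)"
    and N1: "\<forall>\<^sub>F k in sequentially. log_ratio (N1 k) k < ereal c1" and c1: "c1 \<ge> 0"
    and N2: "\<forall>\<^sub>F k in sequentially. log_ratio (N2 k) k < ereal c2" and c2: "c2 \<ge> 0"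
  shows "limsup (\<lambda>k. log_ratio (N k) k) \<le> ereal (c1 + c2)"
proof -
  obtain M1 where M1: "M1 \<ge> 1" "\<And>k. real (N1 k) \<le> M1 * exp (c1 * (real k)\<^sup>2)"
    using ex_real_eventual_bound[OF N1] by blast
  obtain M2 where M2: "M2 \<ge> 1" "\<And>k. real (N2 k) \<le> M2 * exp (c2 * (real k)\<^sup>2)"
    using ex_real_eventual_bound[OF N2] by blast
  define m where "m = ln (M1 * M2)"
  have bound: "log_ratio (N k) k \<le> ereal (2 / real k + m / real k * (1 / real k) + (c1 + c2))" if k: "k \<ge> 1" for k
  proof (cases "N k = 0")
    case False
    define E where "E = exp ((c1 + c2) * (real k)\<^sup>2)"
    have "real (N k) \<le> real (\<Sum>(k1, k2)\<in>{1..k} \<times> {1..k}. N1 k1 * N2 k2)"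
      using N[of k] by (simp only: of_nat_le_iff)
    also have "\<dots> = (\<Sum>(k1, k2)\<in>{1..k} \<times> {1..k}. real (N1 k1) * real (N2 k2))"
      by (simp add: case_prod_unfold)
    also have "\<dots> \<le> (\<Sum>(k1, k2)\<in>{1..k} \<times> {1..k}. M1 * M2 * E)"
    proof (rule sum_mono, clarify)
      fix k1 k2 assume "k1 \<in> {1..k}" "k2 \<in> {1..k}"
      then have kk: "(real k1)\<^sup>2 \<le> (real k)\<^sup>2" "(real k2)\<^sup>2 \<le> (real k)\<^sup>2" by (auto intro: power_mono)
      have "real (N1 k1) \<le> M1 * exp (c1 * (real k)\<^sup>2)"
        using kk c1 M1 by (intro order.trans[OF M1(2)] mult_left_mono) (auto intro: mult_left_mono)
      moreover have "real (N2 k2) \<le> M2 * exp (c2 * (real k)\<^sup>2)"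
        using kk c2 M2 by (intro order.trans[OF M2(2)] mult_left_mono) (auto intro: mult_left_mono)
      ultimately have "real (N1 k1) * real (N2 k2) \<le> (M1 * exp (c1 * (real k)\<^sup>2)) * (M2 * exp (c2 * (real k)\<^sup>2))"
        using M1 by (intro mult_mono) auto
      then show "real (N1 k1) * real (N2 k2) \<le> M1 * M2 * E"
        by (simp add: E_def distrib_right exp_add mult_ac)
    qed
    also have "\<dots> = (real k)\<^sup>2 * (M1 * M2 * E)"
      by (simp add: case_prod_unfold power2_eq_square)
    finally have "ln (real (N k)) \<le> ln ((real k)\<^sup>2 * (M1 * M2 * E))"
      using False by simp
    also have "\<dots> = 2 * ln (real k) + m + (c1 + c2) * (real k)\<^sup>2"
      using k M1(1) M2(1) by (simp add: ln_mult ln_realpow E_def m_def)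
    also have "\<dots> \<le> 2 * real k + m + (c1 + c2) * (real k)\<^sup>2"
      using ln_bound[of "real k"] k by simp
    finally have "ln (real (N k)) / (real k)\<^sup>2 \<le> (2 * real k + m + (c1 + c2) * (real k)\<^sup>2) / (real k)\<^sup>2"
      by (rule divide_right_mono) simp
    also have "\<dots> = 2 / real k + m / real k * (1 / real k) + (c1 + c2)"
      using k by (simp add: field_simps power2_eq_square)
    finally show ?thesis using False by (simp add: log_ratio_def)
  qed (simp add: log_ratio_def)
  have "(\<lambda>k. 2 / real k + m / real k * (1 / real k) + (c1 + c2)) \<longlonglongrightarrow> 0 + 0 * 0 + (c1 + c2)"
    by (intro tendsto_intros lim_const_over_n)
  then have "limsup (\<lambda>k. ereal (2 / real k + m / real k * (1 / real k) + (c1 + c2))) = ereal (c1 + c2)"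
    by (intro lim_imp_Limsup) auto
  moreover have "limsup (\<lambda>k. log_ratio (N k) k) \<le> limsup (\<lambda>k. ereal (2 / real k + m / real k * (1 / real k) + (c1 + c2)))"
    by (intro Limsup_mono eventually_mono[OF eventually_ge_at_top[of 1]] bound)
  ultimately show ?thesis by simp
qed

section \<open>Access to the suprema, infima and upper limits in the definition\<close>

lemma Gamma_top_tuples: "Gamma_top A x R k \<epsilon> P r \<subseteq> tuples (length x) k"
  by (auto simp: Gamma_top_def)

lemma Gamma_top_norm: "X \<in> Gamma_top A x R k \<epsilon> P r \<Longrightarrow> i < length x \<Longrightarrow> opnorm (X ! i) \<le> R"
  by (auto simp: Gamma_top_def)

lemma Gamma_top_o2_0:
  assumes "o2 k (Gamma_top A x R k \<epsilon> P r) \<omega> = 0" "\<omega> > 0"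
  shows "Gamma_top A x R k \<epsilon> P r = {}"
proof -
  have "\<exists>C. finite C \<and> C \<subseteq> Gamma_top A x R k \<epsilon> P r \<and>
      Gamma_top A x R k \<epsilon> P r \<subseteq> (\<Union>B\<in>C. orbit_ball k \<omega> B)"
    by (rule finite_orbit_cover[OF Gamma_top_tuples Gamma_top_norm assms(2)])
  then show ?thesis by (rule o2_attained) (use assms(1) in auto)
qed

lemma Ktop_eventually:
  assumes "Ktop A x P < c"
  shows "\<forall>\<^sub>F \<omega> in at_right 0. Ktop_omega A x P \<omega> < c"
  using assms unfolding Ktop_def by (rule Limsup_lessD)

lemma Ktop_omega_lessD:
  assumes "Ktop_omega A x P \<omega> < c" "R > 0"
  obtains \<epsilon> r where "\<epsilon> > 0" "r \<ge> 1"
    "\<forall>\<^sub>F k in sequentially. log_ratio (o2 k (Gamma_top A x R k \<epsilon> P r) \<omega>) k < c"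
proof -
  have "(INF p\<in>{0<..} \<times> {1..}. limsup (\<lambda>k. log_ratio (o2 k (Gamma_top A x R k (fst p) P (snd p)) \<omega>) k))
      \<le> Ktop_omega A x P \<omega>"
    unfolding Ktop_omega_def by (rule SUP_upper) (use assms(2) in simp)
  then obtain p where "p \<in> {0<..} \<times> {1..}"
      "limsup (\<lambda>k. log_ratio (o2 k (Gamma_top A x R k (fst p) P (snd p)) \<omega>) k) < c"
    using assms(1) by (metis (no_types, lifting) INF_less_iff le_less_trans)
  then show ?thesis
    by (intro that[of "fst p" "snd p"] Limsup_lessD) auto
qed

lemma Ktop_omega_leI:
  assumes "\<And>R. R > 0 \<Longrightarrow> \<exists>\<epsilon>>0. \<exists>r\<ge>1. limsup (\<lambda>k. log_ratio (o2 k (Gamma_top A x R k \<epsilon> P r) \<omega>) k) \<le> c"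
  shows "Ktop_omega A x P \<omega> \<le> c"
  unfolding Ktop_omega_def
proof (rule SUP_least)
  fix R :: real assume "R \<in> {0<..}"
  then obtain \<epsilon> r where "\<epsilon> > 0" "r \<ge> 1" "limsup (\<lambda>k. log_ratio (o2 k (Gamma_top A x R k \<epsilon> P r) \<omega>) k) \<le> c"
    using assms[of R] by auto
  then show "(INF p\<in>{0<..} \<times> {1..}. limsup (\<lambda>k. log_ratio (o2 k (Gamma_top A x R k (fst p) P (snd p)) \<omega>) k)) \<le> c"
    by (intro INF_lower2[of "(\<epsilon>, r)"]) auto
qed

lemma Ktop_leI:
  assumes "\<And>\<omega>. \<omega> > 0 \<Longrightarrow> Ktop_omega A x P \<omega> \<le> c"
  shows "Ktop A x P \<le> c"
  unfolding Ktop_def by (rule Limsup_bounded) (auto simp: eventually_at_filter assms)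

lemma eventually_at_right_less:
  fixes \<delta> :: real assumes "\<delta> > 0"
  shows "\<forall>\<^sub>F \<omega> in at_right 0. 0 < \<omega> \<and> \<omega> < \<delta>"
  using eventually_at_right_real[OF assms] by (rule eventually_mono) simp

lemma limsup_log_ratio_empty:
  assumes "\<And>k. \<Sigma> k = {}"
  shows "limsup (\<lambda>k. log_ratio (o2 k (\<Sigma> k) \<omega>) k) = -\<infinity>"
proof -
  have "o2 k (\<Sigma> k) \<omega> = 0" for k using o2_le[of "{}" "\<Sigma> k" k \<omega>] by (simp add: assms)
  then show ?thesis by (simp add: log_ratio_def Limsup_const)
qed

text \<open>A negative value forces log 0, hence empty spaces, for large sizes, and doubling extends
  this to all sizes from 1 on. The radius is chosen below \<open>\<delta>\<close> because
  \<open>comparison\<close> asks for that.\<close>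

lemma Ktop_negative_empty:
  fixes \<delta> :: real
  assumes neg: "Ktop A x P < 0" and "\<delta> > 0" "R > 0"
    and P: "\<And>j. j \<ge> 1 \<Longrightarrow> P j \<in> ncpolys (length x)"
  shows "\<exists>\<omega> \<epsilon> r. 0 < \<omega> \<and> \<omega> < \<delta> \<and> \<epsilon> > 0 \<and> (\<forall>k\<ge>1. Gamma_top A x R k \<epsilon> P r = {})"
proof -
  from eventually_conj[OF Ktop_eventually[OF neg] eventually_at_right_less[OF assms(2)]]
  obtain \<omega> where \<omega>: "Ktop_omega A x P \<omega> < 0" "0 < \<omega>" "\<omega> < \<delta>"
    using eventually_happens[of _ "at_right (0::real)"] by fastforce
  obtain \<epsilon> r where er: "\<epsilon> > 0" "r \<ge> 1"
    "\<forall>\<^sub>F k in sequentially. log_ratio (o2 k (Gamma_top A x R k \<epsilon> P r) \<omega>) k < 0"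
    using Ktop_omega_lessD[OF \<omega>(1) assms(3)] by blast
  from er(3) have "\<forall>\<^sub>F k in sequentially. Gamma_top A x R k \<epsilon> P r = {}"
    by eventually_elim (use Gamma_top_o2_0 log_ratio_less_0 \<omega>(2) in blast)
  then have "Gamma_top A x R k \<epsilon> P r = {}" if "k \<ge> 1" for k
    by (intro Gamma_top_empty that) (simp_all add: P)
  with \<omega>(2,3) er(1) show ?thesis by blast
qed

context direct_sum_generators
begin

text \<open>The second clause carries emptiness from either summand over to \<open>z\<close>, which
  is how the value \<open>-\<infinity>\<close> propagates.\<close>

definition comparable :: "real \<Rightarrow> real \<Rightarrow> real \<Rightarrow> nat \<Rightarrow> real \<Rightarrow> nat \<Rightarrow> real \<Rightarrow> real \<Rightarrow> nat \<Rightarrow> bool" where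
  "comparable \<omega> \<omega>1 \<epsilon>1 r1 \<epsilon>2 r2 R \<epsilon> r \<longleftrightarrow> (\<forall>k.
     o2 k (Gz R \<epsilon> r k) \<omega> \<le>
       (\<Sum>(k1, k2)\<in>{1..k} \<times> {1..k}. o2 k1 (Gx \<epsilon>1 r1 k1) \<omega>1 * o2 k2 (Gy \<epsilon>2 r2 k2) \<omega>1) \<and>
     (Gz R \<epsilon> r k \<noteq> {} \<longrightarrow> (\<exists>k1\<ge>1. Gx \<epsilon>1 r1 k1 \<noteq> {}) \<and> (\<exists>k2\<ge>1. Gy \<epsilon>2 r2 k2 \<noteq> {})))"

text \<open>The polynomials expressing \<open>z\<close> through \<open>x\<close> and \<open>y\<close>, and with them \<open>\<delta>\<close>, have to be chosen
  before the parameters of the microstates of \<open>x\<close> and \<open>y\<close>, on which those of \<open>z\<close> depend.\<close>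

lemma comparison:
  assumes \<omega>: "\<omega> > 0"
  shows "\<exists>\<delta>>0. \<forall>\<omega>1 \<epsilon>1 r1 \<epsilon>2 r2 R. 0 < \<omega>1 \<longrightarrow> \<omega>1 < \<delta> \<longrightarrow> \<epsilon>1 > 0 \<longrightarrow> \<epsilon>2 > 0 \<longrightarrow>
    (\<exists>\<epsilon>>0. \<exists>r\<ge>1. comparable \<omega> \<omega>1 \<epsilon>1 r1 \<epsilon>2 r2 R \<epsilon> r)"
proof -
  define p where "p = length z"
  \<comment> \<open>Below, \<open>\<delta>\<close> is chosen so that both Lipschitz errors together
    are at most \<open>\<kappa>\<close>. The radius demanded by \<open>o2_decomposes\<close> is then
    at most 4 p \<open>\<kappa>\<close>, which is less than \<open>\<omega>\<close>.\<close>
  define \<kappa> where "\<kappa> = \<omega> / (4 * (real p + 1))"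
  have \<kappa>: "\<kappa> > 0" using \<omega> by (simp add: \<kappa>_def)
  have "\<exists>P\<in>ncpolys (length x). cnorm A (csub A (fst (z ! l)) (ncpoly_eval A x P)) < \<kappa>" for l
    using x(3) \<kappa> by (auto simp: generates_def)
  then obtain g where g: "\<And>l. g l \<in> ncpolys (length x)"
    "\<And>l. cnorm A (csub A (fst (z ! l)) (ncpoly_eval A x (g l))) < \<kappa>" by metis
  have "\<exists>P\<in>ncpolys (length y). cnorm B (csub B (snd (z ! l)) (ncpoly_eval B y P)) < \<kappa>" for l
    using y(3) \<kappa> by (auto simp: generates_def)
  then obtain h where h: "\<And>l. h l \<in> ncpolys (length y)"
    "\<And>l. cnorm B (csub B (snd (z ! l)) (ncpoly_eval B y (h l))) < \<kappa>" by metis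
  obtain L where L: "Lipschitz_evals p (length x) g R1 L" using Lipschitz_evals_exists[of p g "length x" R1, OF g(1)] .
  obtain L' where L': "Lipschitz_evals p (length y) h R2 L'" using Lipschitz_evals_exists[of p h "length y" R2, OF h(1)] .
  have L0: "0 \<le> L" "0 \<le> L'" using L L' by (auto simp: Lipschitz_evals_def)
  define \<delta> where "\<delta> = \<kappa> / (L + L' + 1)"
  have \<delta>: "\<delta> > 0" using \<kappa> L0 by (simp add: \<delta>_def)
  show ?thesis
  proof (rule exI[of _ \<delta>], intro conjI allI impI \<delta>)
    fix \<omega>1 \<epsilon>1 :: real and r1 :: nat and \<epsilon>2 :: real and r2 :: nat and R
    assume \<omega>1: "0 < \<omega>1" "\<omega>1 < \<delta>" and eps: "\<epsilon>1 > 0" "\<epsilon>2 > 0"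
    have "(L + L') * \<omega>1 \<le> (L + L' + 1) * \<delta>" using L0 \<omega>1 by (intro mult_mono) auto
    also have "\<dots> = \<kappa>" using L0 by (simp add: \<delta>_def)
    finally have "\<kappa> + L * \<omega>1 + L' * \<omega>1 \<le> 2 * \<kappa>" by (simp add: algebra_simps)
    then have "real p * (2 * (\<kappa> + L * \<omega>1 + L' * \<omega>1)) \<le> real p * (4 * \<kappa>)"
      by (intro mult_left_mono) auto
    also have "\<dots> < \<omega>" using \<omega> by (simp add: \<kappa>_def field_simps)
    finally have small: "real p * (2 * (\<kappa> + L * \<omega>1 + L' * \<omega>1)) < \<omega>" .
    obtain \<epsilon> r where er: "\<epsilon> > 0" "r \<ge> 1"
      "\<And>k C. C \<in> Gz R \<epsilon> r k \<Longrightarrow> decomposes (Gx \<epsilon>1 r1) (Gy \<epsilon>2 r2) g h \<kappa> k C"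
      using Gz_decomposes[OF eps g h] by blast
    have "o2 k (Gz R \<epsilon> r k) \<omega> \<le>
        (\<Sum>(k1, k2)\<in>{1..k} \<times> {1..k}. o2 k1 (Gx \<epsilon>1 r1 k1) \<omega>1 * o2 k2 (Gy \<epsilon>2 r2 k2) \<omega>1)" for k
      by (rule o2_decomposes[OF er(3) _ Gamma_top_tuples Gamma_top_norm Gamma_top_tuples Gamma_top_norm L L' \<omega>1(1) \<kappa> small])
        (simp_all add: Gamma_top_tuples p_def)
    moreover have "(\<exists>k1\<ge>1. Gx \<epsilon>1 r1 k1 \<noteq> {}) \<and> (\<exists>k2\<ge>1. Gy \<epsilon>2 r2 k2 \<noteq> {})"
      if ne: "Gz R \<epsilon> r k \<noteq> {}" for k
    proof -
      obtain C where "C \<in> Gz R \<epsilon> r k" using ne by blast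
      from er(3)[OF this] show ?thesis unfolding decomposes_def by blast
    qed
    ultimately show "\<exists>\<epsilon>>0. \<exists>r\<ge>1. comparable \<omega> \<omega>1 \<epsilon>1 r1 \<epsilon>2 r2 R \<epsilon> r"
      unfolding comparable_def
      using er(1,2) by blast
  qed
qed

lemma Ktop_eq_minus_infinity:
  assumes "Ktop A x Px < 0 \<or> Ktop B y Py < 0"
  shows "Ktop D z Pz = -\<infinity>"
proof -
  have "Ktop D z Pz \<le> -\<infinity>"
  proof (rule Ktop_leI)
    fix \<omega> :: real assume "\<omega> > 0"
    from comparison[OF this] obtain \<delta> where \<delta>: "\<delta> > 0" "\<And>\<omega>1 \<epsilon>1 r1 \<epsilon>2 r2 R.
        0 < \<omega>1 \<Longrightarrow> \<omega>1 < \<delta> \<Longrightarrow> \<epsilon>1 > 0 \<Longrightarrow> \<epsilon>2 > 0 \<Longrightarrow> \<exists>\<epsilon>>0. \<exists>r\<ge>1. comparable \<omega> \<omega>1 \<epsilon>1 r1 \<epsilon>2 r2 R \<epsilon> r"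
      by blast
    have "\<exists>\<omega>1 \<epsilon>1 r1 \<epsilon>2 r2. 0 < \<omega>1 \<and> \<omega>1 < \<delta> \<and> \<epsilon>1 > 0 \<and> \<epsilon>2 > 0 \<and>
        ((\<forall>k\<ge>1. Gx \<epsilon>1 r1 k = {}) \<or> (\<forall>k\<ge>1. Gy \<epsilon>2 r2 k = {}))"
      using assms
    proof
      assume "Ktop A x Px < 0"
      then have "\<exists>\<omega>1 \<epsilon>1 r1. 0 < \<omega>1 \<and> \<omega>1 < \<delta> \<and> \<epsilon>1 > 0 \<and> (\<forall>k\<ge>1. Gx \<epsilon>1 r1 k = {})"
        by (rule Ktop_negative_empty[OF _ \<delta>(1) x(5)]) (simp add: x(4))
      then show ?thesis using \<delta>(1) by blast
    next
      assume "Ktop B y Py < 0"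
      then have "\<exists>\<omega>1 \<epsilon>2 r2. 0 < \<omega>1 \<and> \<omega>1 < \<delta> \<and> \<epsilon>2 > 0 \<and> (\<forall>k\<ge>1. Gy \<epsilon>2 r2 k = {})"
        by (rule Ktop_negative_empty[OF _ \<delta>(1) y(5)]) (simp add: y(4))
      then show ?thesis using \<delta>(1) by blast
    qed
    then obtain \<omega>1 \<epsilon>1 r1 \<epsilon>2 r2 where pos: "0 < \<omega>1" "\<omega>1 < \<delta>" "\<epsilon>1 > 0" "\<epsilon>2 > 0"
      and empty: "(\<forall>k\<ge>1. Gx \<epsilon>1 r1 k = {}) \<or> (\<forall>k\<ge>1. Gy \<epsilon>2 r2 k = {})"
      by blast
    show "Ktop_omega D z Pz \<omega> \<le> -\<infinity>"
    proof (rule Ktop_omega_leI)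
      fix R :: real
      from \<delta>(2)[OF pos, of r1 r2 R] obtain \<epsilon> r where er: "\<epsilon> > 0" "r \<ge> 1"
        "comparable \<omega> \<omega>1 \<epsilon>1 r1 \<epsilon>2 r2 R \<epsilon> r" by blast
      have none: "Gz R \<epsilon> r k = {}" for k
        using er(3) empty unfolding comparable_def by blast
      from er limsup_log_ratio_empty[of "Gz R \<epsilon> r" \<omega>, OF none]
      show "\<exists>\<epsilon>>0. \<exists>r\<ge>1. limsup (\<lambda>k. log_ratio (o2 k (Gz R \<epsilon> r k) \<omega>) k) \<le> -\<infinity>"
        by (intro exI[of _ \<epsilon>] conjI exI[of _ r]) auto
    qed
  qed
  then show ?thesis by simp
qed

lemma Ktop_le_sum:
  assumes c: "Ktop A x Px < ereal c1" "0 \<le> c1" "Ktop B y Py < ereal c2" "0 \<le> c2"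
  shows "Ktop D z Pz \<le> ereal (c1 + c2)"
proof (rule Ktop_leI)
  fix \<omega> :: real assume "\<omega> > 0"
  from comparison[OF this] obtain \<delta> where \<delta>: "\<delta> > 0" "\<And>\<omega>1 \<epsilon>1 r1 \<epsilon>2 r2 R.
      0 < \<omega>1 \<Longrightarrow> \<omega>1 < \<delta> \<Longrightarrow> \<epsilon>1 > 0 \<Longrightarrow> \<epsilon>2 > 0 \<Longrightarrow> \<exists>\<epsilon>>0. \<exists>r\<ge>1. comparable \<omega> \<omega>1 \<epsilon>1 r1 \<epsilon>2 r2 R \<epsilon> r"
    by blast
  \<comment> \<open>An upper limit below a bound gives the bound for all small radii, so one radius
    \<open>\<omega>1\<close> below \<open>\<delta>\<close> serves both summands.\<close>
  from eventually_conj[OF Ktop_eventually[OF c(1)]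
      eventually_conj[OF Ktop_eventually[OF c(3)] eventually_at_right_less[OF \<delta>(1)]]]
  obtain \<omega>1 where \<omega>1: "Ktop_omega A x Px \<omega>1 < ereal c1" "Ktop_omega B y Py \<omega>1 < ereal c2"
      "0 < \<omega>1" "\<omega>1 < \<delta>"
    using eventually_happens[of _ "at_right (0::real)"] by fastforce
  obtain \<epsilon>1 r1 where 1: "\<epsilon>1 > 0" "\<forall>\<^sub>F k in sequentially. log_ratio (o2 k (Gx \<epsilon>1 r1 k) \<omega>1) k < ereal c1"
    using Ktop_omega_lessD[OF \<omega>1(1) x(5)] by blast
  obtain \<epsilon>2 r2 where 2: "\<epsilon>2 > 0" "\<forall>\<^sub>F k in sequentially. log_ratio (o2 k (Gy \<epsilon>2 r2 k) \<omega>1) k < ereal c2"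
    using Ktop_omega_lessD[OF \<omega>1(2) y(5)] by blast
  show "Ktop_omega D z Pz \<omega> \<le> ereal (c1 + c2)"
  proof (rule Ktop_omega_leI)
    fix R :: real
    from \<delta>(2)[OF \<omega>1(3,4) 1(1) 2(1), of r1 r2 R] obtain \<epsilon> r where er: "\<epsilon> > 0" "r \<ge> 1"
      "comparable \<omega> \<omega>1 \<epsilon>1 r1 \<epsilon>2 r2 R \<epsilon> r" by blast
    have "o2 k (Gz R \<epsilon> r k) \<omega> \<le>
        (\<Sum>(k1, k2)\<in>{1..k} \<times> {1..k}. o2 k1 (Gx \<epsilon>1 r1 k1) \<omega>1 * o2 k2 (Gy \<epsilon>2 r2 k2) \<omega>1)" for k
      using er(3) unfolding comparable_def by blast
    from limsup_log_ratio_le[OF this 1(2) c(2) 2(2) c(4)] er(1,2)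
    show "\<exists>\<epsilon>>0. \<exists>r\<ge>1. limsup (\<lambda>k. log_ratio (o2 k (Gz R \<epsilon> r k) \<omega>) k) \<le> ereal (c1 + c2)"
      by blast
  qed
qed

end

theorem theorem3p5:
  fixes A :: "'a calg" and B :: "'b calg"
    and x :: "'a list" and y :: "'b list" and z :: "('a \<times> 'b) list"
    and Px Py Pz :: "nat \<Rightarrow> nat list \<Rightarrow> complex"
  assumes "unital_cstar_algebra A" and "unital_cstar_algebra B"
    and "\<forall>i<length x. self_adjoint A (x ! i)" and "generates A x"
    and "\<forall>i<length y. self_adjoint B (y ! i)" and "generates B y"
    and "\<forall>i<length z. self_adjoint (cdirect_sum A B) (z ! i)"
    and "generates (cdirect_sum A B) z"
    and "enumerates (length x) Px" and "enumerates (length y) Py"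
    and "enumerates (length z) Pz"
  shows "Ktop (cdirect_sum A B) z Pz \<le> eplus (Ktop A x Px) (Ktop B y Py)"
proof -
  let ?D = "cdirect_sum A B"
  have A: "cstar_algebra A" and B: "cstar_algebra B"
    using assms(1,2) by (auto simp: cstar_algebra_def)
  interpret A: cstar_algebra A by (rule A)
  interpret B: cstar_algebra B by (rule B)
  have Px: "Px j \<in> ncpolys (length x)" if "j \<ge> 1" for j
    using assms(9) that by (auto simp: enumerates_def bij_betw_def intro: rat_ncpolys_ncpolys)
  have Py: "Py j \<in> ncpolys (length y)" if "j \<ge> 1" for j
    using assms(10) that by (auto simp: enumerates_def bij_betw_def intro: rat_ncpolys_ncpolys)
  \<comment> \<open>The added 1 makes the cut-off strictly larger than each norm, and positive even
    for an empty family.\<close>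
  define R1 where "R1 = (\<Sum>i<length x. cnorm A (x ! i)) + 1"
  define R2 where "R2 = (\<Sum>i<length y. cnorm B (y ! i)) + 1"
  have R1: "R1 > 0" and R2: "R2 > 0"
    by (auto simp: R1_def R2_def intro!: add_nonneg_pos sum_nonneg)
  have x: "cstar A (x ! i) = x ! i" "cnorm A (x ! i) < R1" if "i < length x" for i
    using assms(3) that member_le_sum[of i "{..<length x}" "\<lambda>i. cnorm A (x ! i)"]
    by (auto simp: self_adjoint_def R1_def)
  have y: "cstar B (y ! i) = y ! i" "cnorm B (y ! i) < R2" if "i < length y" for i
    using assms(5) that member_le_sum[of i "{..<length y}" "\<lambda>i. cnorm B (y ! i)"]
    by (auto simp: self_adjoint_def R2_def)
  have z: "cstar ?D (z ! i) = z ! i" if "i < length z" for i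
    using assms(7) that by (simp add: self_adjoint_def)
  interpret direct_sum_generators A B x y z Px Py Pz R1 R2
    by (intro direct_sum_generators.intro direct_sum_generators_axioms.intro A B)
      (simp_all add: x y z Px Py R1 R2 assms del: cdirect_sum_simps)
  show ?thesis
  \<comment> \<open>With a negative summand the left side is \<open>-\<infinity>\<close>, whatever
    the other summand is; this settles in particular the combination of \<open>-\<infinity>\<close>
    with \<open>\<infinity>\<close>.\<close>
  proof (cases "Ktop A x Px < 0 \<or> Ktop B y Py < 0")
    case True
    then show ?thesis by (simp add: Ktop_eq_minus_infinity)
  next
    case False
    then have nonneg: "0 \<le> Ktop A x Px" "0 \<le> Ktop B y Py" by auto
    then have eplus: "eplus (Ktop A x Px) (Ktop B y Py) = Ktop A x Px + Ktop B y Py"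
      by (auto simp: eplus_def)
    show ?thesis
    proof (cases "Ktop A x Px = \<infinity> \<or> Ktop B y Py = \<infinity>")
      case True
      then show ?thesis unfolding eplus by auto
    next
      case False
      with nonneg obtain a b where ab: "Ktop A x Px = ereal a" "Ktop B y Py = ereal b" "0 \<le> a" "0 \<le> b"
        by (cases "Ktop A x Px"; cases "Ktop B y Py") auto
      \<comment> \<open>\<open>Ktop_le_sum\<close> needs strict upper bounds, so each summand is
        enlarged by e/2.\<close>
      have "Ktop ?D z Pz \<le> ereal (a + b) + ereal e" if "e > 0" for e
        using Ktop_le_sum[of "a + e / 2" "b + e / 2"] ab that by (simp add: add_ac)
      then have "Ktop ?D z Pz \<le> ereal (a + b)" by (blast intro: ereal_le_epsilon2)
      then show ?thesis unfolding eplus unfolding ab by simp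
    qed
  qed
qed

end
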